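(* Let $\mathfrak{g}_2$ be the compact real simple Lie algebra of type $G_2$. There is, up to conjugation, only one principal three-dimensional subalgebra of $\mathfrak{g}_2$; that is, principal three-dimensional subalgebras of $\mathfrak{g}_2$ exist, and for any two of them $\mathfrak{s},\mathfrak{s}'$ there is an automorphism $\Psi$ of the Lie algebra $\mathfrak{g}_2$ with $\Psi(\mathfrak{s})=\mathfrak{s}'$.
   Context: $\mathfrak{g}_2=\mathfrak{der}(\mathbb{O})$ is the Lie algebra of derivations of the real octonion division algebra $\mathbb{O}$. In a complex semisimple Lie algebra $\mathfrak{g}$, an $\mathfrak{sl}_2$-triple is a triple $\{e,h,f\}$ with $[h,e]=2e$, $[h,f]=-2f$, $[e,f]=h$. A nilpotent element $e$ is principal if its centralizer $\{z\in\mathfrak{g}:[z,e]=0\}$ has dimension equal to $\mathrm{rank}\,\mathfrak{g}$. A principal subalgebra of $\mathfrak{g}$ is the span of an $\mathfrak{sl}_2$-triple $\{e,h,f\}$ with $e$ a principal nilpotent. A three-dimensional simple subalgebra of a simple compact real Lie algebra is called principal if its complexification is a principal subalgebra of the complexified Lie algebra. *)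

theory Defs
  imports "HOL-Analysis.Analysis"
begin

section \<open>Octonions\<close>

text \<open>
  Cayley-Dickson doubling, twice, starting from the complex numbers. The product type carries the
  Euclidean structure of real dimension 8.
\<close>

type_synonym quat = "complex \<times> complex"
type_synonym octonion = "quat \<times> quat"

definition quat_cnj :: "quat \<Rightarrow> quat" where
  "quat_cnj p = (cnj (fst p), - snd p)"

definition quat_mult :: "quat \<Rightarrow> quat \<Rightarrow> quat" where
  "quat_mult p q =
     (fst p * fst q - cnj (snd q) * snd p, snd q * fst p + snd p * cnj (fst q))"

definition oct_mult :: "octonion \<Rightarrow> octonion \<Rightarrow> octonion"  (infixl \<open>\<otimes>\<^sub>O\<close> 70) where
  "x \<otimes>\<^sub>O y =
     (quat_mult (fst x) (fst y) - quat_mult (quat_cnj (snd y)) (snd x),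
      quat_mult (snd y) (fst x) + quat_mult (snd x) (quat_cnj (fst y)))"

definition oct_one :: octonion where
  "oct_one = ((1, 0), (0, 0))"

text \<open>
  The next facts confirm that this is an 8-dimensional unital composition algebra with positive
  definite norm, i.e. the octonion division algebra.
\<close>

lemma oct_mult_one: "oct_one \<otimes>\<^sub>O x = x" "x \<otimes>\<^sub>O oct_one = x"
  by (simp_all add: oct_one_def oct_mult_def quat_mult_def quat_cnj_def prod_eq_iff)

lemma oct_mult_bilinear:
  "(x + y) \<otimes>\<^sub>O z = x \<otimes>\<^sub>O z + y \<otimes>\<^sub>O z"
  "x \<otimes>\<^sub>O (y + z) = x \<otimes>\<^sub>O y + x \<otimes>\<^sub>O z"
  "(r *\<^sub>R x) \<otimes>\<^sub>O y = r *\<^sub>R (x \<otimes>\<^sub>O y)"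
  "x \<otimes>\<^sub>O (r *\<^sub>R y) = r *\<^sub>R (x \<otimes>\<^sub>O y)"
  by (simp_all add: oct_mult_def quat_mult_def quat_cnj_def prod_eq_iff algebra_simps)

lemma norm_oct_mult: "norm (x \<otimes>\<^sub>O y) = norm x * norm y"
proof -
  have n: "(norm (z :: octonion))\<^sup>2 =
      (Re (fst (fst z)))\<^sup>2 + (Im (fst (fst z)))\<^sup>2 + (Re (snd (fst z)))\<^sup>2 + (Im (snd (fst z)))\<^sup>2
    + (Re (fst (snd z)))\<^sup>2 + (Im (fst (snd z)))\<^sup>2 + (Re (snd (snd z)))\<^sup>2 + (Im (snd (snd z)))\<^sup>2" for z
    by (simp add: norm_prod_def cmod_def)
  have "(norm (x \<otimes>\<^sub>O y))\<^sup>2 = (norm x)\<^sup>2 * (norm y)\<^sup>2"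
    unfolding n by (simp add: oct_mult_def quat_mult_def quat_cnj_def, algebra)
  then have "(norm (x \<otimes>\<^sub>O y))\<^sup>2 = (norm x * norm y)\<^sup>2"
    by (simp add: power_mult_distrib)
  then show ?thesis
    by (simp add: power2_eq_iff_nonneg)
qed


section \<open>Lie algebras\<close>

locale lie_algebra_on = vector_space scale
  for scale :: "'k::field \<Rightarrow> 'a::ab_group_add \<Rightarrow> 'a" (infixr \<open>*s\<close> 75) +
  fixes G :: "'a set" and br :: "'a \<Rightarrow> 'a \<Rightarrow> 'a"
  assumes subspace_G: "subspace G"
    and br_closed: "\<lbrakk>x \<in> G; y \<in> G\<rbrakk> \<Longrightarrow> br x y \<in> G"
    and br_add_left: "\<lbrakk>x \<in> G; y \<in> G; z \<in> G\<rbrakk> \<Longrightarrow> br (x + y) z = br x z + br y z"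
    and br_add_right: "\<lbrakk>x \<in> G; y \<in> G; z \<in> G\<rbrakk> \<Longrightarrow> br x (y + z) = br x y + br x z"
    and br_scale_left: "\<lbrakk>x \<in> G; y \<in> G\<rbrakk> \<Longrightarrow> br (c *s x) y = c *s br x y"
    and br_scale_right: "\<lbrakk>x \<in> G; y \<in> G\<rbrakk> \<Longrightarrow> br x (c *s y) = c *s br x y"
    and br_self: "x \<in> G \<Longrightarrow> br x x = 0"
    and jacobi: "\<lbrakk>x \<in> G; y \<in> G; z \<in> G\<rbrakk> \<Longrightarrow>
      br x (br y z) + br y (br z x) + br z (br x y) = 0"
begin

definition subalgebra :: "'a set \<Rightarrow> bool" where
  "subalgebra S \<longleftrightarrow> subspace S \<and> S \<subseteq> G \<and> (\<forall>x\<in>S. \<forall>y\<in>S. br x y \<in> S)"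

definition abelian :: "'a set \<Rightarrow> bool" where
  "abelian S \<longleftrightarrow> (\<forall>x\<in>S. \<forall>y\<in>S. br x y = 0)"

definition ideal_of :: "'a set \<Rightarrow> 'a set \<Rightarrow> bool" where
  "ideal_of I S \<longleftrightarrow> subspace I \<and> I \<subseteq> S \<and> (\<forall>x\<in>S. \<forall>y\<in>I. br x y \<in> I)"

definition simple_subalgebra :: "'a set \<Rightarrow> bool" where
  "simple_subalgebra S \<longleftrightarrow>
     subalgebra S \<and> \<not> abelian S \<and> (\<forall>I. ideal_of I S \<longrightarrow> I = {0} \<or> I = S)"

text \<open>Only the values of \<open>\<Psi>\<close> on \<open>G\<close> matter.\<close>

definition automorphism :: "('a \<Rightarrow> 'a) \<Rightarrow> bool" where
  "automorphism \<Psi> \<longleftrightarrow>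
     bij_betw \<Psi> G G \<and>
     (\<forall>x\<in>G. \<forall>y\<in>G. \<Psi> (x + y) = \<Psi> x + \<Psi> y) \<and>
     (\<forall>c. \<forall>x\<in>G. \<Psi> (c *s x) = c *s \<Psi> x) \<and>
     (\<forall>x\<in>G. \<forall>y\<in>G. \<Psi> (br x y) = br (\<Psi> x) (\<Psi> y))"

definition centralizer :: "'a \<Rightarrow> 'a set" where
  "centralizer e = {z \<in> G. br z e = 0}"

definition nilpotent_element :: "'a \<Rightarrow> bool" where
  "nilpotent_element e \<longleftrightarrow> e \<in> G \<and> (\<exists>n. \<forall>z\<in>G. (br e ^^ n) z = 0)"

text \<open>
  Diagonalizability of \<open>ad x\<close>, which is semisimplicity over an algebraically closed field. From
  here to \<open>principal_subalgebra\<close> the notions are meant for complex semisimple \<open>G\<close>: there a Cartan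
  subalgebra is a maximal abelian subalgebra consisting of semisimple elements, all Cartan
  subalgebras have the same dimension, and that dimension is the rank.
\<close>

definition semisimple_element :: "'a \<Rightarrow> bool" where
  "semisimple_element x \<longleftrightarrow> x \<in> G \<and> G \<subseteq> span {z \<in> G. \<exists>c. br x z = c *s z}"

definition cartan_subalgebra :: "'a set \<Rightarrow> bool" where
  "cartan_subalgebra H \<longleftrightarrow>
     subalgebra H \<and> abelian H \<and>
     (\<forall>K. subalgebra K \<and> abelian K \<and> H \<subseteq> K \<longrightarrow> K = H) \<and>
     (\<forall>x\<in>H. semisimple_element x)"

definition rank :: nat where
  "rank = (THE r. \<exists>H. cartan_subalgebra H \<and> dim H = r)"

definition sl2_triple :: "'a \<Rightarrow> 'a \<Rightarrow> 'a \<Rightarrow> bool" where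
  "sl2_triple e h f \<longleftrightarrow>
     e \<in> G \<and> h \<in> G \<and> f \<in> G \<and>
     br h e = 2 *s e \<and> br h f = (- 2) *s f \<and> br e f = h"

definition principal_nilpotent :: "'a \<Rightarrow> bool" where
  "principal_nilpotent e \<longleftrightarrow> nilpotent_element e \<and> dim (centralizer e) = rank"

definition principal_subalgebra :: "'a set \<Rightarrow> bool" where
  "principal_subalgebra S \<longleftrightarrow>
     (\<exists>e h f. sl2_triple e h f \<and> principal_nilpotent e \<and> S = span {e, h, f})"

end


section \<open>Complexification\<close>

text \<open>
  The pair \<open>(x, y)\<close> stands for \<open>x + i y\<close>; the complexification of a real subspace \<open>S\<close> is
  therefore \<open>S \<times> S\<close>.
\<close>

definition cscale :: "complex \<Rightarrow> 'a::real_vector \<times> 'a \<Rightarrow> 'a \<times> 'a" where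
  "cscale c p = (Re c *\<^sub>R fst p - Im c *\<^sub>R snd p, Im c *\<^sub>R fst p + Re c *\<^sub>R snd p)"

definition complexify :: "'a set \<Rightarrow> ('a \<times> 'a) set" where
  "complexify S = S \<times> S"

definition cbracket :: "('a::real_vector \<Rightarrow> 'a \<Rightarrow> 'a) \<Rightarrow> 'a \<times> 'a \<Rightarrow> 'a \<times> 'a \<Rightarrow> 'a \<times> 'a" where
  "cbracket br p q =
     (br (fst p) (fst q) - br (snd p) (snd q), br (fst p) (snd q) + br (snd p) (fst q))"

lemma vector_space_cscale: "vector_space (cscale :: complex \<Rightarrow> 'a::real_vector \<times> 'a \<Rightarrow> _)"
  by unfold_locales (auto simp: cscale_def prod_eq_iff algebra_simps)

locale real_lie_algebra_on = lie_algebra_on "scaleR" G br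
  for G :: "'a::real_vector set" and br :: "'a \<Rightarrow> 'a \<Rightarrow> 'a"
begin

lemma lie_algebra_on_complexify: "lie_algebra_on cscale (complexify G) (cbracket br)"
proof -
  interpret C: vector_space "cscale :: complex \<Rightarrow> 'a \<times> 'a \<Rightarrow> _"
    by (rule vector_space_cscale)
  have G: "0 \<in> G" "x \<in> G \<Longrightarrow> y \<in> G \<Longrightarrow> x + y \<in> G" "x \<in> G \<Longrightarrow> y \<in> G \<Longrightarrow> x - y \<in> G"
    "x \<in> G \<Longrightarrow> r *\<^sub>R x \<in> G" for x y r
    using subspace_G real_vector.subspace_0 real_vector.subspace_add real_vector.subspace_diff
      real_vector.subspace_scale unfolding subspace_raw_def by blast+
  have diffl: "br (x - y) z = br x z - br y z" if "x \<in> G" "y \<in> G" "z \<in> G" for x y z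
    using br_add_left[of "x - y" y z] that G by (simp add: algebra_simps)
  have diffr: "br z (x - y) = br z x - br z y" if "x \<in> G" "y \<in> G" "z \<in> G" for x y z
    using br_add_right[of z "x - y" y] that G by (simp add: algebra_simps)
  have anti: "br x y + br y x = 0" if "x \<in> G" "y \<in> G" for x y
  proof -
    have "br (x + y) (x + y) = br x x + br x y + (br y x + br y y)"
      using that G by (simp only: br_add_left br_add_right) (simp add: algebra_simps)
    then show ?thesis
      using br_self that G by simp
  qed
  note lin = br_add_left br_add_right br_scale_left br_scale_right diffl diffr br_closed G
  show ?thesis
  proof (unfold_locales, goal_cases)
    case 1
    show ?case
      by (auto simp: C.subspace_def complexify_def cscale_def zero_prod_def G)
  next
    case (8 x y z)
    then obtain a b c d e f where xyz: "x = (a, b)" "y = (c, d)" "z = (e, f)"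
      and m: "a \<in> G" "b \<in> G" "c \<in> G" "d \<in> G" "e \<in> G" "f \<in> G"
      by (auto simp: complexify_def)
    have J: "br u (br v w) = - br v (br w u) - br w (br u v)"
      if "u \<in> G" "v \<in> G" "w \<in> G" for u v w
      using jacobi[OF that] by (simp add: eq_diff_eq eq_neg_iff_add_eq_0 add_ac)
    show ?case
      using m by (simp add: xyz cbracket_def lin J[of a] J[of b] zero_prod_def)
  next
    case (7 x)
    then show ?case
      by (auto simp: complexify_def cbracket_def br_self anti zero_prod_def)
  qed (auto simp: complexify_def cbracket_def cscale_def lin algebra_simps)
qed

sublocale complexified: lie_algebra_on cscale "complexify G" "cbracket br"
  by (rule lie_algebra_on_complexify)

definition principal_three_dim_subalgebra :: "'a set \<Rightarrow> bool" where
  "principal_three_dim_subalgebra S \<longleftrightarrow>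
     simple_subalgebra S \<and> dim S = 3 \<and>
     complexified.principal_subalgebra (complexify S)"

end


section \<open>The compact Lie algebra of type $G_2$\<close>

definition commutator :: "('v::real_normed_vector \<Rightarrow>\<^sub>L 'v) \<Rightarrow> ('v \<Rightarrow>\<^sub>L 'v) \<Rightarrow> ('v \<Rightarrow>\<^sub>L 'v)" where
  "commutator D E = (D o\<^sub>L E) - (E o\<^sub>L D)"

text \<open>Boundedness is no restriction, since the octonions are finite-dimensional.\<close>

definition g2 :: "(octonion \<Rightarrow>\<^sub>L octonion) set" where
  "g2 = {D :: octonion \<Rightarrow>\<^sub>L octonion. \<forall>x y. D (x \<otimes>\<^sub>O y) = D x \<otimes>\<^sub>O y + x \<otimes>\<^sub>O D y}"

interpretation g2: real_lie_algebra_on g2 commutator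
proof (unfold_locales, goal_cases)
  case 1
  have "0 \<otimes>\<^sub>O x = 0" "x \<otimes>\<^sub>O 0 = 0" for x
    using oct_mult_bilinear(3)[of 0 0 x] oct_mult_bilinear(4)[of x 0 0] by simp_all
  then show ?case
    unfolding subspace_raw_def[symmetric] real_vector.subspace_def
    by (simp add: g2_def blinfun.bilinear_simps oct_mult_bilinear scaleR_right_distrib del: split_paired_All)
next
  case (2 D E)
  have m: "(- x) \<otimes>\<^sub>O y = - (x \<otimes>\<^sub>O y)" "x \<otimes>\<^sub>O (- y) = - (x \<otimes>\<^sub>O y)" for x y
    using oct_mult_bilinear(3)[of "-1" x y] oct_mult_bilinear(4)[of x "-1" y] by simp_all
  have d: "(x - y) \<otimes>\<^sub>O z = x \<otimes>\<^sub>O z - y \<otimes>\<^sub>O z" "z \<otimes>\<^sub>O (x - y) = z \<otimes>\<^sub>O x - z \<otimes>\<^sub>O y" for x y z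
    using oct_mult_bilinear(1)[of x "- y" z] oct_mult_bilinear(2)[of z x "- y"] by (simp_all add: m)
  from 2 show ?case
    by (simp add: g2_def commutator_def blinfun.bilinear_simps d algebra_simps del: split_paired_All)
qed (auto intro!: blinfun_eqI simp: commutator_def blinfun.bilinear_simps algebra_simps)

end

theory Submission
  imports Defs "HOL-Computational_Algebra.Fundamental_Theorem_Algebra"
begin

text \<open>
  A basic triple (three orthonormal imaginary units \<open>u, v, w\<close> with \<open>w\<close> orthogonal to \<open>u v\<close>)
  determines an automorphism of the octonions, over the reals as well as over the complex numbers.
  A derivation that is semisimple (always the case over the reals) admits a basic triple with
  \<open>D u = 0\<close>, \<open>D v = a u v\<close> and \<open>D w = b u w\<close>, so it is conjugate into the standard
  two-dimensional torus. The centralizers of torus elements are then explicit, and every Cartan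
  subalgebra of the complexification has dimension 2.

  The nilpotent \<open>e = P + \<i> Q\<close> of a principal subalgebra is isotropic for the invariant form, so after
  scaling \<open>X = P\<close>, \<open>Y = Q\<close>, \<open>Z = [X, Y]\<close> is a standard basis of \<open>so(3)\<close>. Conjugate \<open>Z\<close> to
  the torus element with simple root values \<open>b, a - b \<ge> 0\<close>. Since \<open>e\<close> shifts the eigenvalues of
  \<open>ad Z\<close> by one, the two-dimensionality of its centralizer forces both values to be at least 1, so \<open>e\<close>
  is a combination of two simple root vectors, and \<open>[X, Y] = Z\<close> determines \<open>a\<close>, \<open>b\<close> and the
  absolute values of the two coefficients. A rotation in the torus adjusts their phases.
\<close>

section \<open>Linear algebra\<close>

text \<open>\<open>rank\<close> refers to all Cartan subalgebras of the complexification, so the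
  notion of a principal nilpotent becomes usable only once each of them is known to have dimension
  2. No conjugacy theorem for Cartan subalgebras enters: one nonzero element is moved into the
  standard torus, and its centralizer is either the torus or a copy of gl(2). The obstacle is that
  semisimplicity concerns \<open>ad D\<close> on the 14-dimensional algebra, whereas a basic triple
  requires \<open>D\<close> to be diagonalizable on the 7-dimensional imaginary octonions, with
  eigenvectors of nonzero length, although the complex form has isotropic vectors. Irreducibility of
  the 7-dimensional module settles the first point, polarization inside eigenspaces the second. The
  constants: \<open>Z\<close> must take the value 1 on both simple roots \<open>b\<close> and
  \<open>a - b\<close>, so (a, b) = (2, 1). The torus part of \<open>[X, Y] = Z\<close> reads a = 2m
  - 2n, b = 4n - 2m for the squared absolute values m, n of the two coefficients, whence m = 5/2 and
  n = 3/2. The final conjugations come from automorphisms of the real octonions and so preserve the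
  compact form.\<close>

context vector_space begin

text \<open>Exchange argument: a vector of \<open>T\<close> outside \<open>span S\<close> could be
  adjoined to \<open>S\<close>, giving more independent vectors in \<open>span T\<close> than
  \<open>T\<close> has elements.\<close>

lemma span_eq_of_independent_card:
  assumes "independent S" "S \<subseteq> span T" "finite T" "card S = card T"
  shows "span T \<subseteq> span S"
proof -
  have S: "finite S" using assms independent_span_bound by blast
  have "T \<subseteq> span S"
  proof
    fix x assume x: "x \<in> T"
    show "x \<in> span S"
    proof (rule ccontr)
      assume n: "x \<notin> span S"
      then have "independent (insert x S)" "x \<notin> S"
        using assms(1) by (auto simp: independent_insert span_base)
      moreover have "insert x S \<subseteq> span T" using x assms(2) by (auto simp: span_base)
      ultimately show False
        using independent_span_bound[OF assms(3)] S assms(4) by fastforce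
    qed
  qed
  then show ?thesis by (rule span_minimal) (rule subspace_span)
qed

text \<open>Rank-nullity as an inequality of cardinalities: a basis \<open>N\<close> of the kernel
  extends to a basis \<open>M\<close> of \<open>span A\<close>, and \<open>f\<close> is injective on
  the span of \<open>M - N\<close>, so \<open>M - N\<close> has at most \<open>card T\<close>
  elements. It later bounds a centralizer from below.\<close>

lemma independent_kernel_subset:
  assumes f: "Vector_Spaces.linear scale scale f"
    and A: "independent A" "finite A" and T: "f ` A \<subseteq> span T" "finite T"
  obtains N where "N \<subseteq> {x \<in> span A. f x = 0}" "independent N" "finite N" "card A \<le> card N + card T"
proof -
  interpret f: Vector_Spaces.linear scale scale f by (rule f)
  let ?K = "{x \<in> span A. f x = 0}"
  obtain N where N: "N \<subseteq> ?K" "independent N" "?K \<subseteq> span N"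
    using maximal_independent_subset[of ?K] by blast
  obtain M where M: "N \<subseteq> M" "M \<subseteq> span A" "independent M" "span A \<subseteq> span M"
    using maximal_independent_subset_extend[of N "span A"] N by blast
  have fM: "finite M" using independent_span_bound[OF A(2) M(3) M(2)] by blast
  then have fN: "finite N" using M(1) finite_subset by blast
  have cA: "card A \<le> card M"
    using independent_span_bound[OF fM A(1)] M(4) span_superset by blast
  let ?P = "M - N"
  have iP: "independent ?P" using M(3) independent_mono by blast
  \<comment> \<open>The representation of such a vector over \<open>M\<close> would be supported in
    \<open>M - N\<close> and in \<open>N\<close> at once.\<close>
  have disj: "x = 0" if "x \<in> span ?P" "x \<in> span N" for x
  proof -
    have "representation M x = representation ?P x" "representation M x = representation N x"
      using representation_extend[OF M(3) that(1)] representation_extend[OF M(3) that(2)] M(1) by auto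
    then have "representation ?P x b = 0" for b
      using representation_ne_zero[of ?P x b] representation_ne_zero[of N x b] by auto
    then show ?thesis
      using sum_nonzero_representation_eq[OF iP that(1)] by simp
  qed
  have inj: "inj_on f (span ?P)"
  proof (rule inj_onI)
    fix x y assume xy: "x \<in> span ?P" "y \<in> span ?P" "f x = f y"
    have d: "x - y \<in> span ?P" using xy span_diff by blast
    have "span ?P \<subseteq> span A" using M(2) by (intro span_minimal) (auto simp: subspace_span)
    then have "x - y \<in> ?K" using d xy f.diff by auto
    then show "x = y" using N(3) d disj[of "x - y"] by auto
  qed
  have "independent (f ` ?P)"
    by (rule f.independent_injective_image[OF iP inj])
  moreover have "f ` ?P \<subseteq> span T"
  proof -
    have "f ` ?P \<subseteq> f ` span A" using M(2) by auto
    also have "\<dots> = span (f ` A)" by (simp add: f.span_image)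
    also have "\<dots> \<subseteq> span T" using T(1) by (intro span_minimal) (auto simp: subspace_span)
    finally show ?thesis .
  qed
  ultimately have "card (f ` ?P) \<le> card T"
    using independent_span_bound[OF T(2)] by blast
  moreover have "card (f ` ?P) = card ?P"
    by (intro card_image inj_on_subset[OF inj]) (auto simp: span_base)
  ultimately have "card A \<le> card N + card T"
    using cA card_Diff_subset[OF fN M(1)] card_mono[OF fM M(1)] by linarith
  then show thesis using that N fN by blast
qed

end

text \<open>Rayleigh quotient: a point of the compact unit sphere of \<open>X\<close> where
  \<open>M x \<bullet> x\<close> is maximal is an eigenvector.\<close>

lemma symmetric_eigenvector:
  fixes M :: "'a::euclidean_space \<Rightarrow> 'a"
  assumes lin: "linear M" and X: "subspace X" "\<And>x. x \<in> X \<Longrightarrow> M x \<in> X"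
    and sym: "\<And>x y. x \<in> X \<Longrightarrow> y \<in> X \<Longrightarrow> M x \<bullet> y = x \<bullet> M y"
    and ne: "z \<in> X" "z \<noteq> 0"
  obtains x c where "x \<in> X" "x \<bullet> x = 1" "M x = c *\<^sub>R x"
proof -
  let ?S = "X \<inter> sphere 0 1"
  have "compact ?S" using X(1) by (intro closed_Int_compact closed_subspace) auto
  moreover have "inverse (norm z) *\<^sub>R z \<in> ?S"
    using ne X(1) by (auto simp: subspace_scale)
  moreover have "continuous_on ?S (\<lambda>x. M x \<bullet> x)"
    using lin by (intro continuous_intros linear_continuous_on linear_conv_bounded_linear[THEN iffD1])
  ultimately obtain x where x: "x \<in> ?S" and max: "\<And>y. y \<in> ?S \<Longrightarrow> M y \<bullet> y \<le> M x \<bullet> x"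
    using continuous_attains_sup[of ?S "\<lambda>x. M x \<bullet> x"] by blast
  define c where "c = M x \<bullet> x"
  have xX: "x \<in> X" and xx: "x \<bullet> x = 1" using x by (auto simp: dot_square_norm)
  have le: "M y \<bullet> y \<le> c * (y \<bullet> y)" if "y \<in> X" for y
  proof (cases "y = 0")
    case False
    have "inverse (norm y) *\<^sub>R y \<in> ?S" using False that X(1) by (auto simp: subspace_scale)
    from max[OF this] have "M y \<bullet> y / (norm y)^2 \<le> c"
      unfolding c_def by (simp add: linear_scale[OF lin] power2_eq_square field_simps)
    then show ?thesis using False by (simp add: divide_le_eq dot_square_norm)
  qed (simp add: linear_0[OF lin])
  define w where "w = M x - c *\<^sub>R x"
  have wX: "w \<in> X" unfolding w_def using X xX by (simp add: subspace_diff subspace_scale)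
  \<comment> \<open>Variation of the maximum in the direction of the residual \<open>w\<close>. The
    left side is linear and the right side quadratic in \<open>t\<close>, so a nonzero residual is
    refuted by a small positive \<open>t\<close>.\<close>
  have "2 * t * (w \<bullet> w) \<le> t\<^sup>2 * (c * (w \<bullet> w) - M w \<bullet> w)" for t :: real
  proof -
    have "x + t *\<^sub>R w \<in> X" using X(1) xX wX by (simp add: subspace_add subspace_scale)
    from le[OF this] have "M x \<bullet> x + t * (M x \<bullet> w) + t * (M w \<bullet> x) + t\<^sup>2 * (M w \<bullet> w)
        \<le> c * (x \<bullet> x + 2 * t * (x \<bullet> w) + t\<^sup>2 * (w \<bullet> w))"
      by (simp add: linear_add[OF lin] linear_scale[OF lin] inner_simps inner_commute power2_eq_square algebra_simps)
    moreover have "M w \<bullet> x = M x \<bullet> w" using sym[OF wX xX] by (simp add: inner_commute)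
    moreover have "M x \<bullet> w = w \<bullet> w + c * (x \<bullet> w)"
      by (simp add: w_def inner_diff_left inner_diff_right algebra_simps inner_commute)
    ultimately show ?thesis unfolding c_def[symmetric] xx by (simp add: algebra_simps)
  qed
  note q = this
  have "w \<bullet> w = 0"
  proof (rule ccontr)
    assume "w \<bullet> w \<noteq> 0"
    then have p: "w \<bullet> w > 0" by simp
    define k where "k = \<bar>c * (w \<bullet> w) - M w \<bullet> w\<bar> + 1"
    have k: "k > 0" "c * (w \<bullet> w) - M w \<bullet> w \<le> k" by (auto simp: k_def)
    let ?t = "(w \<bullet> w) / k"
    have "2 * ?t * (w \<bullet> w) \<le> ?t\<^sup>2 * k"
      using q[of ?t] k(2) by (meson mult_left_mono order_trans zero_le_power2)
    then have "(w \<bullet> w) * (w \<bullet> w) \<le> 0" using p k(1) by (simp add: power2_eq_square field_simps)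
    then show False using mult_pos_pos[OF p p] by linarith
  qed
  then show thesis using that[OF xX xx, of c] by (simp add: w_def)
qed

section \<open>Octonion algebras over a field\<close>

text \<open>Bits 0, 1, 2 of an index record the factors \<open>u\<close>, \<open>v\<close>,
  \<open>w\<close> of a basis product, so this table is bitwise exclusive or. The signs are kept
  apart in \<open>oct_sign\<close>.\<close>

definition oct_index :: "nat \<Rightarrow> nat \<Rightarrow> nat" where
  "oct_index i j = [[0,1,2,3,4,5,6,7],[1,0,3,2,5,4,7,6],[2,3,0,1,6,7,4,5],[3,2,1,0,7,6,5,4],
     [4,5,6,7,0,1,2,3],[5,4,7,6,1,0,3,2],[6,7,4,5,2,3,0,1],[7,6,5,4,3,2,1,0]] ! i ! j"

definition oct_sign :: "nat \<Rightarrow> nat \<Rightarrow> int" where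
  "oct_sign i j = [[1,1,1,1,1,1,1,1],[1,-1,1,-1,1,-1,-1,1],[1,-1,-1,1,1,1,-1,-1],
     [1,1,-1,-1,1,-1,1,-1],[1,-1,-1,-1,-1,1,1,1],[1,1,-1,1,-1,-1,-1,1],
     [1,1,1,-1,-1,1,-1,-1],[1,-1,1,1,-1,-1,1,-1]] ! i ! j"

lemma less_8_cases: "(k::nat) < 8 \<longleftrightarrow> k = 0 \<or> k = 1 \<or> k = 2 \<or> k = 3 \<or> k = 4 \<or> k = 5 \<or> k = 6 \<or> k = 7"
  by auto

lemma all_less_8: "(\<forall>k<8::nat. P k) \<longleftrightarrow> P 0 \<and> P 1 \<and> P 2 \<and> P 3 \<and> P 4 \<and> P 5 \<and> P 6 \<and> P 7"
  unfolding less_8_cases by blast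

lemma sum_less_8: "sum f {..<8::nat} = f 0 + f 1 + f 2 + f 3 + f 4 + f 5 + f 6 + f 7"
  by (simp add: eval_nat_numeral add_ac)

text \<open>The identities of a composition algebra in linearised form: being linear in each
  argument, they pass to the complexification by expansion into real and imaginary parts, and
  \<open>two_neq_0\<close> gives back quadratic versions such as \<open>x \<star> x = - one\<close>.
  Over the complex numbers \<open>B\<close> is bilinear, not Hermitian, so isotropic vectors are
  possible.\<close>

locale octonion_algebra = vector_space scale
  for scale :: "'k::field \<Rightarrow> 'v::ab_group_add \<Rightarrow> 'v" (infixr \<open>\<odot>\<close> 75) +
  fixes mul :: "'v \<Rightarrow> 'v \<Rightarrow> 'v" (infixl \<open>\<star>\<close> 70) and one :: 'v and B :: "'v \<Rightarrow> 'v \<Rightarrow> 'k"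
  assumes mul_add_left: "(x + y) \<star> z = x \<star> z + y \<star> z"
    and mul_add_right: "x \<star> (y + z) = x \<star> y + x \<star> z"
    and mul_scale_left: "(a \<odot> x) \<star> y = a \<odot> (x \<star> y)"
    and mul_scale_right: "x \<star> (a \<odot> y) = a \<odot> (x \<star> y)"
    and B_add_left: "B (x + y) z = B x z + B y z"
    and B_scale_left: "B (a \<odot> x) y = a * B x y"
    and B_commute: "B x y = B y x"
    and one_mul: "one \<star> x = x" and mul_one: "x \<star> one = x" and B_one: "B one one = 1"
    and imag_anticommute: "B x one = 0 \<Longrightarrow> B y one = 0 \<Longrightarrow> x \<star> y + y \<star> x = (- 2 * B x y) \<odot> one"
    and left_alternative: "x \<star> (y \<star> z) + y \<star> (x \<star> z) = (x \<star> y + y \<star> x) \<star> z"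
    and right_alternative: "(z \<star> x) \<star> y + (z \<star> y) \<star> x = z \<star> (x \<star> y + y \<star> x)"
    and imag_adjoint_left: "B x one = 0 \<Longrightarrow> B (x \<star> y) z = - B y (x \<star> z)"
    and imag_adjoint_right: "B x one = 0 \<Longrightarrow> B (y \<star> x) z = - B y (z \<star> x)"
    and two_neq_0: "(2::'k) \<noteq> 0"
begin

lemma B_add_right: "B x (y + z) = B x y + B x z"
  by (metis B_add_left B_commute)

lemma B_scale_right: "B x (a \<odot> y) = a * B x y"
  by (metis B_scale_left B_commute)

lemma B_0: "B 0 x = 0" "B x 0 = 0"
  using B_scale_left[of 0 0 x] B_scale_right[of x 0 0] by auto

lemma B_minus: "B (- x) y = - B x y" "B x (- y) = - B x y"
  using B_scale_left[of "- 1" x y] B_scale_right[of x "- 1" y] by auto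

lemma B_diff: "B (x - y) z = B x z - B y z" "B z (x - y) = B z x - B z y"
  using B_add_left[of x "- y" z] B_add_right[of z x "- y"] by (auto simp: B_minus)

lemma B_sum_left: "B (sum f S) y = (\<Sum>i\<in>S. B (f i) y)"
  by (induction S rule: infinite_finite_induct) (auto simp: B_0 B_add_left)

lemma mul_0: "0 \<star> x = 0" "x \<star> 0 = 0"
  using mul_scale_left[of 0 0 x] mul_scale_right[of x 0 0] by auto

lemma mul_minus: "(- x) \<star> y = - (x \<star> y)" "x \<star> (- y) = - (x \<star> y)"
  using mul_scale_left[of "- 1" x y] mul_scale_right[of x "- 1" y] by auto

lemma mul_diff: "(x - y) \<star> z = x \<star> z - y \<star> z" "z \<star> (x - y) = z \<star> x - z \<star> y"
  using mul_add_left[of x "- y" z] mul_add_right[of z x "- y"] by (auto simp: mul_minus)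

definition imag_unit :: "'v \<Rightarrow> bool" where
  "imag_unit x \<longleftrightarrow> B x one = 0 \<and> B x x = 1"

definition orth :: "'v \<Rightarrow> 'v \<Rightarrow> bool" where
  "orth x y \<longleftrightarrow> imag_unit x \<and> imag_unit y \<and> B x y = 0"

lemma orth_sym: "orth x y \<Longrightarrow> orth y x"
  unfolding orth_def using B_commute[of x y] by simp

lemma twice_eq_0: assumes "x + x = 0" shows "(x::'v) = 0"
proof -
  have "2 \<odot> x = x + x" unfolding one_add_one[symmetric] scale_left_distrib scale_one ..
  then have "2 \<odot> x = 0" using assms by (rule trans)
  then show ?thesis using two_neq_0 scale_eq_0_iff[of 2 x] by blast
qed

lemma twice_eq: assumes "x + x = y + y" shows "(x::'v) = y"
proof -
  have "(x - y) + (x - y) = (x + x) - (y + y)" by (rule add_diff_add[symmetric])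
  then have "(x - y) + (x - y) = 0" unfolding assms by simp
  then have "x - y = 0" by (rule twice_eq_0)
  then show ?thesis by simp
qed

lemma imag_unit_square: assumes "imag_unit x" shows "x \<star> x = - one"
proof (rule twice_eq)
  have "x \<star> x + x \<star> x = (- 2 * 1) \<odot> one"
    using assms imag_anticommute[of x x] unfolding imag_unit_def by metis
  also have "- 2 * 1 = - 1 + - (1::'k)" by simp
  also have "(- 1 + - 1) \<odot> one = - one + - one" by (simp only: scale_left_distrib scale_minus_left scale_one)
  finally show "x \<star> x + x \<star> x = - one + - one" .
qed

lemma imag_unit_left_left: assumes "imag_unit x" shows "x \<star> (x \<star> y) = - y"
proof (rule twice_eq)
  have "x \<star> (x \<star> y) + x \<star> (x \<star> y) = (- one + - one) \<star> y"
    unfolding left_alternative imag_unit_square[OF assms] ..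
  then show "x \<star> (x \<star> y) + x \<star> (x \<star> y) = - y + - y"
    by (simp only: mul_add_left mul_minus one_mul)
qed

lemma imag_unit_right_right: assumes "imag_unit x" shows "(y \<star> x) \<star> x = - y"
proof (rule twice_eq)
  have "(y \<star> x) \<star> x + (y \<star> x) \<star> x = y \<star> (- one + - one)"
    unfolding right_alternative imag_unit_square[OF assms] ..
  then show "(y \<star> x) \<star> x + (y \<star> x) \<star> x = - y + - y"
    by (simp only: mul_add_right mul_minus mul_one)
qed

lemma orth_mul_add: assumes "orth x y" shows "x \<star> y + y \<star> x = 0"
  using imag_anticommute[of x y] assms by (simp add: orth_def imag_unit_def)

lemma orth_anticommute: "orth x y \<Longrightarrow> y \<star> x = - (x \<star> y)"
  using orth_mul_add by (metis minus_unique)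

lemma orth_left_left: assumes "orth x y" shows "x \<star> (y \<star> z) = - (y \<star> (x \<star> z))"
  using left_alternative[of x y z] unfolding orth_mul_add[OF assms] mul_0
  by (simp add: eq_neg_iff_add_eq_0)

lemma orth_right_right: assumes "orth x y" shows "(z \<star> x) \<star> y = - ((z \<star> y) \<star> x)"
  using right_alternative[of z x y] unfolding orth_mul_add[OF assms] mul_0
  by (simp add: eq_neg_iff_add_eq_0)

lemma imag_unit_isometry_left: assumes "imag_unit x" shows "B (x \<star> y) (x \<star> z) = B y z"
  using imag_adjoint_left[of x y "x \<star> z"] assms unfolding imag_unit_left_left[OF assms]
  by (simp add: imag_unit_def B_minus)

lemma imag_unit_isometry_right: assumes "imag_unit x" shows "B (y \<star> x) (z \<star> x) = B y z"
  using imag_adjoint_right[of x y "z \<star> x"] assms unfolding imag_unit_right_right[OF assms]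
  by (simp add: imag_unit_def B_minus)

lemma orth_mul:
  assumes "orth x y" shows "imag_unit (x \<star> y)" "orth x (x \<star> y)" "orth y (x \<star> y)"
proof -
  have x: "imag_unit x" and y: "imag_unit y" and xy: "B x y = 0" using assms by (auto simp: orth_def)
  have x1: "B x one = 0" and y1: "B y one = 0" using x y by (auto simp: imag_unit_def)
  have "B (x \<star> y) one = - B y x" using imag_adjoint_left[OF x1, of y one] by (simp only: mul_one)
  moreover have "B (x \<star> y) (x \<star> y) = 1"
    using imag_unit_isometry_left[OF x, of y y] y by (simp add: imag_unit_def)
  moreover have "B (x \<star> y) x = B y one"
    using imag_adjoint_left[OF x1, of y x] unfolding imag_unit_square[OF x] B_minus by simp
  moreover have "B (x \<star> y) y = B x one"
    using imag_adjoint_right[OF y1, of x y] unfolding imag_unit_square[OF y] B_minus by simp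
  ultimately have "B (x \<star> y) one = 0" "B (x \<star> y) (x \<star> y) = 1" "B x (x \<star> y) = 0" "B y (x \<star> y) = 0"
    using xy x1 y1 by (simp_all only: B_commute[of x "x \<star> y"] B_commute[of y "x \<star> y"] B_commute[of y x] minus_zero)
  then show "imag_unit (x \<star> y)" "orth x (x \<star> y)" "orth y (x \<star> y)"
    using x y by (auto simp: orth_def imag_unit_def)
qed

definition basic_triple :: "'v \<Rightarrow> 'v \<Rightarrow> 'v \<Rightarrow> bool" where
  "basic_triple u v w \<longleftrightarrow> orth u v \<and> orth u w \<and> orth v w \<and> B (u \<star> v) w = 0"

definition triple_basis :: "'v \<Rightarrow> 'v \<Rightarrow> 'v \<Rightarrow> nat \<Rightarrow> 'v" where
  "triple_basis u v w k = [one, u, v, u \<star> v, w, u \<star> w, v \<star> w, (u \<star> v) \<star> w] ! k"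

lemma triple_basis_simps:
  "triple_basis u v w 0 = one" "triple_basis u v w 1 = u" "triple_basis u v w (Suc 0) = u"
  "triple_basis u v w 2 = v" "triple_basis u v w 3 = u \<star> v" "triple_basis u v w 4 = w"
  "triple_basis u v w 5 = u \<star> w" "triple_basis u v w 6 = v \<star> w"
  "triple_basis u v w 7 = (u \<star> v) \<star> w"
  by (simp_all add: triple_basis_def)

text \<open>A basic triple fixes the whole multiplication table. Adjointness and isometry of
  multiplication by imaginary units make the seven imaginary products pairwise orthogonal, hence
  anticommuting; the alternative laws then reduce each product to the four defining ones.\<close>

lemma basic_triple_mul:
  assumes "basic_triple u v w" "i < 8" "j < 8"
  shows "triple_basis u v w i \<star> triple_basis u v w j =
    of_int (oct_sign i j) \<odot> triple_basis u v w (oct_index i j)" (is ?mul)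
    and "B (triple_basis u v w i) (triple_basis u v w j) = (if i = j then 1 else 0)" (is ?orth)
proof -
  define p a b c where "p = u \<star> v" and "a = u \<star> w" and "b = v \<star> w" and "c = p \<star> w"
  note d = p_def a_def b_def c_def
  have uv: "orth u v" and uw: "orth u w" and vw: "orth v w" and uvw: "B p w = 0"
    using assms(1) by (auto simp: basic_triple_def p_def)
  have iu0: "imag_unit u" "imag_unit v" "imag_unit w"
    using uv vw by (auto simp: orth_def)
  have im: "B u one = 0" "B v one = 0" "B w one = 0"
    using iu0 by (auto simp: imag_unit_def)
  have ip: "imag_unit p" and up: "orth u p" and vp: "orth v p" unfolding d using orth_mul[OF uv] by auto
  have pw: "orth p w" using ip iu0(3) uvw by (simp add: orth_def)
  note wp = orth_sym[OF pw]
  have ia: "imag_unit a" and ua: "orth u a" and wa: "orth w a" unfolding d using orth_mul[OF uw] by auto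
  have ib: "imag_unit b" and vb: "orth v b" and wb: "orth w b" unfolding d using orth_mul[OF vw] by auto
  have ic: "imag_unit c" and pc: "orth p c" and wc: "orth w c" unfolding d(4) using orth_mul[OF pw] by auto
  note iu = iu0 ip ia ib ic
  note units = uv uw vw up vp pw ua wa vb wb pc wc
  have vu: "v \<star> u = - p" using orth_anticommute[OF uv] by (simp add: p_def)
  have va: "orth v a"
    using imag_adjoint_left[OF im(1), of v w, folded d] iu uvw by (simp add: orth_def)
  have ub: "orth u b"
    using imag_adjoint_left[OF im(2), of u w, folded d, unfolded vu] iu uvw by (simp add: orth_def B_minus)
  have pa: "orth p a" using imag_unit_isometry_left[OF iu(1), of v w] iu vw
    by (simp add: orth_def a_def p_def)
  have pb: "orth p b" using imag_unit_isometry_left[OF iu(2), of u w, folded d, unfolded vu] iu uw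
    by (simp add: orth_def B_minus)
  have ab: "orth a b" using imag_unit_isometry_right[OF iu(3), of u v] iu uv
    by (simp add: orth_def a_def b_def)
  have ac: "orth a c" using imag_unit_isometry_right[OF iu(3), of u p] iu up
    by (simp add: orth_def a_def c_def)
  have bc: "orth b c" using imag_unit_isometry_right[OF iu(3), of v p] iu vp
    by (simp add: orth_def b_def c_def)
  have uc: "orth u c" using imag_adjoint_right[OF im(3), of u p, folded d] orth_sym[OF pa] iu
    by (simp add: orth_def)
  have vc: "orth v c" using imag_adjoint_right[OF im(3), of v p, folded d] orth_sym[OF pb] iu
    by (simp add: orth_def)
  note O = units va ub pa pb ab ac bc uc vc
  have 1: "u \<star> v = p" "u \<star> w = a" "v \<star> w = b" "p \<star> w = c" by (simp_all add: d)
  have 2: "u \<star> p = - v" "u \<star> a = - w" "v \<star> b = - w" "p \<star> c = - w"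
    using imag_unit_left_left iu by (auto simp: d)
  have 3: "a \<star> w = - u" "b \<star> w = - v" "c \<star> w = - p"
    using imag_unit_right_right[OF iu(3)] by (auto simp: d)
  have vp': "v \<star> p = u"
    using imag_unit_left_left[OF iu(2), of u] orth_anticommute[OF uv] by (simp add: d mul_minus)
  have pv: "p \<star> v = - u" using orth_anticommute[OF vp] vp' by simp
  have pu: "p \<star> u = v" using orth_anticommute[OF up] 2(1) by simp
  have va': "v \<star> a = c"
  proof -
    have "a \<star> v = - c" using orth_right_right[OF orth_sym[OF vw], of u] 1 by simp
    then show ?thesis using orth_anticommute[OF orth_sym[OF va]] by simp
  qed
  have ub': "u \<star> b = - c"
    using orth_left_left[OF uv, of w] 1 va' by simp
  have uc': "u \<star> c = b"
    using imag_unit_left_left[OF iu(1), of b] ub' by (simp add: mul_minus)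
  have vc': "v \<star> c = - a" using imag_unit_left_left[OF iu(2), of a] va' by simp
  have pa': "p \<star> a = - b" using orth_left_left[OF orth_sym[OF up], of w] 1 uc' by simp
  have pb': "p \<star> b = a" using orth_left_left[OF orth_sym[OF vp], of w] 1 vc' by simp
  have ab': "a \<star> b = - p"
    using orth_left_left[OF orth_sym[OF va], of w] 1 3 orth_anticommute[OF uv] by (simp add: mul_minus)
  have ac': "a \<star> c = v"
    using orth_left_left[OF orth_sym[OF pa], of w] 1 3 pu by (simp add: mul_minus)
  have bc': "b \<star> c = - u"
    using orth_left_left[OF orth_sym[OF pb], of w] 1 3 pv by (simp add: mul_minus)
  note tab = 1 2 3 vp' pv pu va' ub' uc' vc' pa' pb' ab' ac' bc'
  have wa': "w \<star> a = u" using orth_anticommute[OF orth_sym[OF wa]] 3 by simp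
  have wb': "w \<star> b = v" using orth_anticommute[OF orth_sym[OF wb]] 3 by simp
  have wc': "w \<star> c = p" using orth_anticommute[OF orth_sym[OF wc]] 3 by simp
  note anti = O[THEN orth_anticommute]
  note sq = iu[THEN imag_unit_square]
  note all = tab wa' wb' wc' anti sq one_mul mul_one
  have "\<forall>i<8. \<forall>j<8. triple_basis u v w i \<star> triple_basis u v w j =
    of_int (oct_sign i j) \<odot> triple_basis u v w (oct_index i j)"
    unfolding all_less_8
    by (simp add: triple_basis_simps oct_sign_def oct_index_def p_def[symmetric] a_def[symmetric]
        b_def[symmetric] c_def[symmetric] all)
  then show ?mul using assms(2,3) by blast
  have "B x y = 0 \<and> B y x = 0" if "orth x y" for x y
    using that B_commute[of x y] by (simp add: orth_def)
  note O' = O[THEN this]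
  have one: "B x x = 1 \<and> B x one = 0 \<and> B one x = 0" if "imag_unit x" for x
    using that B_commute[of x one] by (simp add: imag_unit_def)
  have "\<forall>i<8. \<forall>j<8. B (triple_basis u v w i) (triple_basis u v w j) = (if i = j then 1 else 0)"
    unfolding all_less_8
    by (simp add: triple_basis_simps p_def[symmetric] a_def[symmetric]
        b_def[symmetric] c_def[symmetric] O' iu[THEN one] B_one)
  then show ?orth using assms(2,3) by blast
qed

end

section \<open>Derivations in diagonal form and the Weyl group moves\<close>

context octonion_algebra begin

lemma orthonormal_independent:
  assumes fin: "finite S" and S: "\<And>x y. x \<in> S \<Longrightarrow> y \<in> S \<Longrightarrow> B x y = (if x = y then 1 else 0)"
  shows "independent S"
proof -
  have "c x = 0" if "(\<Sum>y\<in>S. c y \<odot> y) = 0" "x \<in> S" for c x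
  proof -
    have "0 = B (\<Sum>y\<in>S. c y \<odot> y) x" using that(1) by (simp add: B_0)
    also have "\<dots> = (\<Sum>y\<in>S. if y = x then c y else 0)"
      unfolding B_sum_left B_scale_left by (intro sum.cong) (use S that(2) in auto)
    also have "\<dots> = c x" using fin that(2) by simp
    finally show ?thesis by simp
  qed
  then show ?thesis using fin by (auto simp: dependent_finite)
qed

definition derivation :: "('v \<Rightarrow> 'v) \<Rightarrow> bool" where
  "derivation D \<longleftrightarrow> (\<forall>x y. D (x + y) = D x + D y) \<and> (\<forall>a x. D (a \<odot> x) = a \<odot> D x) \<and>
     (\<forall>x y. D (x \<star> y) = D x \<star> y + x \<star> D y)"

text \<open>Left multiplication by \<open>u\<close> plays the role of an imaginary unit, and
  \<open>D\<close> acts on \<open>v\<close> and \<open>w\<close> as \<open>a\<close> and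
  \<open>b\<close> times it. This is the shape of an element of the maximal torus attached to the
  triple, with weights \<open>a\<close>, \<open>b\<close>, \<open>- (a + b)\<close>.\<close>

definition diag_triple :: "('v \<Rightarrow> 'v) \<Rightarrow> 'k \<Rightarrow> 'k \<Rightarrow> 'v \<Rightarrow> 'v \<Rightarrow> 'v \<Rightarrow> bool" where
  "diag_triple D a b u v w \<longleftrightarrow>
     basic_triple u v w \<and> D u = 0 \<and> D v = a \<odot> (u \<star> v) \<and> D w = b \<odot> (u \<star> w)"

lemma triple_orth:
  assumes "basic_triple u v w" "0 < i" "0 < j" "i < 8" "j < 8" "i \<noteq> j"
  shows "orth (triple_basis u v w i) (triple_basis u v w j)"
  using basic_triple_mul(2)[OF assms(1,4,5)] basic_triple_mul(2)[OF assms(1,4), of 0]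
    basic_triple_mul(2)[OF assms(1,5), of 0] basic_triple_mul(2)[OF assms(1,4,4)]
    basic_triple_mul(2)[OF assms(1,5,5)] assms(2-)
  unfolding triple_basis_simps by (simp add: orth_def imag_unit_def)

text \<open>This exchange, the sign change and the passage to the third weight generate the action
  of the Weyl group of G2, which is dihedral of order 12, on the pair of weights.\<close>

lemma diag_triple_swap: "diag_triple D a b u v w \<Longrightarrow> diag_triple D b a u w v"
  using triple_orth[of u v w 5 2] orth_sym[of v w]
  by (simp add: diag_triple_def basic_triple_def triple_basis_simps orth_def)

lemma diag_triple_neg: "diag_triple D a b u v w \<Longrightarrow> derivation D \<Longrightarrow> diag_triple D (- a) (- b) (- u) v w"
  by (simp add: diag_triple_def basic_triple_def orth_def imag_unit_def mul_minus B_minus derivation_def)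
    (metis scale_minus_left scale_one add.inverse_inverse scale_zero_right)

text \<open>The product \<open>v \<star> w\<close> carries the third weight: by the Leibniz rule
  both terms of \<open>D (v \<star> w)\<close> are multiples of
  \<open>(u \<star> v) \<star> w\<close>, which is
  \<open>- (u \<star> (v \<star> w))\<close>.\<close>

lemma diag_triple_third:
  assumes D: "diag_triple D a b u v w" "derivation D"
  shows "diag_triple D a (- (a + b)) u v (v \<star> w)"
proof -
  have t: "basic_triple u v w" using D(1) by (simp add: diag_triple_def)
  have "D (v \<star> w) = a \<odot> ((u \<star> v) \<star> w) + b \<odot> (v \<star> (u \<star> w))"
    using D by (simp add: diag_triple_def derivation_def mul_scale_left mul_scale_right)
  also have "v \<star> (u \<star> w) = (u \<star> v) \<star> w"
    using basic_triple_mul(1)[OF t, of 2 5] by (simp add: oct_sign_def oct_index_def triple_basis_simps)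
  also have "(u \<star> v) \<star> w = - (u \<star> (v \<star> w))"
    using basic_triple_mul(1)[OF t, of 1 6] by (simp add: oct_sign_def oct_index_def triple_basis_simps)
  finally have "D (v \<star> w) = (- (a + b)) \<odot> (u \<star> (v \<star> w))"
    by (simp add: scale_left_distrib scale_left_diff_distrib)
  then show ?thesis
    using D(1) t triple_orth[OF t, of 1 6] triple_orth[OF t, of 2 6] triple_orth[OF t, of 3 6]
    by (auto simp: diag_triple_def basic_triple_def triple_basis_simps orth_def)
qed

end

text \<open>A spanning reference triple pins the dimension to 8. In spite of the name, the real
  division algebra is an instance; the split form arises as its complexification.\<close>

locale split_octonion_algebra = octonion_algebra +
  fixes u\<^sub>0 v\<^sub>0 w\<^sub>0
  assumes standard_triple: "basic_triple u\<^sub>0 v\<^sub>0 w\<^sub>0"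
    and standard_span: "x \<in> span (triple_basis u\<^sub>0 v\<^sub>0 w\<^sub>0 ` {..<8})"
begin

lemma triple_set:
  assumes "basic_triple u v w"
  shows "inj_on (triple_basis u v w) {..<8}" "independent (triple_basis u v w ` {..<8})"
    "card (triple_basis u v w ` {..<8}) = 8"
proof -
  show i: "inj_on (triple_basis u v w) {..<8}"
  proof (rule inj_onI)
    fix i j :: nat assume ij: "i \<in> {..<8}" "j \<in> {..<8}" "triple_basis u v w i = triple_basis u v w j"
    then show "i = j"
      using basic_triple_mul(2)[OF assms, of i j] basic_triple_mul(2)[OF assms, of j j]
      by (auto split: if_splits)
  qed
  then show "card (triple_basis u v w ` {..<8}) = 8" by (simp add: card_image)
  show "independent (triple_basis u v w ` {..<8})"
    by (rule orthonormal_independent) (use basic_triple_mul(2)[OF assms] i in \<open>auto simp: inj_on_def\<close>)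
qed

text \<open>The eight orthonormal products of any basic triple are as many as the reference basis
  has, hence span.\<close>

lemma triple_span: assumes "basic_triple u v w" shows "x \<in> span (triple_basis u v w ` {..<8})"
  using span_eq_of_independent_card[OF triple_set(2)[OF assms], of "triple_basis u\<^sub>0 v\<^sub>0 w\<^sub>0 ` {..<8}"]
    triple_set(3)[OF assms] triple_set(3)[OF standard_triple] standard_span by auto

lemma triple_induct [consumes 1, case_names basis zero add scale]:
  assumes t: "basic_triple u v w" and k: "\<And>k. k < 8 \<Longrightarrow> P (triple_basis u v w k)"
    and 0: "P 0" "\<And>x y. P x \<Longrightarrow> P y \<Longrightarrow> P (x + y)" "\<And>a x. P x \<Longrightarrow> P (a \<odot> x)"
  shows "P x"
proof -
  have "subspace {x. P x}" using 0 by (auto simp: subspace_def)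
  moreover have "triple_basis u v w ` {..<8} \<subseteq> {x. P x}" using k by auto
  ultimately show ?thesis using span_minimal triple_span[OF t, of x] by blast
qed

lemma triple_expand:
  assumes "basic_triple u v w"
  shows "x = (\<Sum>k<8. B x (triple_basis u v w k) \<odot> triple_basis u v w k)"
  using assms
proof (induction x rule: triple_induct)
  case (basis k)
  then have "(\<Sum>j<8. B (triple_basis u v w k) (triple_basis u v w j) \<odot> triple_basis u v w j)
    = (\<Sum>j<8. if k = j then triple_basis u v w j else 0)"
    by (intro sum.cong) (use basic_triple_mul(2)[OF assms] in auto)
  then show ?case using basis by simp
next
  case (add x y)
  have "(\<Sum>k<8. B (x + y) (triple_basis u v w k) \<odot> triple_basis u v w k) =
    (\<Sum>k<8. B x (triple_basis u v w k) \<odot> triple_basis u v w k) + (\<Sum>k<8. B y (triple_basis u v w k) \<odot> triple_basis u v w k)"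
    by (simp add: B_add_left scale_left_distrib sum.distrib)
  then show ?case using add by metis
next
  case (scale a x)
  have "(\<Sum>k<8. B (a \<odot> x) (triple_basis u v w k) \<odot> triple_basis u v w k) =
    a \<odot> (\<Sum>k<8. B x (triple_basis u v w k) \<odot> triple_basis u v w k)"
    by (simp add: B_scale_left scale_sum_right)
  then show ?case using scale by metis
qed (simp add: B_0)

lemma B_nondegenerate: "(\<And>y. B x y = 0) \<Longrightarrow> x = 0"
  using triple_expand[OF standard_triple, of x] by simp

text \<open>Orthogonal projection off \<open>S\<close>. A nonzero vector of the complement may be
  isotropic, so the result is a pair with nonzero product; the search for a nonisotropic eigenvector
  starts from such a pair.\<close>

lemma orth_complement_nondegenerate:
  assumes fin: "finite S" and c: "card S < 8"
    and S: "\<And>x y. x \<in> S \<Longrightarrow> y \<in> S \<Longrightarrow> B x y = (if x = y then 1 else 0)"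
  obtains x y where "B x y \<noteq> 0" "\<And>s. s \<in> S \<Longrightarrow> B x s = 0" "\<And>s. s \<in> S \<Longrightarrow> B y s = 0"
proof -
  define pr where "pr z = z - (\<Sum>s\<in>S. B z s \<odot> s)" for z
  have pr: "B (pr z) s = 0" if "s \<in> S" for z s
  proof -
    have "(\<Sum>t\<in>S. B z t * B t s) = (\<Sum>t\<in>S. if t = s then B z t else 0)"
      by (intro sum.cong) (use S that in auto)
    then show ?thesis using fin that by (simp add: pr_def B_diff B_sum_left B_scale_left)
  qed
  have "\<exists>z. pr z \<noteq> 0"
  proof (rule ccontr)
    assume "\<not> ?thesis"
    then have z: "z = (\<Sum>s\<in>S. B z s \<odot> s)" for z by (simp add: pr_def)
    have "z \<in> span S" for z by (subst z) (intro span_sum span_scale span_base)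
    then have "card (triple_basis u\<^sub>0 v\<^sub>0 w\<^sub>0 ` {..<8}) \<le> card S"
      using independent_span_bound[OF fin triple_set(2)[OF standard_triple]] by auto
    then show False using c triple_set(3)[OF standard_triple] by simp
  qed
  then obtain x y where xy: "B (pr x) y \<noteq> 0" using B_nondegenerate by blast
  have "B (pr x) (\<Sum>s\<in>S. B y s \<odot> s) = 0"
    unfolding B_commute[of "pr x"] B_sum_left B_scale_left
    using pr B_commute[of _ "pr x"] by (intro sum.neutral) auto
  then have "B (pr x) (pr y) \<noteq> 0" using xy by (simp add: pr_def[of y] B_diff)
  then show thesis using that pr by blast
qed

definition triple_map :: "'b \<Rightarrow> 'b \<Rightarrow> 'b \<Rightarrow> 'b \<Rightarrow> 'b" where
  "triple_map u v w x = (\<Sum>k<8. B x (triple_basis u\<^sub>0 v\<^sub>0 w\<^sub>0 k) \<odot> triple_basis u v w k)"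

definition triple_map_inv :: "'b \<Rightarrow> 'b \<Rightarrow> 'b \<Rightarrow> 'b \<Rightarrow> 'b" where
  "triple_map_inv u v w x = (\<Sum>k<8. B x (triple_basis u v w k) \<odot> triple_basis u\<^sub>0 v\<^sub>0 w\<^sub>0 k)"

lemma triple_map_linear:
  "triple_map u v w (x + y) = triple_map u v w x + triple_map u v w y"
  "triple_map u v w (a \<odot> x) = a \<odot> triple_map u v w x"
  "triple_map_inv u v w (x + y) = triple_map_inv u v w x + triple_map_inv u v w y"
  "triple_map_inv u v w (a \<odot> x) = a \<odot> triple_map_inv u v w x"
  "triple_map u v w 0 = 0" "triple_map_inv u v w 0 = 0"
  by (simp_all add: triple_map_def triple_map_inv_def B_add_left B_scale_left B_0
      scale_left_distrib sum.distrib scale_sum_right)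

lemma triple_map_basis:
  assumes "k < 8"
  shows "triple_map u v w (triple_basis u\<^sub>0 v\<^sub>0 w\<^sub>0 k) = triple_basis u v w k"
proof -
  have "triple_map u v w (triple_basis u\<^sub>0 v\<^sub>0 w\<^sub>0 k) = (\<Sum>j<8. if k = j then triple_basis u v w j else 0)"
    unfolding triple_map_def
    by (intro sum.cong) (use basic_triple_mul(2)[OF standard_triple] assms in auto)
  then show ?thesis using assms by simp
qed

lemma triple_map_inv_basis:
  assumes "basic_triple u v w" "k < 8"
  shows "triple_map_inv u v w (triple_basis u v w k) = triple_basis u\<^sub>0 v\<^sub>0 w\<^sub>0 k"
proof -
  have "triple_map_inv u v w (triple_basis u v w k) = (\<Sum>j<8. if k = j then triple_basis u\<^sub>0 v\<^sub>0 w\<^sub>0 j else 0)"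
    unfolding triple_map_inv_def
    by (intro sum.cong) (use basic_triple_mul(2)[OF assms(1)] assms in auto)
  then show ?thesis using assms by simp
qed

lemma triple_map_inverse:
  assumes t: "basic_triple u v w"
  shows "triple_map_inv u v w (triple_map u v w x) = x" "triple_map u v w (triple_map_inv u v w x) = x"
proof -
  show "triple_map_inv u v w (triple_map u v w x) = x"
    by (induction x rule: triple_induct[OF standard_triple])
      (simp_all add: triple_map_linear triple_map_basis triple_map_inv_basis[OF t])
  show "triple_map u v w (triple_map_inv u v w x) = x"
    by (induction x rule: triple_induct[OF t])
      (simp_all add: triple_map_linear triple_map_basis triple_map_inv_basis[OF t])
qed

lemma oct_index_less: "i < 8 \<Longrightarrow> j < 8 \<Longrightarrow> oct_index i j < 8"
proof -
  have "\<forall>i<8. \<forall>j<8. oct_index i j < 8" unfolding all_less_8 by (simp add: oct_index_def)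
  then show "i < 8 \<Longrightarrow> j < 8 \<Longrightarrow> oct_index i j < 8" by blast
qed

text \<open>Both bases obey the same multiplication table, so the linear map between them is
  multiplicative on basis elements and hence everywhere.\<close>

lemma triple_map_mul:
  assumes t: "basic_triple u v w"
  shows "triple_map u v w (x \<star> y) = triple_map u v w x \<star> triple_map u v w y"
  using standard_triple
proof (induction x rule: triple_induct)
  case (basis i)
  show ?case
    using standard_triple \<open>i < 8\<close>
  proof (induction y rule: triple_induct)
    case (basis j)
    then show ?case
      using basic_triple_mul(1)[OF t, of i j] basic_triple_mul(1)[OF standard_triple, of i j]
      by (simp add: triple_map_basis triple_map_linear oct_index_less)
  qed (simp_all add: triple_map_linear mul_0 mul_add_right mul_scale_right)
qed (simp_all add: triple_map_linear mul_0 mul_add_left mul_scale_left)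

lemma triple_map_inv_mul:
  assumes t: "basic_triple u v w"
  shows "triple_map_inv u v w (x \<star> y) = triple_map_inv u v w x \<star> triple_map_inv u v w y"
  using triple_map_mul[OF t, of "triple_map_inv u v w x" "triple_map_inv u v w y"]
  by (metis triple_map_inverse[OF t])

lemma triple_map_standard:
  "triple_map u v w u\<^sub>0 = u" "triple_map u v w v\<^sub>0 = v" "triple_map u v w w\<^sub>0 = w"
  using triple_map_basis[of 1 u v w] triple_map_basis[of 2 u v w] triple_map_basis[of 4 u v w]
  unfolding triple_basis_simps by simp_all

lemma triple_map_inv_triple:
  assumes "basic_triple u v w"
  shows "triple_map_inv u v w u = u\<^sub>0" "triple_map_inv u v w v = v\<^sub>0" "triple_map_inv u v w w = w\<^sub>0"
  using triple_map_standard triple_map_inverse[OF assms] by metis+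

section \<open>Skewness of derivations and the symmetric operator attached to a fixed unit\<close>

context
  fixes D assumes D: "derivation D"
begin

lemma derivation_linear: "D (x + y) = D x + D y" "D (a \<odot> x) = a \<odot> D x" "D 0 = 0" "D (- x) = - D x"
  "D (x - y) = D x - D y" "D (x \<star> y) = D x \<star> y + x \<star> D y"
proof -
  show 1: "D (x + y) = D x + D y" "D (a \<odot> x) = a \<odot> D x" "D (x \<star> y) = D x \<star> y + x \<star> D y" for x y a
    using D by (auto simp: derivation_def)
  show "D 0 = 0" using 1(2)[of 0 0] by simp
  show 2: "D (- x) = - D x" for x using 1(2)[of "- 1" x] by simp
  show "D (x - y) = D x - D y" using 1(1)[of x "- y"] 2[of y] by simp
qed

lemma derivation_one: "D one = 0"
  using derivation_linear(6)[of one one] by (simp add: mul_one one_mul)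

text \<open>Differentiating \<open>x \<star> x = - one\<close> leaves a multiple of
  \<open>one\<close> plus \<open>2 * r\<close> times \<open>x\<close>, with \<open>r\<close> the
  real part of \<open>D x\<close>; pairing with \<open>x\<close> isolates
  \<open>2 * r\<close>.\<close>

lemma derivation_imag_unit: assumes "imag_unit x" shows "B (D x) one = 0"
proof -
  define r where "r = B (D x) one"
  define y where "y = D x - r \<odot> one"
  have y: "B y one = 0" by (simp add: y_def r_def B_diff B_scale_left B_one)
  have "D (x \<star> x) = 0"
    unfolding imag_unit_square[OF assms] by (simp add: derivation_linear derivation_one)
  moreover have "(2 * r) \<odot> x = r \<odot> x + r \<odot> x" by (simp only: mult_2 scale_left_distrib)
  ultimately have "(y \<star> x + x \<star> y) + (2 * r) \<odot> x = 0"
    by (simp add: y_def derivation_linear(6) mul_diff mul_scale_left mul_scale_right one_mul mul_one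
       algebra_simps)
  then have "(-2 * B y x) \<odot> one + (2 * r) \<odot> x = 0"
    using imag_anticommute[OF y, of x] assms by (simp add: imag_unit_def)
  then have "B ((-2 * B y x) \<odot> one + (2 * r) \<odot> x) x = 0" by (simp add: B_0)
  then have "2 * r = 0"
    using assms B_commute[of one x] by (simp only: B_add_left B_scale_left imag_unit_def) simp
  then show ?thesis using two_neq_0 by (simp add: r_def)
qed

lemma derivation_imag: "B (D x) one = 0"
  using standard_triple
proof (induction x rule: triple_induct)
  case (basis k)
  show ?case
  proof (cases "k = 0")
    case True then show ?thesis by (simp add: triple_basis_simps derivation_one B_0)
  next
    case False
    then have "orth (triple_basis u\<^sub>0 v\<^sub>0 w\<^sub>0 k) (triple_basis u\<^sub>0 v\<^sub>0 w\<^sub>0 (if k = 1 then 2 else 1))"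
      by (intro triple_orth standard_triple) (use basis in auto)
    then show ?thesis by (intro derivation_imag_unit) (simp add: orth_def)
  qed
qed (simp_all add: derivation_linear B_0 B_add_left B_scale_left)

text \<open>Apply \<open>D\<close> to
  \<open>x' \<star> y' + y' \<star> x' = (- 2 * B x' y') \<odot> one\<close>. Its right side is
  killed, and subtracting multiples of \<open>one\<close> from \<open>x\<close> and \<open>y\<close>
  changes neither \<open>D x\<close> nor \<open>D y\<close>.\<close>

lemma derivation_skew: "B (D x) y = - B x (D y)"
proof -
  define x' y' where "x' = x - B x one \<odot> one" and "y' = y - B y one \<odot> one"
  have i: "B x' one = 0" "B y' one = 0"
    by (simp_all add: x'_def y'_def B_diff B_scale_left B_one)
  have d: "D x' = D x" "D y' = D y"
    by (simp_all add: x'_def y'_def derivation_linear derivation_one)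
  have "D (x' \<star> y' + y' \<star> x') = 0"
    unfolding imag_anticommute[OF i] by (simp add: derivation_linear derivation_one)
  moreover have "D (x' \<star> y' + y' \<star> x') = (D x \<star> y' + y' \<star> D x) + (x' \<star> D y + D y \<star> x')"
    by (simp add: derivation_linear d algebra_simps)
  moreover have "\<dots> = (- 2 * B (D x) y' + - 2 * B x' (D y)) \<odot> one"
    by (simp only: imag_anticommute[OF derivation_imag i(2)] imag_anticommute[OF i(1) derivation_imag] scale_left_distrib)
  ultimately have "(- 2 * B (D x) y' + - 2 * B x' (D y)) \<odot> one = 0" by metis
  then have "B ((- 2 * B (D x) y' + - 2 * B x' (D y)) \<odot> one) one = 0" by (simp only: B_0)
  then have "- 2 * B (D x) y' + - 2 * B x' (D y) = 0" by (simp only: B_scale_left B_one mult_1_right)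
  moreover have "2 * (B (D x) y' + B x' (D y)) = - (- 2 * B (D x) y' + - 2 * B x' (D y))"
    by (simp add: algebra_simps)
  ultimately have "2 * (B (D x) y' + B x' (D y)) = 0" by (metis minus_zero)
  then have "B (D x) y' + B x' (D y) = 0" using two_neq_0 mult_eq_0_iff by blast
  then show ?thesis
    using derivation_imag[of x] derivation_imag[of y] B_commute[of one "D y"]
    by (simp add: x'_def y'_def B_diff B_scale_left B_scale_right eq_neg_iff_add_eq_0)
qed

text \<open>If \<open>D\<^sup>2 x = - m\<^sup>2 x\<close>, then \<open>x \<star> D x\<close> is annihilated by \<open>D\<close>.\<close>

lemma derivation_kernel_imag_unit:
  assumes x: "imag_unit x" and e: "D (D x) = - (m * m) \<odot> x" and 0: "m = 0 \<Longrightarrow> D x = 0"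
  obtains u where "imag_unit u" "D u = 0"
proof (cases "m = 0")
  case True
  then show ?thesis using that x 0 by blast
next
  case False
  define y where "y = inverse m \<odot> D x"
  have Dx: "D x = m \<odot> y" using False by (simp add: y_def)
  have Dy: "D y = - m \<odot> x" using False by (simp add: y_def derivation_linear e)
  have "B (D x) x = - B (D x) x" using derivation_skew[of x x] B_commute[of x "D x"] by simp
  then have "2 * B (D x) x = 0" by (simp add: eq_neg_iff_add_eq_0)
  then have xy: "B x y = 0" using two_neq_0 B_commute[of x "D x"] by (simp add: y_def B_scale_right)
  have "B y y = inverse m * B (D x) y" by (simp add: y_def B_scale_left)
  also have "\<dots> = 1" using False x by (simp add: derivation_skew Dy B_scale_right imag_unit_def B_minus)
  finally have "imag_unit y" by (simp add: imag_unit_def y_def B_scale_left derivation_imag)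
  then have o: "orth x y" using x xy by (simp add: orth_def)
  have "D (x \<star> y) = 0"
    using imag_unit_square[OF x] imag_unit_square[OF \<open>imag_unit y\<close>]
    by (simp add: derivation_linear(6) Dx Dy mul_scale_left mul_scale_right mul_minus)
  then show ?thesis using that orth_mul(1)[OF o] by blast
qed

text \<open>Left multiplication by \<open>u\<close> and \<open>D\<close> are both skew, and they
  commute because \<open>D u = 0\<close>; their composite is therefore symmetric, and its
  eigenvectors are the candidates for \<open>v\<close> and \<open>w\<close>.\<close>

lemma kernel_complement_invariant:
  assumes u: "imag_unit u" "D u = 0"
  shows "B (u \<star> D x) y = B x (u \<star> D y)" "B (u \<star> D x) one = 0" "B (u \<star> D x) u = 0"
proof -
  have u1: "B u one = 0" using u by (simp add: imag_unit_def)
  have "B (u \<star> D x) y = - B (D x) (u \<star> y)" by (rule imag_adjoint_left[OF u1])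
  also have "\<dots> = B x (u \<star> D y)" by (simp add: derivation_skew derivation_linear(6) u(2) mul_0)
  finally show "B (u \<star> D x) y = B x (u \<star> D y)" .
  show "B (u \<star> D x) one = 0" "B (u \<star> D x) u = 0"
    unfolding imag_adjoint_left[OF u1] derivation_skew
    by (simp_all add: derivation_linear(6) derivation_one u mul_0 B_0)
qed

lemma diag_eigenvector:
  assumes "imag_unit u" "u \<star> D v = c \<odot> v"
  shows "D v = (- c) \<odot> (u \<star> v)"
proof -
  have "- D v = u \<star> (c \<odot> v)" using imag_unit_left_left[OF assms(1), of "D v"] assms(2) by simp
  then show ?thesis by (simp add: mul_scale_right) (metis add.inverse_inverse)
qed

text \<open>\<open>u \<star> v\<close> has the same eigenvalue as \<open>v\<close>, since left
  multiplication by \<open>u\<close> commutes with the symmetric operator. The complement of both is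
  thus invariant, and \<open>w\<close> is sought there.\<close>

lemma eigenvector_complement_invariant:
  assumes u: "imag_unit u" "D u = 0" and v: "u \<star> D v = c \<odot> v"
    and x: "B x v = 0" "B x (u \<star> v) = 0"
  shows "B (u \<star> D x) v = 0" "B (u \<star> D x) (u \<star> v) = 0"
proof -
  note s = kernel_complement_invariant(1)[OF u]
  show "B (u \<star> D x) v = 0" unfolding s v using x by (simp add: B_scale_right)
  have "u \<star> D (u \<star> v) = c \<odot> (u \<star> v)"
    by (simp add: derivation_linear(6) u mul_0 imag_unit_left_left[OF u(1)] diag_eigenvector[OF u(1) v])
  then show "B (u \<star> D x) (u \<star> v) = 0" unfolding s using x by (simp add: B_scale_right)
qed

lemma diag_triple_of_eigenvectors:
  assumes u: "imag_unit u" "D u = 0"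
    and v: "imag_unit v" "B v u = 0" "u \<star> D v = c \<odot> v"
    and w: "imag_unit w" "B w u = 0" "B w v = 0" "B w (u \<star> v) = 0" "u \<star> D w = d \<odot> w"
  shows "diag_triple D (- c) (- d) u v w"
  using assms diag_eigenvector[OF u(1)] B_commute[of u v] B_commute[of u w] B_commute[of v w]
    B_commute[of "u \<star> v" w]
  by (simp add: diag_triple_def basic_triple_def orth_def)

end
end

section \<open>Diagonalizable derivations in the presence of isotropic vectors\<close>

context split_octonion_algebra begin

text \<open>If all eigenvectors were isotropic, polarization would annihilate \<open>B\<close>
  within each eigenspace, while symmetry makes different eigenspaces orthogonal; then
  \<open>B\<close> would vanish on all of \<open>X\<close>.\<close>

lemma nonisotropic_eigenvector:
  assumes M: "\<And>x y. M (x + y) = M x + M y"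
    and X: "\<And>x y. x \<in> X \<Longrightarrow> y \<in> X \<Longrightarrow> x + y \<in> X"
    and sym: "\<And>x y. x \<in> X \<Longrightarrow> y \<in> X \<Longrightarrow> B (M x) y = B x (M y)"
    and E: "X \<subseteq> span {x \<in> X. \<exists>c. M x = c \<odot> x}"
    and ne: "x \<in> X" "y \<in> X" "B x y \<noteq> 0"
  obtains z c where "z \<in> X" "M z = c \<odot> z" "B z z \<noteq> 0"
proof (rule ccontr)
  assume "\<not> thesis"
  then have iso: "B z z = 0" if "z \<in> X" "M z = c \<odot> z" for z c
    using that \<open>\<And>z c. z \<in> X \<Longrightarrow> M z = c \<odot> z \<Longrightarrow> B z z \<noteq> 0 \<Longrightarrow> thesis\<close> by blast
  let ?E = "{x \<in> X. \<exists>c. M x = c \<odot> x}"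
  have E0: "B p q = 0" if "p \<in> ?E" "q \<in> ?E" for p q
  proof -
    obtain c d where cd: "M p = c \<odot> p" "M q = d \<odot> q" and pq: "p \<in> X" "q \<in> X" using \<open>p \<in> ?E\<close> \<open>q \<in> ?E\<close> by blast
    show ?thesis
    proof (cases "c = d")
      case True
      then have "M (p + q) = c \<odot> (p + q)" using cd M by (simp add: scale_right_distrib)
      then have "B (p + q) (p + q) = 0" using X pq iso by blast
      then have "2 * B p q = 0"
        using iso[OF pq(1) cd(1)] iso[OF pq(2) cd(2)] B_commute[of q p]
        by (simp add: B_add_left B_add_right)
      then show ?thesis using two_neq_0 mult_eq_0_iff by blast
    next
      case False
      have "c * B p q = d * B p q" using sym[OF pq] by (simp add: cd B_scale_left B_scale_right)
      then show ?thesis using False by simp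
    qed
  qed
  have s1: "subspace {z. B z q = 0}" for q by (auto simp: subspace_def B_0 B_add_left B_scale_left)
  have s2: "subspace {z. B p z = 0}" for p by (auto simp: subspace_def B_0 B_add_right B_scale_right)
  have "B p q = 0" if "p \<in> span ?E" "q \<in> ?E" for p q
    using span_minimal[OF _ s1, of ?E q] E0 that by blast
  then have "B p q = 0" if "p \<in> span ?E" "q \<in> span ?E" for p q
    using span_minimal[OF _ s2, of ?E p] that by blast
  then show False using ne E by blast
qed

lemma unit_eigenvector:
  assumes sqrt: "\<And>c::'a. \<exists>s. s * s = c"
    and M: "\<And>x y. M (x + y) = M x + M y" "\<And>a x. M (a \<odot> x) = a \<odot> M x"
    and X: "subspace X"
    and sym: "\<And>x y. x \<in> X \<Longrightarrow> y \<in> X \<Longrightarrow> B (M x) y = B x (M y)"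
    and E: "X \<subseteq> span {x \<in> X. \<exists>c. M x = c \<odot> x}"
    and ne: "x \<in> X" "y \<in> X" "B x y \<noteq> 0"
  shows "\<exists>z c. z \<in> X \<and> M z = c \<odot> z \<and> B z z = 1"
proof -
  obtain z c where z: "z \<in> X" "M z = c \<odot> z" "B z z \<noteq> 0"
    using nonisotropic_eigenvector[OF M(1) subspace_add[OF X] sym E ne] by blast
  obtain s where s: "s * s = B z z" using sqrt by blast
  then have "s \<noteq> 0" using z(3) by auto
  then have "B (inverse s \<odot> z) (inverse s \<odot> z) = 1"
    using s z(3) by (simp add: B_scale_left B_scale_right field_simps)
  moreover have "M (inverse s \<odot> z) = c \<odot> (inverse s \<odot> z)" using z(2) M(2) by (simp add: mult.commute)
  ultimately show ?thesis using z(1) subspace_scale[OF X] by blast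
qed

text \<open>Passes diagonalizability to a smaller space: \<open>P\<close> sends each eigenvector
  that spans the larger space to a combination of eigenvectors in the smaller one.\<close>

lemma span_of_projection:
  assumes P: "\<And>x y. P (x + y) = P x + P y" "\<And>a x. P (a \<odot> x) = a \<odot> P x"
    and F: "\<And>x. x \<in> F \<Longrightarrow> P x \<in> span E" and x: "x \<in> span F" "P x = x"
  shows "x \<in> span E"
proof -
  have "P 0 = 0" using P(2)[of 0 0] by simp
  then have "subspace {x. P x \<in> span E}"
    by (auto simp: subspace_def P span_zero span_add span_scale)
  then have "P x \<in> span E" using span_minimal[of F "{x. P x \<in> span E}"] F x(1) by blast
  then show ?thesis using x(2) by simp
qed

lemma imag_unit_orthonormal:
  assumes "imag_unit u" "x \<in> {one, u}" "y \<in> {one, u}"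
  shows "B x y = (if x = y then 1 else 0)"
  using assms B_commute[of u one] by (auto simp: imag_unit_def B_one)

lemma orth_orthonormal:
  assumes "orth u v" "x \<in> {one, u, v, u \<star> v}" "y \<in> {one, u, v, u \<star> v}"
  shows "B x y = (if x = y then 1 else 0)"
proof -
  have d: "B p q = 0 \<and> B q p = 0 \<and> p \<noteq> q" if "orth p q" for p q
    using that B_commute[of p q] by (auto simp: orth_def imag_unit_def)
  have i: "B p p = 1 \<and> B p one = 0 \<and> B one p = 0 \<and> p \<noteq> one \<and> one \<noteq> p" if "imag_unit p" for p
    using that B_commute[of p one] by (auto simp: imag_unit_def B_one)
  have u: "imag_unit u" "imag_unit v" using assms(1) by (auto simp: orth_def)
  note dd = d[OF assms(1)] d[OF orth_mul(2)[OF assms(1)]] d[OF orth_mul(3)[OF assms(1)]]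
  note dd' = dd[THEN conjunct2, THEN conjunct2, THEN not_sym]
  show ?thesis
    using assms(2,3)
    by (elim insertE emptyE)
      (simp_all add: dd dd' i[OF u(1)] i[OF u(2)] i[OF orth_mul(1)[OF assms(1)]] B_one)
qed

lemma orth_complement_pair:
  assumes u: "imag_unit u"
  obtains x y where "B x y \<noteq> 0" "B x one = 0" "B x u = 0" "B y one = 0" "B y u = 0"
proof -
  have "card {one, u} < 8" by (simp add: card_insert_if)
  then obtain x y where "B x y \<noteq> 0" "\<And>s. s \<in> {one, u} \<Longrightarrow> B x s = 0" "\<And>s. s \<in> {one, u} \<Longrightarrow> B y s = 0"
    using orth_complement_nondegenerate[of "{one, u}"] imag_unit_orthonormal[OF u] by blast
  then show thesis using that by blast
qed

lemma orth_complement_quadruple: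
  assumes uv: "orth u v"
  obtains x y where "B x y \<noteq> 0"
    "B x one = 0" "B x u = 0" "B x v = 0" "B x (u \<star> v) = 0"
    "B y one = 0" "B y u = 0" "B y v = 0" "B y (u \<star> v) = 0"
proof -
  let ?S = "{one, u, v, u \<star> v}"
  have "card ?S < 8" by (simp add: card_insert_if)
  then obtain x y where "B x y \<noteq> 0" "\<And>s. s \<in> ?S \<Longrightarrow> B x s = 0" "\<And>s. s \<in> ?S \<Longrightarrow> B y s = 0"
    using orth_complement_nondegenerate[of ?S] orth_orthonormal[OF uv] by blast
  then show thesis using that by blast
qed

text \<open>An eigenvector of the square of \<open>D\<close> produces \<open>u\<close>; then
  \<open>v\<close> and \<open>w\<close> are unit eigenvectors of left multiplication by
  \<open>u\<close> after \<open>D\<close> on the complements of \<open>one, u\<close> and of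
  \<open>one, u, v, u \<star> v\<close>. At each stage diagonalizability has to be carried over to
  the complement before a unit eigenvector can be chosen.\<close>

lemma diag_triple_exists_of_diagonalizable:
  assumes \<iota>: "\<iota> * \<iota> = (-1::'a)" and sqrt: "\<And>c::'a. \<exists>s. s * s = c"
    and D: "derivation D"
    and diag: "{x. B x one = 0} \<subseteq> span {x. B x one = 0 \<and> (\<exists>c. D x = c \<odot> x)}"
  shows "\<exists>a b u v w. diag_triple D a b u v w"
proof -
  note lin = derivation_linear[OF D]
  obtain u where u: "imag_unit u" "D u = 0"
  proof -
    let ?X = "{x. B x one = 0}"
    have E: "?X \<subseteq> span {x \<in> ?X. \<exists>c. D (D x) = c \<odot> x}"
    proof
      fix x assume "x \<in> ?X"
      then have "x \<in> span {x. B x one = 0 \<and> (\<exists>c. D x = c \<odot> x)}" using diag by blast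
      moreover have "{x. B x one = 0 \<and> (\<exists>c. D x = c \<odot> x)} \<subseteq> {x \<in> ?X. \<exists>c. D (D x) = c \<odot> x}"
        by (auto simp: lin)
      ultimately show "x \<in> span {x \<in> ?X. \<exists>c. D (D x) = c \<odot> x}" using span_mono by blast
    qed
    have "B v\<^sub>0 v\<^sub>0 \<noteq> 0" "B v\<^sub>0 one = 0"
      using standard_triple by (auto simp: basic_triple_def orth_def imag_unit_def)
    then have "\<exists>x c. x \<in> ?X \<and> D (D x) = c \<odot> x \<and> B x x = 1"
      by (intro unit_eigenvector[where x = v\<^sub>0 and y = v\<^sub>0, OF sqrt _ _ _ _ E])
        (simp_all add: lin subspace_def B_0 B_add_left B_scale_left derivation_skew[OF D] B_minus)
    then obtain x c where x: "B x one = 0" "D (D x) = c \<odot> x" "B x x = 1" by blast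
    obtain m where m: "m * m = - c" using sqrt by blast
    \<comment> \<open>A vector killed by the square of \<open>D\<close> need not be killed by
      \<open>D\<close> unless diagonalizability is invoked, since \<open>D x\<close> could be a
      nonzero isotropic vector. Skewness makes \<open>D x\<close> orthogonal to each eigenvector of
      \<open>D\<close>, and these span the imaginary part.\<close>
    have Dx: "D x = 0" if "m = 0"
    proof -
      have DD: "D (D x) = 0" using that m x by simp
      let ?R = "{x. B x one = 0 \<and> (\<exists>c. D x = c \<odot> x)}"
      have "x \<in> span ?R" using diag x by blast
      moreover have "B y (D x) = 0" if "y \<in> ?R" for y
      proof -
        obtain d where d: "D y = d \<odot> y" using \<open>y \<in> ?R\<close> by blast
        have "0 = B (D (D y)) x" unfolding derivation_skew[OF D] DD by (simp add: B_0 B_minus)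
        then have "d = 0 \<or> B y x = 0" by (simp add: d lin B_scale_left)
        then have "B (D y) x = 0" by (auto simp: d B_scale_left B_0)
        then show ?thesis by (simp add: derivation_skew[OF D])
      qed
      moreover have "subspace {y. B y (D x) = 0}" by (auto simp: subspace_def B_0 B_add_left B_scale_left)
      ultimately have R: "B y (D x) = 0" if "y \<in> span ?R" for y
        using span_minimal[of ?R "{y. B y (D x) = 0}"] that by blast
      have "B (D x) y = 0" for y
      proof -
        have "B (y - B y one \<odot> one) one = 0" by (simp add: B_diff B_scale_left B_one)
        then have "B (y - B y one \<odot> one) (D x) = 0" using diag by (intro R) blast
        then have "B y (D x) = 0"
          using derivation_imag[OF D, of x] B_commute[of one "D x"] by (simp add: B_diff B_scale_left)
        then show ?thesis using B_commute[of y "D x"] by simp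
      qed
      then show "D x = 0" by (rule B_nondegenerate)
    qed
    have "imag_unit x" "D (D x) = - (m * m) \<odot> x" using x m by (auto simp: imag_unit_def)
    then show thesis using derivation_kernel_imag_unit[OF D _ _ Dx] that by blast
  qed
  have u1: "B u one = 0" using u(1) by (simp add: imag_unit_def)
  let ?M = "\<lambda>x. u \<star> D x"
  have Ml: "?M (x + y) = ?M x + ?M y" "?M (a \<odot> x) = a \<odot> ?M x" for x y a
    by (simp_all add: lin mul_add_right mul_scale_right)
  note Ms = kernel_complement_invariant(1)[OF D u]
  let ?X2 = "{x. B x one = 0 \<and> B x u = 0}"
  let ?E2 = "{x \<in> ?X2. \<exists>c. ?M x = c \<odot> x}"
  have E2: "?X2 \<subseteq> span ?E2"
  proof
    fix x assume x: "x \<in> ?X2"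
    define P where "P x = x - B x u \<odot> u" for x
    have Pe: "P e \<in> span ?E2" if e: "B e one = 0" "D e = c \<odot> e" for e c
    proof -
      define f where "f = P e"
      have f1: "B f one = 0" using e u1 by (simp add: f_def P_def B_diff B_scale_left)
      have fu: "B f u = 0" using e u(1) by (simp add: f_def P_def B_diff B_scale_left imag_unit_def)
      \<comment> \<open>By skewness and \<open>D u = 0\<close>, an eigenvector with nonzero
        eigenvalue is orthogonal to \<open>u\<close>; in either case removing its \<open>u\<close>
        component keeps it in the eigenspace.\<close>
      have "c * B e u = 0"
        using derivation_skew[OF D, of e u] by (simp add: e u B_0 B_scale_left)
      then have "c \<odot> (B e u \<odot> u) = 0" by auto
      then have Df: "D f = c \<odot> f"
        by (simp add: f_def P_def lin u e(2) scale_right_diff_distrib)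
      define g where "g = u \<star> f"
      have g1: "B g one = 0" and gu: "B g u = 0"
        using imag_adjoint_left[OF u1, of f one] imag_adjoint_left[OF u1, of f u] fu f1
          imag_unit_square[OF u(1)] by (simp_all add: g_def mul_one B_minus)
      have ug: "u \<star> g = - f" by (simp add: g_def imag_unit_left_left[OF u(1)])
      have Dg: "D g = c \<odot> g" by (simp add: g_def lin u mul_0 Df mul_scale_right)
      \<comment> \<open>\<open>f\<close> and \<open>g = u \<star> f\<close> lie in the same
        eigenspace of \<open>D\<close>. For \<open>a\<close> equal to \<open>\<iota>\<close> and
        \<open>- \<iota>\<close> the combinations diagonalize left multiplication by
        \<open>u\<close>, and \<open>f\<close> is half their sum.\<close>
      have "f + a \<odot> g \<in> ?E2" if "a * a = -1" for a
      proof -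
        have "?M (f + a \<odot> g) = c \<odot> g - (a * c) \<odot> f"
          by (simp add: Ml Df Dg mul_scale_right ug flip: g_def)
        also have "c \<odot> g = (- (a * a) * c) \<odot> g" unfolding that by simp
        also have "(- (a * a) * c) \<odot> g - (a * c) \<odot> f = (- (a * c)) \<odot> (f + a \<odot> g)"
          unfolding scale_right_distrib scale_scale by (simp add: ac_simps)
        finally have "\<exists>d. ?M (f + a \<odot> g) = d \<odot> (f + a \<odot> g)" by blast
        then show ?thesis using f1 fu g1 gu by (simp add: B_add_left B_scale_left)
      qed
      from this[of \<iota>] this[of "- \<iota>"] have "(f + \<iota> \<odot> g) + (f + (- \<iota>) \<odot> g) \<in> span ?E2"
        using \<iota> by (intro span_add span_base) auto
      moreover have "(f + \<iota> \<odot> g) + (f + (- \<iota>) \<odot> g) = f + f" by simp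
      ultimately have "inverse 2 \<odot> (f + f) \<in> span ?E2" by (intro span_scale) simp
      moreover have "f + f = 2 \<odot> f" by (metis one_add_one scale_left_distrib scale_one)
      ultimately show ?thesis using two_neq_0 by (simp add: f_def)
    qed
    have xs: "x \<in> span {x. B x one = 0 \<and> (\<exists>c. D x = c \<odot> x)}" using diag x by blast
    have Px: "P x = x" using x by (simp add: P_def)
    have Pl: "P (y + z) = P y + P z" "P (a \<odot> y) = a \<odot> P y" for y z a
      by (simp_all add: P_def B_add_left B_scale_left scale_left_distrib scale_right_diff_distrib)
    show "x \<in> span ?E2"
    proof (rule span_of_projection[where P = P, OF Pl _ xs Px])
      fix y assume "y \<in> {x. B x one = 0 \<and> (\<exists>c. D x = c \<odot> x)}"
      then show "P y \<in> span ?E2" using Pe by blast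
    qed
  qed
  obtain v c where v: "B v one = 0" "B v u = 0" "?M v = c \<odot> v" "B v v = 1"
  proof -
    obtain x y where "B x y \<noteq> 0" "x \<in> ?X2" "y \<in> ?X2"
      using orth_complement_pair[OF u(1)] by blast
    then have "\<exists>v c. v \<in> ?X2 \<and> ?M v = c \<odot> v \<and> B v v = 1"
      by (intro unit_eigenvector[where x = x and y = y, OF sqrt Ml _ Ms E2])
        (simp_all add: subspace_def B_0 B_add_left B_scale_left)
    then show thesis using that by blast
  qed
  have uv: "orth u v" using u v B_commute[of u v] by (simp add: orth_def imag_unit_def)
  define p where "p = u \<star> v"
  have Mp: "?M p = c \<odot> p"
    by (simp add: p_def lin u mul_0 imag_unit_left_left[OF u(1)] diag_eigenvector[OF D u(1) v(3)])
  have p: "B p one = 0" "B p u = 0" "B p v = 0" "B p p = 1" "B v p = 0"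
    using orth_mul[OF uv] B_commute[of p u] B_commute[of p v] by (auto simp: p_def orth_def imag_unit_def)
  let ?X3 = "{x. B x one = 0 \<and> B x u = 0 \<and> B x v = 0 \<and> B x p = 0}"
  let ?E3 = "{x \<in> ?X3. \<exists>c. ?M x = c \<odot> x}"
  have E3: "?X3 \<subseteq> span ?E3"
  proof
    fix x assume x: "x \<in> ?X3"
    define P where "P x = x - B x v \<odot> v - B x p \<odot> p" for x
    have Pe: "P e \<in> span ?E3" if e: "B e one = 0" "B e u = 0" "?M e = d \<odot> e" for e d
    proof -
      have "P e \<in> ?X3" using e v p
        by (auto simp: P_def B_diff B_scale_left)
      moreover have "?M (P e) = d \<odot> P e"
      proof -
        \<comment> \<open>Eigenvectors of a symmetric operator for different eigenvalues are
          orthogonal, so either \<open>d = c\<close> or the projection leaves \<open>e\<close>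
          unchanged.\<close>
        have "(d - c) * B e v = 0" "(d - c) * B e p = 0"
          using Ms[of e v] Ms[of e p]
          unfolding e v(3) Mp B_scale_left B_scale_right by (auto simp: algebra_simps)
        then have "d = c \<or> (B e v = 0 \<and> B e p = 0)" by auto
        then have "c \<odot> (B e v \<odot> v) = d \<odot> (B e v \<odot> v)" "c \<odot> (B e p \<odot> p) = d \<odot> (B e p \<odot> p)"
          by auto
        moreover have "?M (P e) = d \<odot> e - B e v \<odot> (c \<odot> v) - B e p \<odot> (c \<odot> p)"
          unfolding P_def by (simp only: lin mul_diff mul_scale_right e(3) v(3) Mp)
        moreover have "B e v \<odot> (c \<odot> v) = c \<odot> (B e v \<odot> v)" "B e p \<odot> (c \<odot> p) = c \<odot> (B e p \<odot> p)"
          by (simp_all add: mult.commute)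
        ultimately show ?thesis by (simp only: P_def scale_right_diff_distrib)
      qed
      ultimately show ?thesis by (intro span_base) blast
    qed
    have xs: "x \<in> span ?E2" using E2 x by blast
    have Px: "P x = x" using x by (simp add: P_def)
    have Pl: "P (y + z) = P y + P z" "P (a \<odot> y) = a \<odot> P y" for y z a
      by (simp_all add: P_def B_add_left B_scale_left scale_left_distrib scale_right_diff_distrib)
    show "x \<in> span ?E3"
    proof (rule span_of_projection[where P = P, OF Pl _ xs Px])
      fix y assume "y \<in> ?E2"
      then show "P y \<in> span ?E3" using Pe by blast
    qed
  qed
  obtain w d where w: "B w one = 0" "B w u = 0" "B w v = 0" "B w p = 0" "?M w = d \<odot> w" "B w w = 1"
  proof -
    obtain x y where "B x y \<noteq> 0" "x \<in> ?X3" "y \<in> ?X3"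
      using orth_complement_quadruple[OF uv] unfolding p_def by blast
    then have "\<exists>v c. v \<in> ?X3 \<and> ?M v = c \<odot> v \<and> B v v = 1"
      by (intro unit_eigenvector[where x = x and y = y, OF sqrt Ml _ Ms E3])
        (simp_all add: subspace_def B_0 B_add_left B_scale_left)
    then show thesis using that by blast
  qed
  have "diag_triple D (- c) (- d) u v w"
    using v w by (intro diag_triple_of_eigenvectors[OF D u _ v(2,3) _ w(2,3) _ w(5)])
      (simp_all add: imag_unit_def p_def)
  then show ?thesis by blast
qed

end

section \<open>The real and the complexified octonions\<close>

definition oct_i :: octonion where "oct_i = ((\<i>, 0), (0, 0))"
definition oct_j :: octonion where "oct_j = ((0, 1), (0, 0))"
definition oct_l :: octonion where "oct_l = ((0, 0), (1, 0))"

lemma inner_octonion: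
  "((x0, x1), (x2, x3)) \<bullet> (((y0, y1), (y2, y3)) :: octonion) =
     Re (x0 * cnj y0) + Re (x1 * cnj y1) + Re (x2 * cnj y2) + Re (x3 * cnj y3)"
  by (simp add: inner_complex_def)

lemma oct_mult_coords:
  "((x0, x1), (x2, x3)) \<otimes>\<^sub>O ((y0, y1), (y2, y3)) =
    ((x0 * y0 - x1 * cnj y1 - x2 * cnj y2 - cnj x3 * y3,
      x0 * y1 + x1 * cnj y0 + cnj x2 * y3 - x3 * cnj y2),
     (x0 * y2 + x2 * cnj y0 + x3 * cnj y1 - cnj x1 * y3,
      cnj x0 * y3 + x3 * y0 + x1 * y2 - x2 * y1))"
  by (simp add: oct_mult_def quat_mult_def quat_cnj_def algebra_simps)

lemma octonion_basis_products:
  "oct_i \<otimes>\<^sub>O oct_j = ((0, \<i>), (0, 0))" "oct_i \<otimes>\<^sub>O oct_l = ((0, 0), (\<i>, 0))"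
  "oct_j \<otimes>\<^sub>O oct_l = ((0, 0), (0, 1))" "((0, \<i>), (0, 0)) \<otimes>\<^sub>O oct_l = ((0, 0), (0, \<i>))"
  by (simp_all add: oct_i_def oct_j_def oct_l_def oct_mult_coords)

interpretation R8: octonion_algebra scaleR oct_mult oct_one "(\<bullet>)"
proof (unfold_locales, goal_cases)
  case (11 x y)
  obtain x0 x1 x2 x3 y0 y1 y2 y3 where xy: "x = ((x0, x1), (x2, x3))" "y = ((y0, y1), (y2, y3))"
    by (metis surj_pair)
  show ?case using 11 unfolding xy oct_one_def inner_octonion oct_mult_coords
    by (simp add: complex_eq_iff algebra_simps)
next
  case (12 x y z)
  obtain x0 x1 x2 x3 y0 y1 y2 y3 z0 z1 z2 z3
    where xyz: "x = ((x0, x1), (x2, x3))" "y = ((y0, y1), (y2, y3))" "z = ((z0, z1), (z2, z3))"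
    by (metis surj_pair)
  show ?case unfolding xyz oct_mult_coords by (simp add: oct_mult_coords algebra_simps)
next
  case (13 z x y)
  obtain x0 x1 x2 x3 y0 y1 y2 y3 z0 z1 z2 z3
    where xyz: "x = ((x0, x1), (x2, x3))" "y = ((y0, y1), (y2, y3))" "z = ((z0, z1), (z2, z3))"
    by (metis surj_pair)
  show ?case unfolding xyz oct_mult_coords by (simp add: oct_mult_coords algebra_simps)
next
  case (14 x y z)
  obtain x0 x1 x2 x3 y0 y1 y2 y3 z0 z1 z2 z3
    where xyz: "x = ((x0, x1), (x2, x3))" "y = ((y0, y1), (y2, y3))" "z = ((z0, z1), (z2, z3))"
    by (metis surj_pair)
  show ?case using 14 unfolding xyz oct_mult_coords inner_octonion oct_one_def by (simp add: algebra_simps)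
next
  case (15 x y z)
  obtain x0 x1 x2 x3 y0 y1 y2 y3 z0 z1 z2 z3
    where xyz: "x = ((x0, x1), (x2, x3))" "y = ((y0, y1), (y2, y3))" "z = ((z0, z1), (z2, z3))"
    by (metis surj_pair)
  show ?case using 15 unfolding xyz oct_mult_coords inner_octonion oct_one_def by (simp add: algebra_simps)
qed (simp_all add: oct_mult_bilinear inner_simps inner_commute oct_mult_one, simp_all add: oct_one_def)

lemma octonion_coords: "x = (\<Sum>k<8. (x \<bullet> R8.triple_basis oct_i oct_j oct_l k) *\<^sub>R R8.triple_basis oct_i oct_j oct_l k)"
proof -
  obtain x0 x1 x2 x3 where x: "x = ((x0, x1), (x2, x3))" by (metis surj_pair)
  show ?thesis unfolding sum_less_8 R8.triple_basis_simps octonion_basis_products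
    unfolding oct_one_def oct_i_def oct_j_def oct_l_def x inner_octonion
    by (simp add: complex_eq_iff)
qed

lemma basic_triple_standard: "R8.basic_triple oct_i oct_j oct_l"
  by (simp add: R8.basic_triple_def R8.orth_def R8.imag_unit_def octonion_basis_products inner_octonion)
    (simp add: oct_i_def oct_j_def oct_l_def oct_one_def)

interpretation R8: split_octonion_algebra scaleR oct_mult oct_one "(\<bullet>)" oct_i oct_j oct_l
proof
  show "R8.basic_triple oct_i oct_j oct_l" by (rule basic_triple_standard)
  show "x \<in> module.span scaleR (R8.triple_basis oct_i oct_j oct_l ` {..<8})" for x
    unfolding span_raw_def[symmetric]
    by (subst octonion_coords) (intro span_sum span_scale span_base imageI)
qed

text \<open>The spectral theorem is used three times: for the square of \<open>D\<close> on the
  imaginary octonions, then for left multiplication by \<open>u\<close> after \<open>D\<close> on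
  two successive orthogonal complements.\<close>

lemma real_derivation_diag_triple:
  assumes D: "R8.derivation D"
  shows "\<exists>a b u v w. R8.diag_triple D a b u v w"
proof -
  note lin = R8.derivation_linear[OF D]
  have lD: "linear D" by (intro linearI) (auto simp: lin)
  obtain u where u: "R8.imag_unit u" "D u = 0"
  proof -
    let ?X = "{x. x \<bullet> oct_one = 0}"
    have "oct_i \<in> ?X" "oct_i \<noteq> 0" by (auto simp: oct_i_def oct_one_def zero_prod_def)
    moreover have "linear (\<lambda>x. D (D x))" using linear_compose[OF lD lD] by (simp add: o_def)
    moreover have "subspace ?X" by (auto simp: subspace_def inner_simps)
    moreover have "D (D x) \<in> ?X" "D (D x) \<bullet> y = x \<bullet> D (D y)" for x y
      using R8.derivation_imag[OF D] by (simp_all add: R8.derivation_skew[OF D])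
    ultimately obtain x c where x: "x \<bullet> oct_one = 0" "x \<bullet> x = 1" "D (D x) = c *\<^sub>R x"
      by (elim symmetric_eigenvector[of "\<lambda>x. D (D x)" ?X oct_i]) blast+
    \<comment> \<open>Positive definiteness makes \<open>- c\<close> a squared length: it has a real
      square root \<open>m\<close>, and \<open>m = 0\<close> forces \<open>D x = 0\<close>.\<close>
    have c: "- c = D x \<bullet> D x" using R8.derivation_skew[OF D, of x "D x"] x by simp
    define m where "m = sqrt (- c)"
    have "- c \<ge> 0" unfolding c by simp
    then have m: "m * m = - c" by (simp add: m_def)
    have "D x = 0" if "m = 0" using that m c by simp
    then show thesis
      using R8.derivation_kernel_imag_unit[OF D, of x m] x m that by (auto simp: R8.imag_unit_def)
  qed
  let ?M = "\<lambda>x. u \<otimes>\<^sub>O D x"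
  have lM: "linear ?M" by (intro linearI) (auto simp: lin R8.mul_add_right R8.mul_scale_right)
  note Ms = R8.kernel_complement_invariant[OF D u]
  let ?X2 = "{x. x \<bullet> oct_one = 0 \<and> x \<bullet> u = 0}"
  obtain v c where v: "v \<in> ?X2" "v \<bullet> v = 1" "?M v = c *\<^sub>R v"
  proof -
    obtain x y where xy: "x \<bullet> y \<noteq> 0" "x \<in> ?X2" using R8.orth_complement_pair[OF u(1)] by blast
    then have x0: "x \<noteq> 0" by auto
    have sub: "subspace ?X2" by (auto simp: subspace_def inner_simps)
    have inv: "?M x \<in> ?X2" if "x \<in> ?X2" for x using Ms by simp
    show thesis by (rule symmetric_eigenvector[OF lM sub inv Ms(1) xy(2) x0]) (assumption | rule that)+
  qed
  have uv: "R8.orth u v" using u v by (simp add: R8.orth_def R8.imag_unit_def inner_commute)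
  let ?X3 = "{x. x \<bullet> oct_one = 0 \<and> x \<bullet> u = 0 \<and> x \<bullet> v = 0 \<and> x \<bullet> (u \<otimes>\<^sub>O v) = 0}"
  obtain w d where w: "w \<in> ?X3" "w \<bullet> w = 1" "?M w = d *\<^sub>R w"
  proof -
    obtain x y where xy: "x \<bullet> y \<noteq> 0" "x \<in> ?X3" using R8.orth_complement_quadruple[OF uv] by blast
    then have x0: "x \<noteq> 0" by auto
    have sub: "subspace ?X3" by (auto simp: subspace_def inner_simps)
    have inv: "?M x \<in> ?X3" if "x \<in> ?X3" for x
      using Ms R8.eigenvector_complement_invariant[OF D u v(3)] that by simp
    show thesis by (rule symmetric_eigenvector[OF lM sub inv Ms(1) xy(2) x0]) (assumption | rule that)+
  qed
  have "R8.diag_triple D (- c) (- d) u v w"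
    using v w by (intro R8.diag_triple_of_eigenvectors[OF D u]) (simp_all add: R8.imag_unit_def)
  then show ?thesis by blast
qed

section \<open>The complexified octonions\<close>

type_synonym coctonion = "octonion \<times> octonion"

text \<open>The complex bilinear extension of the inner product, without conjugation, so that
  derivations stay skew.\<close>

definition coct_inner :: "coctonion \<Rightarrow> coctonion \<Rightarrow> complex" where
  "coct_inner p q = Complex (fst p \<bullet> fst q - snd p \<bullet> snd q) (fst p \<bullet> snd q + snd p \<bullet> fst q)"

text \<open>\<open>cbracket\<close> is the complex bilinear extension of an arbitrary real product,
  not just of a Lie bracket.\<close>

abbreviation coct_mult :: "coctonion \<Rightarrow> coctonion \<Rightarrow> coctonion" where
  "coct_mult \<equiv> cbracket oct_mult"

interpretation C8: octonion_algebra cscale coct_mult "(oct_one, 0)" coct_inner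
proof -
  interpret C: vector_space "cscale :: complex \<Rightarrow> coctonion \<Rightarrow> coctonion" by (rule vector_space_cscale)
  note lin = R8.mul_add_left R8.mul_add_right R8.mul_scale_left R8.mul_scale_right R8.mul_0 R8.mul_diff R8.mul_minus
  \<comment> \<open>\<open>L\<close> and \<open>R\<close> measure the failure of the two linearised
    alternative laws. By trilinearity the complex defects are signed sums of real ones, all of which
    are zero.\<close>
  define L where "L x y z = x \<otimes>\<^sub>O (y \<otimes>\<^sub>O z) + y \<otimes>\<^sub>O (x \<otimes>\<^sub>O z) - (x \<otimes>\<^sub>O y + y \<otimes>\<^sub>O x) \<otimes>\<^sub>O z" for x y z
  define R where "R x y z = (z \<otimes>\<^sub>O x) \<otimes>\<^sub>O y + (z \<otimes>\<^sub>O y) \<otimes>\<^sub>O x - z \<otimes>\<^sub>O (x \<otimes>\<^sub>O y + y \<otimes>\<^sub>O x)" for x y z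
  have L: "L x y z = 0" and R: "R x y z = 0" for x y z
    using R8.left_alternative[of x y z] R8.right_alternative[of z x y] by (auto simp: L_def R_def)
  show "octonion_algebra cscale coct_mult (oct_one, 0) coct_inner"
  proof (unfold_locales, goal_cases)
    case (11 x y)
    then obtain a b c d where xy: "x = (a, b)" "y = (c, d)" by (metis surj_pair)
    have i: "a \<bullet> oct_one = 0" "b \<bullet> oct_one = 0" "c \<bullet> oct_one = 0" "d \<bullet> oct_one = 0"
      using 11 by (auto simp: xy coct_inner_def complex_eq_iff)
    note q = R8.imag_anticommute
    have "coct_mult x y + coct_mult y x =
      ((a \<otimes>\<^sub>O c + c \<otimes>\<^sub>O a) - (b \<otimes>\<^sub>O d + d \<otimes>\<^sub>O b), (a \<otimes>\<^sub>O d + d \<otimes>\<^sub>O a) + (b \<otimes>\<^sub>O c + c \<otimes>\<^sub>O b))"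
      by (simp add: xy cbracket_def)
    then show ?case unfolding q[OF i(1,3)] q[OF i(2,4)] q[OF i(1,4)] q[OF i(2,3)]
      by (simp add: xy coct_inner_def cscale_def algebra_simps)
  next
    case (12 x y z)
    obtain a b c d e f where xy: "x = (a, b)" "y = (c, d)" "z = (e, f)" by (metis surj_pair)
    have "coct_mult x (coct_mult y z) + coct_mult y (coct_mult x z) - coct_mult (coct_mult x y + coct_mult y x) z
      = (L a c e - L b d e - L a d f - L b c f, L a c f - L b d f + L a d e + L b c e)"
      by (simp add: xy cbracket_def L_def lin)
    then show ?case unfolding L by (simp add: flip: zero_prod_def)
  next
    case (13 z x y)
    obtain a b c d e f where xy: "x = (a, b)" "y = (c, d)" "z = (e, f)" by (metis surj_pair)
    have "coct_mult (coct_mult z x) y + coct_mult (coct_mult z y) x - coct_mult z (coct_mult x y + coct_mult y x)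
      = (R a c e - R b d e - R a d f - R b c f, R a c f - R b d f + R a d e + R b c e)"
      by (simp add: xy cbracket_def R_def lin)
    then show ?case unfolding R by (simp add: flip: zero_prod_def)
  next
    case (14 x y z)
    then show ?case
      by (simp add: coct_inner_def cbracket_def complex_eq_iff inner_simps R8.imag_adjoint_left algebra_simps)
  next
    case (15 x y z)
    then show ?case
      by (simp add: coct_inner_def cbracket_def complex_eq_iff inner_simps R8.imag_adjoint_right algebra_simps)
  qed (simp_all add: cbracket_def cscale_def coct_inner_def lin complex_eq_iff inner_simps algebra_simps
      R8.one_mul R8.mul_one R8.B_one inner_commute)
qed

interpretation C8: split_octonion_algebra cscale coct_mult "(oct_one, 0)" coct_inner "(oct_i, 0)" "(oct_j, 0)" "(oct_l, 0)"
proof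
  have m: "coct_mult (x, 0) (y, 0) = (x \<otimes>\<^sub>O y, 0)" for x y
    by (simp add: cbracket_def R8.mul_0)
  have b: "coct_inner (x, 0) (y, 0) = complex_of_real (x \<bullet> y)" for x y
    by (simp add: coct_inner_def complex_eq_iff)
  show "C8.basic_triple (oct_i, 0) (oct_j, 0) (oct_l, 0)"
    using basic_triple_standard
    by (simp add: R8.basic_triple_def R8.orth_def R8.imag_unit_def C8.basic_triple_def C8.orth_def C8.imag_unit_def m b)
  have t: "C8.triple_basis (oct_i, 0) (oct_j, 0) (oct_l, 0) k = (R8.triple_basis oct_i oct_j oct_l k, 0)" if "k < 8" for k
    using that unfolding less_8_cases
    by (auto simp: C8.triple_basis_simps R8.triple_basis_simps m)
  let ?S = "C8.span (C8.triple_basis (oct_i, 0) (oct_j, 0) (oct_l, 0) ` {..<8})"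
  have r: "(x, 0) \<in> ?S" for x
  proof -
    have "(\<Sum>k<8. cscale (complex_of_real (c k)) (b k, 0)) = (\<Sum>k<8. c k *\<^sub>R b k, 0)" for c and b :: "nat \<Rightarrow> octonion"
      by (simp add: sum_less_8 cscale_def)
    then have "(x, 0) = (\<Sum>k<8. cscale (complex_of_real (x \<bullet> R8.triple_basis oct_i oct_j oct_l k))
        (C8.triple_basis (oct_i, 0) (oct_j, 0) (oct_l, 0) k))"
      using octonion_coords[of x] by (simp add: t)
    then show ?thesis by (metis (no_types, lifting) C8.span_sum C8.span_scale C8.span_base imageI)
  qed
  show "x \<in> ?S" for x
  proof -
    have "x = (fst x, 0) + cscale \<i> (snd x, 0)" by (simp add: cscale_def prod_eq_iff)
    then show ?thesis using r C8.span_add C8.span_scale by metis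
  qed
qed

section \<open>Coordinates on the derivation algebra\<close>

text \<open>
  Write an octonion \<open>((z0, z1), (z2, z3))\<close> as a pair of \<open>z0 \<in> \<complex>\<close> and \<open>z = (z1, z2, cnj z3) \<in> \<complex>\<^sup>3\<close>; this
  turns left multiplication by \<open>oct_i\<close> into multiplication by \<open>\<i>\<close>. Derivations correspond to pairs
  of \<open>A \<in> su(3)\<close> and \<open>q \<in> \<complex>\<^sup>3\<close> acting by
  \<open>(z0, z) \<mapsto> (-2\<i> Re \<langle>z, q\<rangle>, A z + 2 Im z0 q + \<i> cnj (q \<times> z))\<close>. The coordinates with indices
  0, 1 are the diagonal entries of \<open>A\<close> divided by \<open>\<i>\<close>, those with indices 2 to 7 the entries
  12, 13, 23, 21, 31, 32 of \<open>A\<close>, those with indices 8 to 10 the vector \<open>q\<close>, and those with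
  indices 11 to 13 its conjugate, which becomes independent of \<open>q\<close> after complexification.
\<close>

definition oct_der :: "(nat \<Rightarrow> complex) \<Rightarrow> octonion \<Rightarrow> octonion" where
  "oct_der c x = (let z0 = fst (fst x); z1 = snd (fst x); z2 = fst (snd x); z3 = cnj (snd (snd x));
     s = z1 * cnj (c 8) + z2 * cnj (c 9) + z3 * cnj (c 10); t = - \<i> * (z0 - cnj z0);
     a = complex_of_real (Re (c 0)); b = complex_of_real (Re (c 1)) in
     ((- \<i> * (s + cnj s),
       \<i> * a * z1 + c 2 * z2 + c 3 * z3 + t * c 8 + \<i> * cnj (c 9 * z3 - c 10 * z2)),
      (- cnj (c 2) * z1 + \<i> * b * z2 + c 4 * z3 + t * c 9 + \<i> * cnj (c 10 * z1 - c 8 * z3),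
       cnj (- cnj (c 3) * z1 - cnj (c 4) * z2 - \<i> * (a + b) * z3 + t * c 10
         + \<i> * cnj (c 8 * z2 - c 9 * z1)))))"

text \<open>Reads \<open>A\<close> and \<open>q\<close> off the images of three generators:
  \<open>D oct_i\<close> is twice \<open>q\<close>, up to a conjugation in the last slot, and the
  cross product contribution of \<open>q\<close> is removed from the images of \<open>oct_j\<close>
  and \<open>oct_l\<close> before the matrix entries are taken.\<close>

definition g2_coord :: "(octonion \<Rightarrow> octonion) \<Rightarrow> nat \<Rightarrow> complex" where
  "g2_coord D k = (let q1 = snd (fst (D oct_i)) / 2; q2 = fst (snd (D oct_i)) / 2;
     q3 = cnj (snd (snd (D oct_i))) / 2;
     b12 = - cnj (fst (snd (D oct_j)) - \<i> * cnj q3); b13 = - (snd (snd (D oct_j)) - \<i> * q2);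
     b23 = - (snd (snd (D oct_l)) + \<i> * q1) in
     [complex_of_real (Im (snd (fst (D oct_j)))), complex_of_real (Im (fst (snd (D oct_l)))),
      b12, b13, b23, - cnj b12, - cnj b13, - cnj b23, q1, q2, q3, cnj q1, cnj q2, cnj q3] ! k)"

text \<open>Entries 0 to 7 are the commutator of the two matrices minus 3 times the antisymmetrized
  outer product of the \<open>q\<close> parts, made traceless on the diagonal. Entries 8 to 10 are
  \<open>A q' - A' q\<close> plus a conjugated cross product, and 11 to 13 their conjugates. No
  conjugation sign appears, so the formula is complex bilinear.\<close>

definition g2_bracket :: "(nat \<Rightarrow> complex) \<Rightarrow> (nat \<Rightarrow> complex) \<Rightarrow> nat \<Rightarrow> complex" where
  "g2_bracket x y k = [
      - \<i> * (x 2 * y 5 - y 2 * x 5 + x 3 * y 6 - y 3 * x 6 - 3 * (x 8 * y 11) + 3 * (y 8 * x 11) + (y 11 * x 8 - x 11 * y 8 + y 12 * x 9 - x 12 * y 9 + y 13 * x 10 - x 13 * y 10)),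
      - \<i> * (x 5 * y 2 - y 5 * x 2 + x 4 * y 7 - y 4 * x 7 - 3 * (x 9 * y 12) + 3 * (y 9 * x 12) + (y 11 * x 8 - x 11 * y 8 + y 12 * x 9 - x 12 * y 9 + y 13 * x 10 - x 13 * y 10)),
      (\<i> * x 0) * y 2 - (\<i> * y 0) * x 2 + x 2 * (\<i> * y 1) - y 2 * (\<i> * x 1) + x 3 * y 7 - y 3 * x 7 - 3 * (x 8 * y 12) + 3 * (y 8 * x 12),
      (\<i> * x 0) * y 3 - (\<i> * y 0) * x 3 + x 2 * y 4 - y 2 * x 4 + x 3 * (- \<i> * (y 0 + y 1)) - y 3 * (- \<i> * (x 0 + x 1)) - 3 * (x 8 * y 13) + 3 * (y 8 * x 13),
      x 5 * y 3 - y 5 * x 3 + (\<i> * x 1) * y 4 - (\<i> * y 1) * x 4 + x 4 * (- \<i> * (y 0 + y 1)) - y 4 * (- \<i> * (x 0 + x 1)) - 3 * (x 9 * y 13) + 3 * (y 9 * x 13),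
      x 5 * (\<i> * y 0) - y 5 * (\<i> * x 0) + (\<i> * x 1) * y 5 - (\<i> * y 1) * x 5 + x 4 * y 6 - y 4 * x 6 - 3 * (x 9 * y 11) + 3 * (y 9 * x 11),
      x 6 * (\<i> * y 0) - y 6 * (\<i> * x 0) + x 7 * y 5 - y 7 * x 5 + (- \<i> * (x 0 + x 1)) * y 6 - (- \<i> * (y 0 + y 1)) * x 6 - 3 * (x 10 * y 11) + 3 * (y 10 * x 11),
      x 6 * y 2 - y 6 * x 2 + x 7 * (\<i> * y 1) - y 7 * (\<i> * x 1) + (- \<i> * (x 0 + x 1)) * y 7 - (- \<i> * (y 0 + y 1)) * x 7 - 3 * (x 10 * y 12) + 3 * (y 10 * x 12),
      ((\<i> * x 0) * y 8 - (\<i> * y 0) * x 8) + (x 2 * y 9 - y 2 * x 9) + (x 3 * y 10 - y 3 * x 10) + 2 * \<i> * (x 12 * y 13 - x 13 * y 12),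
      (x 5 * y 8 - y 5 * x 8) + ((\<i> * x 1) * y 9 - (\<i> * y 1) * x 9) + (x 4 * y 10 - y 4 * x 10) + 2 * \<i> * (x 13 * y 11 - x 11 * y 13),
      (x 6 * y 8 - y 6 * x 8) + (x 7 * y 9 - y 7 * x 9) + ((- \<i> * (x 0 + x 1)) * y 10 - (- \<i> * (y 0 + y 1)) * x 10) + 2 * \<i> * (x 11 * y 12 - x 12 * y 11),
      ((\<i> * y 0) * x 11 - (\<i> * x 0) * y 11) + (y 5 * x 12 - x 5 * y 12) + (y 6 * x 13 - x 6 * y 13) - 2 * \<i> * (x 9 * y 10 - x 10 * y 9),
      (y 2 * x 11 - x 2 * y 11) + ((\<i> * y 1) * x 12 - (\<i> * x 1) * y 12) + (y 7 * x 13 - x 7 * y 13) - 2 * \<i> * (x 10 * y 8 - x 8 * y 10),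
      (y 3 * x 11 - x 3 * y 11) + (y 4 * x 12 - x 4 * y 12) + ((- \<i> * (y 0 + y 1)) * x 13 - (- \<i> * (x 0 + x 1)) * y 13) - 2 * \<i> * (x 8 * y 9 - x 9 * y 8)] ! k"

lemma less_14_cases: "(k::nat) < 14 \<longleftrightarrow> k = 0 \<or> k = 1 \<or> k = 2 \<or> k = 3 \<or> k = 4 \<or> k = 5 \<or> k = 6 \<or> k = 7
   \<or> k = 8 \<or> k = 9 \<or> k = 10 \<or> k = 11 \<or> k = 12 \<or> k = 13"
  by presburger

lemma all_less_14: "(\<forall>k<14::nat. P k) \<longleftrightarrow> P 0 \<and> P 1 \<and> P 2 \<and> P 3 \<and> P 4 \<and> P 5 \<and> P 6 \<and> P 7 \<and> P 8
   \<and> P 9 \<and> P 10 \<and> P 11 \<and> P 12 \<and> P 13"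
  unfolding less_14_cases by blast

lemma oct_der_derivation: "R8.derivation (oct_der c)"
  unfolding R8.derivation_def
proof (intro conjI allI, goal_cases)
  case (1 x y)
  then show ?case by (simp add: oct_der_def Let_def complex_eq_iff algebra_simps)
next
  case (2 r x)
  then show ?case by (simp add: oct_der_def Let_def complex_eq_iff algebra_simps)
next
  case (3 x y)
  obtain x0 x1 x2 x3 y0 y1 y2 y3 where xy: "x = ((x0, x1), (x2, x3))" "y = ((y0, y1), (y2, y3))"
    by (metis surj_pair)
  show ?case unfolding xy oct_der_def Let_def fst_conv snd_conv oct_mult_coords
    by (simp add: algebra_simps)
qed

lemma g2_coord_oct_der:
  "k < 14 \<Longrightarrow> g2_coord (oct_der c) k = [complex_of_real (Re (c 0)), complex_of_real (Re (c 1)),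
      c 2, c 3, c 4, - cnj (c 2), - cnj (c 3), - cnj (c 4), c 8, c 9, c 10, cnj (c 8), cnj (c 9), cnj (c 10)] ! k"
proof -
  have "g2_coord (oct_der c) k = [complex_of_real (Re (c 0)), complex_of_real (Re (c 1)),
      c 2, c 3, c 4, - cnj (c 2), - cnj (c 3), - cnj (c 4), c 8, c 9, c 10, cnj (c 8), cnj (c 9), cnj (c 10)] ! k"
    unfolding g2_coord_def oct_der_def Let_def oct_i_def oct_j_def oct_l_def by simp
  then show ?thesis .
qed

lemma derivation_eqI:
  assumes D: "R8.derivation D" and E: "R8.derivation E"
    and eq: "D oct_i = E oct_i" "D oct_j = E oct_j" "D oct_l = E oct_l"
  shows "D x = E x"
proof -
  note lin = R8.derivation_linear[OF D] R8.derivation_linear[OF E] R8.derivation_one[OF D] R8.derivation_one[OF E]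
  show ?thesis
    using R8.standard_triple
  proof (induction x rule: R8.triple_induct)
    case (basis k)
    then show ?case unfolding less_8_cases by (elim disjE) (simp_all add: R8.triple_basis_simps lin eq)
  qed (simp_all add: lin)
qed

lemma derivation_eq_oct_der:
  assumes D: "R8.derivation D"
  shows "D x = oct_der (g2_coord D) x"
proof (rule derivation_eqI[OF D oct_der_derivation])
  obtain i0 i1 i2 i3 j0 j1 j2 j3 l0 l1 l2 l3
    where di: "D oct_i = ((i0, i1), (i2, i3))" and dj: "D oct_j = ((j0, j1), (j2, j3))"
      and dl: "D oct_l = ((l0, l1), (l2, l3))" by (metis surj_pair)
  have dij: "D ((0, \<i>), (0, 0)) = D oct_i \<otimes>\<^sub>O oct_j + oct_i \<otimes>\<^sub>O D oct_j"
    using R8.derivation_linear(6)[OF D, of oct_i oct_j] by (simp add: octonion_basis_products)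
  note im = R8.derivation_imag[OF D]
  note sk = R8.derivation_skew[OF D]
  note fields = di dj dl dij
  \<comment> \<open>The images of the three generators have 24 real coordinates. These ten
    relations, all from imaginarity and skewness, leave 14, the dimension of the algebra.\<close>
  have eqs: "Re i0 = 0" "Re j0 = 0" "Re l0 = 0" "Im i0 = 0" "Im j0 = - Re i1" "Im l0 = - Re i2"
    "Re j1 = 0" "Re l2 = 0" "Re l1 = - Re j2" "Im l1 = Im j2 - Re i3"
    using im[of oct_i] im[of oct_j] im[of oct_l] sk[of oct_i oct_i] sk[of oct_j oct_i]
      sk[of oct_l oct_i] sk[of oct_j oct_j] sk[of oct_l oct_l] sk[of oct_l oct_j]
      sk[of oct_l "((0, \<i>), (0, 0))"]
    unfolding fields unfolding oct_i_def oct_j_def oct_l_def oct_one_def oct_mult_coords add_Pair inner_octonion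
    by simp_all
  show "D oct_i = oct_der (g2_coord D) oct_i" "D oct_j = oct_der (g2_coord D) oct_j"
    "D oct_l = oct_der (g2_coord D) oct_l"
    unfolding g2_coord_def oct_der_def Let_def di dj dl fst_conv snd_conv
    unfolding oct_i_def oct_j_def oct_l_def fst_conv snd_conv
    using eqs by (simp_all add: complex_eq_iff)
qed

section \<open>Coordinates on the complexified derivation algebra\<close>

type_synonym g2c_operator = "(octonion \<Rightarrow>\<^sub>L octonion) \<times> (octonion \<Rightarrow>\<^sub>L octonion)"

abbreviation g2c :: "g2c_operator set" where
  "g2c \<equiv> complexify g2"

abbreviation cbr :: "g2c_operator \<Rightarrow> _ \<Rightarrow> _" where
  "cbr \<equiv> cbracket commutator"

lemma g2_iff_derivation: "D \<in> g2 \<longleftrightarrow> R8.derivation (blinfun_apply D)"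
  by (simp add: g2_def R8.derivation_def blinfun.add_right blinfun.scaleR_right del: split_paired_All)

definition blinfun_der :: "(nat \<Rightarrow> complex) \<Rightarrow> octonion \<Rightarrow>\<^sub>L octonion" where
  "blinfun_der c = Blinfun (oct_der c)"

lemma blinfun_der_apply: "blinfun_apply (blinfun_der c) = oct_der c"
proof -
  have "linear (oct_der c)"
    using R8.derivation_linear[OF oct_der_derivation, of c] by (intro linearI) auto
  then have "bounded_linear (oct_der c)" by (simp add: linear_conv_bounded_linear)
  then show ?thesis unfolding blinfun_der_def by (rule bounded_linear_Blinfun_apply)
qed

lemma blinfun_der_in_g2: "blinfun_der c \<in> g2"
  by (simp add: g2_iff_derivation blinfun_der_apply oct_der_derivation)

lemma commutator_apply: "blinfun_apply (commutator D E) x = D (E x) - E (D x)"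
  by (simp add: commutator_def blinfun.diff_left)

lemma commutator_linear:
  "commutator (D + E) F = commutator D F + commutator E F" "commutator F (D + E) = commutator F D + commutator F E"
  "commutator (D - E) F = commutator D F - commutator E F" "commutator F (D - E) = commutator F D - commutator F E"
  "commutator (r *\<^sub>R D) E = r *\<^sub>R commutator D E" "commutator D (r *\<^sub>R E) = r *\<^sub>R commutator D E"
  "commutator 0 D = 0" "commutator D 0 = 0" "commutator D D = 0"
  by (auto intro!: blinfun_eqI simp: commutator_apply blinfun.bilinear_simps algebra_simps)

lemma g2_coord_linear:
  assumes "k < 14"
  shows "g2_coord (\<lambda>x. D x + E x) k = g2_coord D k + g2_coord E k"
    "g2_coord (\<lambda>x. D x - E x) k = g2_coord D k - g2_coord E k"
    "g2_coord (\<lambda>x. r *\<^sub>R D x) k = r *\<^sub>R g2_coord D k"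
proof -
  have "\<forall>k<14. g2_coord (\<lambda>x. D x + E x) k = g2_coord D k + g2_coord E k"
    "\<forall>k<14. g2_coord (\<lambda>x. D x - E x) k = g2_coord D k - g2_coord E k"
    "\<forall>k<14. g2_coord (\<lambda>x. r *\<^sub>R D x) k = r *\<^sub>R g2_coord D k"
    unfolding all_less_14 by (simp_all add: g2_coord_def Let_def complex_eq_iff field_simps)
  then show "g2_coord (\<lambda>x. D x + E x) k = g2_coord D k + g2_coord E k"
    "g2_coord (\<lambda>x. D x - E x) k = g2_coord D k - g2_coord E k"
    "g2_coord (\<lambda>x. r *\<^sub>R D x) k = r *\<^sub>R g2_coord D k" using assms by auto
qed

lemma g2_coord_commutator_oct_der:
  "\<forall>k<14. g2_coord (\<lambda>x. oct_der c (oct_der d x) - oct_der d (oct_der c x)) k =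
     g2_bracket (g2_coord (oct_der c)) (g2_coord (oct_der d)) k"
proof -
  note e = g2_coord_oct_der
  show ?thesis
    unfolding all_less_14 g2_bracket_def
    by (simp add: e, simp add: g2_coord_def oct_der_def Let_def oct_i_def oct_j_def oct_l_def, intro conjI,
        (simp add: complex_eq_iff algebra_simps)[1], (simp add: complex_eq_iff algebra_simps)[1],
        simp_all add: algebra_simps add_divide_distrib diff_divide_distrib)
qed

lemma g2_coord_commutator:
  assumes "D \<in> g2" "E \<in> g2" "k < 14"
  shows "g2_coord (blinfun_apply (commutator D E)) k = g2_bracket (g2_coord D) (g2_coord E) k"
proof -
  have DE: "blinfun_apply D = oct_der (g2_coord D)" "blinfun_apply E = oct_der (g2_coord E)"
    using assms derivation_eq_oct_der by (auto simp: g2_iff_derivation)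
  have "blinfun_apply (commutator D E) = (\<lambda>x. oct_der (g2_coord D) (oct_der (g2_coord E) x)
      - oct_der (g2_coord E) (oct_der (g2_coord D) x))"
    by (rule ext) (simp add: commutator_apply flip: DE)
  then show ?thesis
    using g2_coord_commutator_oct_der[of "g2_coord D" "g2_coord E"] assms(3)
    unfolding DE[symmetric] by simp
qed

lemma g2_eqI:
  assumes "D \<in> g2" "E \<in> g2" "\<And>k. k < 14 \<Longrightarrow> g2_coord D k = g2_coord E k"
  shows "D = E"
proof (rule blinfun_eqI)
  fix x
  have "oct_der (g2_coord D) x = oct_der (g2_coord E) x"
    unfolding oct_der_def using assms(3) by simp
  then show "D x = E x" using assms derivation_eq_oct_der by (metis g2_iff_derivation)
qed

definition g2c_coord :: "g2c_operator \<Rightarrow> nat \<Rightarrow> complex" where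
  "g2c_coord p k = g2_coord (fst p) k + \<i> * g2_coord (snd p) k"

text \<open>Inverse of \<open>g2c_coord\<close>: arbitrary complex coordinates are split into real
  and imaginary parts for the real structure of \<open>g2_coord_real\<close>, under which 5 is minus
  the conjugate of 2 and 11 is the conjugate of 8, and so on. The slots 5 to 7 are placeholders that
  \<open>oct_der\<close> does not read.\<close>

definition g2c_elem :: "(nat \<Rightarrow> complex) \<Rightarrow> g2c_operator" where
  "g2c_elem c =
    (blinfun_der ((!) [complex_of_real (Re (c 0)), complex_of_real (Re (c 1)),
       (c 2 - cnj (c 5)) / 2, (c 3 - cnj (c 6)) / 2, (c 4 - cnj (c 7)) / 2, 0, 0, 0,
       (c 8 + cnj (c 11)) / 2, (c 9 + cnj (c 12)) / 2, (c 10 + cnj (c 13)) / 2]),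
     blinfun_der ((!) [complex_of_real (Im (c 0)), complex_of_real (Im (c 1)),
       (c 2 + cnj (c 5)) / (2 * \<i>), (c 3 + cnj (c 6)) / (2 * \<i>), (c 4 + cnj (c 7)) / (2 * \<i>), 0, 0, 0,
       (c 8 - cnj (c 11)) / (2 * \<i>), (c 9 - cnj (c 12)) / (2 * \<i>), (c 10 - cnj (c 13)) / (2 * \<i>)]))"

lemma g2c_elem_in: "g2c_elem c \<in> g2c"
  by (simp add: g2c_elem_def complexify_def blinfun_der_in_g2)

lemma g2c_coord_elem: "k < 14 \<Longrightarrow> g2c_coord (g2c_elem c) k = c k"
proof -
  have "\<forall>k<14. g2c_coord (g2c_elem c) k = c k"
    unfolding all_less_14
    by (simp add: g2c_coord_def g2c_elem_def blinfun_der_apply g2_coord_oct_der complex_eq_iff field_simps)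
  then show "k < 14 \<Longrightarrow> g2c_coord (g2c_elem c) k = c k" by blast
qed

lemma g2_coord_blinfun_linear:
  assumes "k < 14"
  shows "g2_coord (blinfun_apply (D + E)) k = g2_coord D k + g2_coord E k"
    "g2_coord (blinfun_apply (D - E)) k = g2_coord D k - g2_coord E k"
    "g2_coord (blinfun_apply (r *\<^sub>R D)) k = r *\<^sub>R g2_coord D k"
    "g2_coord (blinfun_apply 0) k = 0"
proof -
  have "blinfun_apply (D + E) = (\<lambda>x. D x + E x)" "blinfun_apply (D - E) = (\<lambda>x. D x - E x)"
    "blinfun_apply (r *\<^sub>R D) = (\<lambda>x. r *\<^sub>R D x)" for D E :: "octonion \<Rightarrow>\<^sub>L octonion"
    by (auto simp: blinfun.bilinear_simps)
  then show 1: "g2_coord (blinfun_apply (D + E)) k = g2_coord D k + g2_coord E k"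
    "g2_coord (blinfun_apply (D - E)) k = g2_coord D k - g2_coord E k"
    "g2_coord (blinfun_apply (r *\<^sub>R D)) k = r *\<^sub>R g2_coord D k" for D E :: "octonion \<Rightarrow>\<^sub>L octonion"
    using g2_coord_linear[OF assms] by simp_all
  show "g2_coord (blinfun_apply 0) k = 0" using 1(2)[of 0 0] by simp
qed

lemma g2c_coord_linear:
  assumes "k < 14"
  shows "g2c_coord (p + q) k = g2c_coord p k + g2c_coord q k"
    "g2c_coord (p - q) k = g2c_coord p k - g2c_coord q k"
    "g2c_coord (cscale a p) k = a * g2c_coord p k" "g2c_coord 0 k = 0"
  using assms by (simp_all add: g2c_coord_def g2_coord_blinfun_linear cscale_def complex_eq_iff algebra_simps)

lemma g2_coord_real:
  assumes "D \<in> g2"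
  shows "g2_coord D 0 \<in> \<real>" "g2_coord D 1 \<in> \<real>"
    "g2_coord D 5 = - cnj (g2_coord D 2)" "g2_coord D 6 = - cnj (g2_coord D 3)"
    "g2_coord D 7 = - cnj (g2_coord D 4)" "g2_coord D 11 = cnj (g2_coord D 8)"
    "g2_coord D 12 = cnj (g2_coord D 9)" "g2_coord D 13 = cnj (g2_coord D 10)"
  by (simp_all add: g2_coord_def Let_def)

text \<open>Coordinates 0 and 1 of real elements are real, and the others come in pairs conjugate up
  to sign; the two members of a pair together separate the contributions of the real and the
  imaginary component.\<close>

lemma g2c_eqI:
  assumes "p \<in> g2c" "q \<in> g2c" "\<And>k. k < 14 \<Longrightarrow> g2c_coord p k = g2c_coord q k"
  shows "p = q"
proof -
  have g: "fst p \<in> g2" "snd p \<in> g2" "fst q \<in> g2" "snd q \<in> g2"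
    using assms(1,2) by (auto simp: complexify_def)
  have c: "\<forall>k<14. g2c_coord p k = g2c_coord q k" using assms(3) by blast
  have real: "x = x' \<and> y = y'" if "complex_of_real x + \<i> * complex_of_real y = complex_of_real x' + \<i> * complex_of_real y'" for x y x' y'
    using that by (simp add: complex_eq_iff)
  have anti: "x = x' \<and> y = y'" if "x + \<i> * y = x' + \<i> * y'" "- cnj x + \<i> * (- cnj y) = - cnj x' + \<i> * (- cnj y')" for x y x' y'
    using that by (auto simp add: complex_eq_iff)
  have conj: "x = x' \<and> y = y'" if "x + \<i> * y = x' + \<i> * y'" "cnj x + \<i> * cnj y = cnj x' + \<i> * cnj y'" for x y x' y'
    using that by (auto simp add: complex_eq_iff)
  have rr: "g2_coord D k = complex_of_real (Re (g2_coord D k))" if "k \<in> {0, 1}" for D and k :: nat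
    using that by (auto simp: g2_coord_def Let_def)
  note all = c[unfolded all_less_14 g2c_coord_def]
  note r = g[THEN g2_coord_real(3)] g[THEN g2_coord_real(4)] g[THEN g2_coord_real(5)]
     g[THEN g2_coord_real(6)] g[THEN g2_coord_real(7)] g[THEN g2_coord_real(8)]
  have "g2_coord (fst p) 0 = g2_coord (fst q) 0 \<and> g2_coord (snd p) 0 = g2_coord (snd q) 0"
    "g2_coord (fst p) 1 = g2_coord (fst q) 1 \<and> g2_coord (snd p) 1 = g2_coord (snd q) 1"
    using all real rr[of 0 "fst p"] rr[of 0 "fst q"] rr[of 0 "snd p"] rr[of 0 "snd q"]
      rr[of 1 "fst p"] rr[of 1 "fst q"] rr[of 1 "snd p"] rr[of 1 "snd q"]
    by (simp, metis)+
  moreover have "g2_coord (fst p) 2 = g2_coord (fst q) 2 \<and> g2_coord (snd p) 2 = g2_coord (snd q) 2"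
    "g2_coord (fst p) 3 = g2_coord (fst q) 3 \<and> g2_coord (snd p) 3 = g2_coord (snd q) 3"
    "g2_coord (fst p) 4 = g2_coord (fst q) 4 \<and> g2_coord (snd p) 4 = g2_coord (snd q) 4"
    by (rule anti; use all in \<open>simp add: r\<close>)+
  moreover have "g2_coord (fst p) 8 = g2_coord (fst q) 8 \<and> g2_coord (snd p) 8 = g2_coord (snd q) 8"
    "g2_coord (fst p) 9 = g2_coord (fst q) 9 \<and> g2_coord (snd p) 9 = g2_coord (snd q) 9"
    "g2_coord (fst p) 10 = g2_coord (fst q) 10 \<and> g2_coord (snd p) 10 = g2_coord (snd q) 10"
    by (rule conj; use all in \<open>simp add: r\<close>)+
  ultimately have "\<forall>k<14. g2_coord (fst p) k = g2_coord (fst q) k" "\<forall>k<14. g2_coord (snd p) k = g2_coord (snd q) k"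
    unfolding all_less_14 by (simp_all add: r)
  then show ?thesis using g2_eqI[OF g(1,3)] g2_eqI[OF g(2,4)] by (simp add: prod_eq_iff)
qed

lemma g2_bracket_bilinear:
  "\<forall>k<14. g2_bracket (\<lambda>k. a k + \<i> * b k) (\<lambda>k. c k + \<i> * d k) k =
    (g2_bracket a c k - g2_bracket b d k) + \<i> * (g2_bracket a d k + g2_bracket b c k)"
  unfolding all_less_14 g2_bracket_def by (simp add: algebra_simps)

lemma g2c_coord_bracket:
  assumes "p \<in> g2c" "q \<in> g2c" "k < 14"
  shows "g2c_coord (cbr p q) k = g2_bracket (g2c_coord p) (g2c_coord q) k"
proof -
  have g: "fst p \<in> g2" "snd p \<in> g2" "fst q \<in> g2" "snd q \<in> g2"
    using assms(1,2) by (auto simp: complexify_def)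
  have "g2c_coord p = (\<lambda>k. g2_coord (fst p) k + \<i> * g2_coord (snd p) k)"
    "g2c_coord q = (\<lambda>k. g2_coord (fst q) k + \<i> * g2_coord (snd q) k)"
    by (auto simp: g2c_coord_def)
  then show ?thesis
    using g2_bracket_bilinear assms(3) g
    by (simp add: cbracket_def g2c_coord_def g2_coord_blinfun_linear g2_coord_commutator)
qed

section \<open>Action on the complexified octonions\<close>

text \<open>Finitely many iterates of \<open>v\<close> satisfy a linear relation, so a nonzero
  polynomial in \<open>F\<close> kills \<open>v\<close>. Splitting off a root either exhibits an
  eigenvector or leaves a nonzero vector of \<open>X\<close> killed by a polynomial of smaller
  degree.\<close>

lemma (in vector_space) invariant_subspace_eigenvector:
  fixes F :: "'b \<Rightarrow> 'b"
  assumes alg: "\<And>p :: 'a poly. degree p > 0 \<Longrightarrow> \<exists>z. poly p z = 0"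
    and F: "\<And>x y. F (x + y) = F x + F y" "\<And>a x. F (scale a x) = scale a (F x)"
    and X: "subspace X" "\<And>x. x \<in> X \<Longrightarrow> F x \<in> X" "X \<subseteq> span S" "finite S"
    and v: "v \<in> X" "v \<noteq> 0"
  shows "\<exists>x c. x \<in> X \<and> x \<noteq> 0 \<and> F x = scale c x"
proof -
  \<comment> \<open>\<open>ev p\<close> is \<open>p\<close> evaluated at the operator
    \<open>F\<close>.\<close>
  define ev where "ev p = fold_coeffs (\<lambda>a g x. scale a x + g (F x)) p (\<lambda>x. 0)" for p
  have ev_0: "ev 0 x = 0" for x by (simp add: ev_def)
  have ev_pCons: "ev (pCons a p) x = scale a x + ev p (F x)" for a p x
    by (cases "p = 0 \<and> a = 0") (auto simp: ev_def)
  have ev_add: "ev p (x + y) = ev p x + ev p y" for p x y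
    by (induction p arbitrary: x y) (simp_all add: ev_0 ev_pCons F scale_right_distrib)
  have ev_scale: "ev p (scale a x) = scale a (ev p x)" for p a x
    by (induction p arbitrary: x) (simp_all add: ev_0 ev_pCons F scale_right_distrib mult.commute)
  have ev_padd: "ev (p + q) x = ev p x + ev q x" for p q x
  proof (induction p arbitrary: q x)
    case (pCons a p)
    obtain b r where "q = pCons b r" by (cases q)
    then show ?case using pCons by (simp add: ev_pCons scale_left_distrib)
  qed (simp add: ev_0)
  have ev_smult: "ev (smult a p) x = scale a (ev p x)" for a p x
    by (induction p arbitrary: x) (simp_all add: ev_0 ev_pCons scale_right_distrib)
  have ev_monom: "ev (monom a n) x = scale a ((F ^^ n) x)" for a n x
    by (induction n arbitrary: x) (simp_all add: ev_0 ev_pCons monom_0 monom_Suc funpow_swap1)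
  have ev_sum: "ev (\<Sum>i\<in>A. f i) x = (\<Sum>i\<in>A. ev (f i) x)" for f :: "nat \<Rightarrow> _" and A x
    by (induction A rule: infinite_finite_induct) (auto simp: ev_0 ev_padd)
  have ev_linear: "ev ([:- z, 1:] * q) x = ev q (F x + scale (- z) x)" for z q x
  proof -
    have "[:- z, 1:] * q = smult (- z) q + pCons 0 q" by simp
    then show ?thesis by (simp only: ev_padd ev_smult ev_pCons ev_add ev_scale scale_zero_left) (simp add: add.commute)
  qed
  have step: "\<exists>x c. x \<in> X \<and> x \<noteq> 0 \<and> F x = scale c x"
    if "p \<noteq> 0" "ev p v = 0" "v \<in> X" "v \<noteq> 0" for p v
    using that
  proof (induction "degree p" arbitrary: p v rule: less_induct)
    case less
    show ?case
    proof (cases "degree p = 0")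
      case True
      then obtain a where "p = [:a:]" by (rule degree_eq_zeroE)
      then show ?thesis using less by (simp add: ev_pCons ev_0)
    next
      case False
      then obtain z where "poly p z = 0" using alg[of p] by auto
      then obtain q where q: "p = [:- z, 1:] * q" by (auto simp: poly_eq_0_iff_dvd elim: dvdE)
      then have "q \<noteq> 0" using less.prems(1) by auto
      then have dq: "degree q < degree p" unfolding q by (subst degree_mult_eq) auto
      define w where "w = F v + scale (- z) v"
      have "w \<in> X" unfolding w_def
        using X(1,2) less.prems by (intro subspace_add subspace_scale) auto
      have "ev q w = 0" using less.prems(2) unfolding w_def q ev_linear .
      show ?thesis
      proof (cases "w = 0")
        case True
        then have "F v = scale z v" by (simp add: w_def eq_neg_iff_add_eq_0)
        then show ?thesis using less.prems by blast
      next
        case False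
        then show ?thesis using less.hyps[OF dq \<open>q \<noteq> 0\<close> \<open>ev q w = 0\<close> \<open>w \<in> X\<close>] by blast
      qed
    qed
  qed
  have Fn: "(F ^^ n) v \<in> X" for n by (induction n) (use v X in auto)
  \<comment> \<open>\<open>{..card S}\<close> has one element more than \<open>S\<close>, so the
    iterates repeat or are dependent.\<close>
  let ?f = "\<lambda>n. (F ^^ n) v" and ?N = "{..card S}"
  have "\<exists>p. p \<noteq> 0 \<and> ev p v = 0"
  proof (cases "inj_on ?f ?N")
    case False
    then obtain i j where ij: "i \<noteq> j" "?f i = ?f j" by (auto simp: inj_on_def)
    have "coeff (monom 1 i + monom (- 1) j :: 'a poly) i = 1" using ij by simp
    then have "monom 1 i + monom (- 1) j \<noteq> (0 :: 'a poly)" by (metis coeff_0 zero_neq_one)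
    moreover have "ev (monom 1 i + monom (- 1) j) v = 0" using ij by (simp add: ev_padd ev_monom)
    ultimately show ?thesis by blast
  next
    case True
    have "\<not> independent (?f ` ?N)"
    proof
      assume "independent (?f ` ?N)"
      moreover have "?f ` ?N \<subseteq> span S" using Fn X(3) by auto
      ultimately have "card (?f ` ?N) \<le> card S" using independent_span_bound X(4) by blast
      then show False using card_image[OF True] by simp
    qed
    then obtain u where u: "\<exists>x\<in>?f ` ?N. u x \<noteq> 0" "(\<Sum>x\<in>?f ` ?N. scale (u x) x) = 0"
      by (auto simp: dependent_finite)
    define p where "p = (\<Sum>i\<in>?N. monom (u (?f i)) i)"
    have "ev p v = (\<Sum>i\<in>?N. scale (u (?f i)) (?f i))"
      by (simp add: p_def ev_sum ev_monom)
    also have "\<dots> = 0" using u(2) sum.reindex[OF True, of "\<lambda>x. scale (u x) x"] by simp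
    finally have "ev p v = 0" .
    obtain i where i: "i \<in> ?N" "u (?f i) \<noteq> 0" using u(1) by blast
    have "coeff p i = (\<Sum>j\<in>?N. if j = i then u (?f j) else 0)"
      unfolding p_def coeff_sum by (intro sum.cong) auto
    then have "coeff p i \<noteq> 0" using i by simp
    then have "p \<noteq> 0" by auto
    then show ?thesis using \<open>ev p v = 0\<close> by blast
  qed
  then show ?thesis using step v by blast
qed

section \<open>The imaginary octonions as an irreducible module\<close>

definition g2c_act :: "g2c_operator \<Rightarrow> coctonion \<Rightarrow> coctonion" where
  "g2c_act p x = (blinfun_apply (fst p) (fst x) - blinfun_apply (snd p) (snd x),
     blinfun_apply (fst p) (snd x) + blinfun_apply (snd p) (fst x))"

lemma g2c_act_linear:
  "g2c_act p (x + y) = g2c_act p x + g2c_act p y" "g2c_act p (cscale a x) = cscale a (g2c_act p x)"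
  "g2c_act (p + q) x = g2c_act p x + g2c_act q x" "g2c_act (cscale a p) x = cscale a (g2c_act p x)"
  "g2c_act 0 x = 0"
  by (simp_all add: g2c_act_def cscale_def blinfun.bilinear_simps algebra_simps zero_prod_def)

lemma g2c_act_bracket: "g2c_act (cbr p q) x = g2c_act p (g2c_act q x) - g2c_act q (g2c_act p x)"
  by (simp add: g2c_act_def cbracket_def commutator_apply blinfun.bilinear_simps algebra_simps)

lemma g2c_act_derivation:
  assumes "p \<in> g2c" shows "C8.derivation (g2c_act p)"
proof -
  have "R8.derivation (blinfun_apply (fst p))" "R8.derivation (blinfun_apply (snd p))"
    using assms by (auto simp: complexify_def g2_iff_derivation)
  note l = R8.derivation_linear(6)[OF this(1)] R8.derivation_linear(6)[OF this(2)]
  have "g2c_act p (coct_mult x y) = coct_mult (g2c_act p x) y + coct_mult x (g2c_act p y)" for x y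
    by (simp add: g2c_act_def cbracket_def blinfun.bilinear_simps l R8.mul_diff R8.mul_add_left R8.mul_add_right)
  then show ?thesis unfolding C8.derivation_def using g2c_act_linear by blast
qed

lemma g2c_act_eqI: assumes "\<And>x. g2c_act p x = g2c_act q x" shows "p = q"
proof -
  have "g2c_act p (x, 0) = g2c_act q (x, 0)" for x using assms .
  then show ?thesis
    by (auto intro!: prod_eqI blinfun_eqI simp: g2c_act_def blinfun.bilinear_simps simp del: split_paired_All)
qed

text \<open>A complex derivation is determined on the real octonions, and the real and imaginary
  parts \<open>f\<close>, \<open>g\<close> of that restriction are themselves real
  derivations.\<close>

lemma g2c_act_surj:
  assumes F: "C8.derivation F"
  obtains p where "p \<in> g2c" "\<And>x. g2c_act p x = F x"
proof -
  note lin = C8.derivation_linear[OF F]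
  define f g where "f x = fst (F (x, 0))" and "g x = snd (F (x, 0))" for x
  have F0: "F (x, 0) = (f x, g x)" for x by (simp add: f_def g_def)
  have add: "F (x + y, 0) = F (x, 0) + F (y, 0)" for x y using lin(1)[of "(x, 0)" "(y, 0)"] by simp
  have scale: "F (r *\<^sub>R x, 0) = cscale (complex_of_real r) (F (x, 0))" for r x
    using lin(2)[of "complex_of_real r" "(x, 0)"] by (simp add: cscale_def)
  have mult: "F (x \<otimes>\<^sub>O y, 0) = coct_mult (F (x, 0)) (y, 0) + coct_mult (x, 0) (F (y, 0))" for x y
    using lin(6)[of "(x, 0)" "(y, 0)"] by (simp add: cbracket_def R8.mul_0)
  have fg: "R8.derivation f" "R8.derivation g"
    unfolding R8.derivation_def f_def g_def add scale mult
    by (simp_all add: cscale_def cbracket_def R8.mul_0 del: split_paired_All)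
  have bl: "bounded_linear f" "bounded_linear g"
    using fg unfolding R8.derivation_def linear_conv_bounded_linear[symmetric]
    by (auto intro!: linearI simp del: split_paired_All)
  define p where "p = (Blinfun f, Blinfun g)"
  have p: "blinfun_apply (fst p) = f" "blinfun_apply (snd p) = g"
    by (simp_all add: p_def bounded_linear_Blinfun_apply bl)
  have "p \<in> g2c" using fg by (simp add: complexify_def p_def g2_iff_derivation bounded_linear_Blinfun_apply bl)
  moreover have "g2c_act p x = F x" for x
  proof -
    have "x = (fst x, 0) + cscale \<i> (snd x, 0)" by (simp add: cscale_def prod_eq_iff)
    then have "F x = F (fst x, 0) + cscale \<i> (F (snd x, 0))" by (metis lin(1,2))
    then show ?thesis by (simp add: g2c_act_def p F0 cscale_def)
  qed
  ultimately show thesis using that by blast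
qed

text \<open>The left side is \<open>(1 + A\<^sup>2) (1 + B\<^sup>2) x\<close> for torus elements
  \<open>A\<close>, \<open>B\<close> with weights (0, 1, -1) and (1, 0, -1) on the three complex
  coordinates. On each of these at least one factor vanishes, so only the \<open>oct_i\<close>
  direction survives.\<close>

lemma imag_projection:
  assumes "x \<bullet> oct_one = 0"
  shows "x + oct_der ((!) [0, 1, 0, 0, 0, 0, 0, 0, 0, 0, 0]) (oct_der ((!) [0, 1, 0, 0, 0, 0, 0, 0, 0, 0, 0]) x)
    + oct_der ((!) [1, 0, 0, 0, 0, 0, 0, 0, 0, 0, 0]) (oct_der ((!) [1, 0, 0, 0, 0, 0, 0, 0, 0, 0, 0]) x)
    + oct_der ((!) [0, 1, 0, 0, 0, 0, 0, 0, 0, 0, 0]) (oct_der ((!) [0, 1, 0, 0, 0, 0, 0, 0, 0, 0, 0])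
     (oct_der ((!) [1, 0, 0, 0, 0, 0, 0, 0, 0, 0, 0]) (oct_der ((!) [1, 0, 0, 0, 0, 0, 0, 0, 0, 0, 0]) x)))
    = (x \<bullet> oct_i) *\<^sub>R oct_i"
proof -
  obtain x0 x1 x2 x3 where x: "x = ((x0, x1), (x2, x3))" by (metis surj_pair)
  show ?thesis using assms unfolding x oct_i_def oct_one_def inner_octonion
    by (simp add: oct_der_def Let_def complex_eq_iff)
qed

lemma oct_der_transitive:
  assumes "y \<bullet> oct_one = 0" "y \<bullet> oct_i = 0"
  obtains c where "oct_der c oct_i = y"
proof -
  obtain y0 y1 y2 y3 where y: "y = ((y0, y1), (y2, y3))" by (metis surj_pair)
  have "oct_der ((!) [0, 0, 0, 0, 0, 0, 0, 0, y1 / 2, y2 / 2, cnj y3 / 2]) oct_i = y"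
    using assms unfolding y oct_i_def oct_one_def inner_octonion
    by (simp add: oct_der_def Let_def complex_eq_iff)
  then show thesis using that by blast
qed

text \<open>If \<open>x\<close> has a nonzero component along a basis element \<open>b\<close>, a
  derivation taking \<open>oct_i\<close> to \<open>b\<close> gives, by skewness, a vector of
  \<open>U\<close> with nonzero \<open>oct_i\<close> component. The projection then puts
  \<open>oct_i\<close> into \<open>U\<close>, and derivations carry it to all other imaginary basis
  elements.\<close>

lemma imag_irreducible:
  assumes U: "C8.subspace U" "\<And>p x. p \<in> g2c \<Longrightarrow> x \<in> U \<Longrightarrow> g2c_act p x \<in> U"
    and x: "x \<in> U" "x \<noteq> 0" "\<And>y. y \<in> U \<Longrightarrow> coct_inner y (oct_one, 0) = 0"
    and y: "coct_inner y (oct_one, 0) = 0"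
  shows "y \<in> U"
proof -
  have act: "(oct_der c (fst z), oct_der c (snd z)) \<in> U" if "z \<in> U" for c z
  proof -
    have "0 \<in> g2" by (simp add: g2_def R8.mul_0)
    then have "(blinfun_der c, 0) \<in> g2c" by (simp add: complexify_def blinfun_der_in_g2)
    from U(2)[OF this \<open>z \<in> U\<close>] show ?thesis by (simp add: g2c_act_def blinfun_der_apply)
  qed
  have proj: "cscale (coct_inner z (oct_i, 0)) (oct_i, 0) \<in> U" if z: "z \<in> U" for z
  proof -
    have z0: "fst z \<bullet> oct_one = 0" "snd z \<bullet> oct_one = 0"
      using x(3)[OF z] by (auto simp: coct_inner_def complex_eq_iff)
    let ?A = "oct_der ((!) [0, 1, 0, 0, 0, 0, 0, 0, 0, 0, 0])"
    let ?B = "oct_der ((!) [1, 0, 0, 0, 0, 0, 0, 0, 0, 0, 0])"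
    have a: "(?A (?A (fst w)), ?A (?A (snd w))) \<in> U" "(?B (?B (fst w)), ?B (?B (snd w))) \<in> U" if "w \<in> U" for w
      using act[OF act[OF that]] by simp_all
    have "z + (?A (?A (fst z)), ?A (?A (snd z))) + (?B (?B (fst z)), ?B (?B (snd z)))
      + (?A (?A (?B (?B (fst z)))), ?A (?A (?B (?B (snd z))))) \<in> U"
      using z a[OF z] a(1)[OF a(2)[OF z]] by (intro C8.subspace_add U(1)) simp_all
    also have "z + (?A (?A (fst z)), ?A (?A (snd z))) + (?B (?B (fst z)), ?B (?B (snd z)))
      + (?A (?A (?B (?B (fst z)))), ?A (?A (?B (?B (snd z))))) =
      (fst z + ?A (?A (fst z)) + ?B (?B (fst z)) + ?A (?A (?B (?B (fst z)))),
       snd z + ?A (?A (snd z)) + ?B (?B (snd z)) + ?A (?A (?B (?B (snd z)))))"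
      by (simp add: prod_eq_iff)
    also have "\<dots> = cscale (coct_inner z (oct_i, 0)) (oct_i, 0)"
      unfolding imag_projection[OF z0(1)] imag_projection[OF z0(2)] by (simp add: cscale_def coct_inner_def)
    finally show ?thesis .
  qed
  have iU: "(oct_i, 0) \<in> U" if "z \<in> U" "coct_inner z (oct_i, 0) \<noteq> 0" for z
  proof -
    have "cscale (inverse (coct_inner z (oct_i, 0))) (cscale (coct_inner z (oct_i, 0)) (oct_i, 0)) \<in> U"
      by (rule C8.subspace_scale[OF U(1) proj[OF that(1)]])
    then show ?thesis using that(2) by simp
  qed
  let ?b = "R8.triple_basis oct_i oct_j oct_l"
  have b: "?b k \<bullet> oct_one = 0" "?b k \<bullet> oct_i = 0" if "1 < k" "k < 8" for k
    using R8.basic_triple_mul(2)[OF R8.standard_triple, of k 0]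
      R8.basic_triple_mul(2)[OF R8.standard_triple, of k 1] that by (auto simp: R8.triple_basis_simps)
  have t: "C8.triple_basis (oct_i, 0) (oct_j, 0) (oct_l, 0) k = (?b k, 0)" if "k < 8" for k
    using that unfolding less_8_cases
    by (elim disjE) (simp_all add: C8.triple_basis_simps R8.triple_basis_simps cbracket_def R8.mul_0)
  have expand: "z = (\<Sum>k<8. cscale (coct_inner z (?b k, 0)) (?b k, 0))" for z
  proof -
    have "z = (\<Sum>k<8. cscale (coct_inner z (C8.triple_basis (oct_i, 0) (oct_j, 0) (oct_l, 0) k))
       (C8.triple_basis (oct_i, 0) (oct_j, 0) (oct_l, 0) k))"
      by (rule C8.triple_expand[OF C8.standard_triple])
    also have "\<dots> = (\<Sum>k<8. cscale (coct_inner z (?b k, 0)) (?b k, 0))"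
      by (intro sum.cong) (simp_all add: t)
    finally show ?thesis .
  qed
  have i: "(oct_i, 0) \<in> U"
  proof -
    obtain k where k: "k < 8" "coct_inner x (?b k, 0) \<noteq> 0"
    proof (rule ccontr)
      assume "\<not> thesis"
      then have "\<forall>k<8. coct_inner x (?b k, 0) = 0" using that by blast
      then have "x = 0" using expand[of x] by simp
      then show False using x by simp
    qed
    have "k \<noteq> 0"
    proof
      assume "k = 0"
      then show False using k x(3)[OF x(1)] by (simp add: R8.triple_basis_simps)
    qed
    show ?thesis
    proof (cases "k = 1")
      case True
      then show ?thesis using iU[OF x(1)] k by (simp add: R8.triple_basis_simps)
    next
      case False
      then have "1 < k" using \<open>k \<noteq> 0\<close> by simp
      obtain c where c: "oct_der c oct_i = ?b k" by (rule oct_der_transitive[OF b[OF \<open>1 < k\<close> k(1)]])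
      have "R8.derivation (oct_der c)" by (rule oct_der_derivation)
      note sk = R8.derivation_skew[OF this]
      have "coct_inner (oct_der c (fst x), oct_der c (snd x)) (oct_i, 0) = - coct_inner x (?b k, 0)"
        by (simp add: coct_inner_def sk c complex_eq_iff)
      then show ?thesis using iU[OF act[OF x(1)], of c] k by simp
    qed
  qed
  have bU: "(?b k, 0) \<in> U" if "0 < k" "k < 8" for k
  proof (cases "k = 1")
    case True
    then show ?thesis using i by (simp add: R8.triple_basis_simps)
  next
    case False
    then have "1 < k" using that by simp
    obtain c where c: "oct_der c oct_i = ?b k" by (rule oct_der_transitive[OF b[OF \<open>1 < k\<close> \<open>k < 8\<close>]])
    have "oct_der c 0 = 0" using R8.derivation_linear(3)[OF oct_der_derivation] .
    then show ?thesis using act[OF i, of c] c by simp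
  qed
  have "cscale (coct_inner y (?b k, 0)) (?b k, 0) \<in> U" if "k < 8" for k
  proof (cases "k = 0")
    case True
    then show ?thesis using y C8.subspace_0[OF U(1)] by (simp add: R8.triple_basis_simps)
  next
    case False
    then show ?thesis using bU that C8.subspace_scale[OF U(1)] by simp
  qed
  then have "(\<Sum>k<8. cscale (coct_inner y (?b k, 0)) (?b k, 0)) \<in> U"
    by (intro C8.subspace_sum U(1)) simp
  then show ?thesis using expand[of y] by simp
qed

text \<open>The span of the imaginary eigenvectors of \<open>D\<close> is nonzero because the
  complex numbers are algebraically closed, and it is stable under the eigenvectors of
  \<open>ad D\<close>, which span the algebra. Irreducibility makes it everything, so
  \<open>D\<close> is diagonalizable on imaginary octonions.\<close>

lemma semisimple_diag_triple:
  assumes D: "g2.complexified.semisimple_element D"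
  shows "\<exists>a b u v w. C8.diag_triple (g2c_act D) a b u v w"
proof -
  let ?F = "g2c_act D" and ?I = "{x. coct_inner x (oct_one, 0) = 0}"
  have Dg: "D \<in> g2c" and span: "g2c \<subseteq> g2.complexified.span {z \<in> g2c. \<exists>c. cbr D z = cscale c z}"
    using D by (auto simp: g2.complexified.semisimple_element_def)
  note der = g2c_act_derivation
  let ?E = "{x \<in> ?I. \<exists>c. ?F x = cscale c x}"
  have sI: "C8.subspace ?I" by (auto simp: C8.subspace_def C8.B_0 C8.B_add_left C8.B_scale_left)
  let ?S = "C8.triple_basis (oct_i, 0) (oct_j, 0) (oct_l, 0) ` {..<8}"
  have "\<exists>x c. x \<in> ?I \<and> x \<noteq> 0 \<and> ?F x = cscale c x"
  proof (rule C8.invariant_subspace_eigenvector[where S = ?S and v = "(oct_i, 0)"])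
    show "\<And>p :: complex poly. 0 < degree p \<Longrightarrow> \<exists>z. poly p z = 0"
      using fundamental_theorem_of_algebra constant_degree by force
    show "?F x \<in> ?I" if "x \<in> ?I" for x using C8.derivation_imag[OF der[OF Dg]] by simp
    show "(oct_i, 0) \<in> ?I"
      using C8.standard_triple by (simp add: C8.basic_triple_def C8.orth_def C8.imag_unit_def)
    show "(oct_i, 0) \<noteq> (0 :: coctonion)" by (simp add: oct_i_def zero_prod_def)
  qed (use sI C8.standard_span in \<open>auto simp: g2c_act_linear\<close>)
  then obtain x where x: "x \<in> ?E" "x \<noteq> 0" by blast
  let ?U = "C8.span ?E"
  have UI: "?U \<subseteq> ?I" by (rule C8.span_minimal[OF _ sI]) blast
  have sU: "C8.subspace ?U" by (rule C8.subspace_span)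
  have inv: "g2c_act p y \<in> ?U" if "p \<in> g2c" "y \<in> ?U" for p y
  proof -
    have e: "g2c_act p y \<in> ?U" if p: "p \<in> g2c" "cbr D p = cscale c p" and y: "y \<in> ?E" for p c y
    proof -
      obtain d where d: "?F y = cscale d y" using y by blast
      \<comment> \<open>An eigenvector of \<open>ad D\<close> with value \<open>c\<close> moves the
        eigenvalue \<open>d\<close> of \<open>y\<close> to \<open>c + d\<close>.\<close>
      have "?F (g2c_act p y) = g2c_act (cbr D p) y + g2c_act p (?F y)" by (simp add: g2c_act_bracket)
      also have "\<dots> = cscale (c + d) (g2c_act p y)"
        unfolding p d by (simp add: g2c_act_linear C8.scale_left_distrib)
      finally show ?thesis
        using C8.derivation_imag[OF der[OF p(1)]] by (intro C8.span_base) auto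
    qed
    have e2: "g2c_act p y \<in> ?U" if p: "p \<in> g2c" "cbr D p = cscale c p" and y: "y \<in> ?U" for p c y
    proof -
      have sp: "C8.subspace {y. g2c_act p y \<in> ?U}"
        unfolding C8.subspace_def using C8.subspace_add[OF sU] C8.subspace_scale[OF sU] C8.subspace_0[OF sU]
        by (simp add: g2c_act_linear C8.derivation_linear(3)[OF der[OF p(1)]] del: split_paired_All)
      have "?E \<subseteq> {y. g2c_act p y \<in> ?U}"
      proof (rule subsetI, rule CollectI)
        fix z assume "z \<in> ?E"
        then show "g2c_act p z \<in> ?U" by (rule e[OF p])
      qed
      from subsetD[OF C8.span_minimal[OF this sp] y] show ?thesis by (rule CollectD)
    qed
    have sp: "g2.complexified.subspace {p. g2c_act p y \<in> ?U}"
      unfolding g2.complexified.subspace_def using C8.subspace_add[OF sU] C8.subspace_scale[OF sU] C8.subspace_0[OF sU]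
      by (simp add: g2c_act_linear del: split_paired_All)
    have "{z \<in> g2c. \<exists>c. cbr D z = cscale c z} \<subseteq> {p. g2c_act p y \<in> ?U}"
    proof (rule subsetI, rule CollectI)
      fix z assume "z \<in> {z \<in> g2c. \<exists>c. cbr D z = cscale c z}"
      then obtain c where "z \<in> g2c" "cbr D z = cscale c z" by (elim CollectE conjE exE)
      then show "g2c_act z y \<in> ?U" by (rule e2) (rule \<open>y \<in> ?U\<close>)
    qed
    from g2.complexified.span_minimal[OF this sp] have "g2c \<subseteq> {p. g2c_act p y \<in> ?U}"
      using span by (rule order_trans[rotated])
    from subsetD[OF this \<open>p \<in> g2c\<close>] show ?thesis by (rule CollectD)
  qed
  have "?I \<subseteq> ?U"
  proof
    fix y assume "y \<in> ?I"
    then have y: "coct_inner y (oct_one, 0) = 0" by (rule CollectD)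
    show "y \<in> ?U"
    proof (rule imag_irreducible[OF sU inv C8.span_base[OF x(1)] x(2) _ y])
      fix z assume "z \<in> ?U"
      from subsetD[OF UI this] show "coct_inner z (oct_one, 0) = 0" by (rule CollectD)
    qed
  qed
  then have diag: "?I \<subseteq> C8.span {x. coct_inner x (oct_one, 0) = 0 \<and> (\<exists>c. ?F x = cscale c x)}"
    by (simp only: mem_Collect_eq)
  have sqrt: "\<exists>s. s * s = c" for c :: complex
    by (rule exI[of _ "csqrt c"]) (simp flip: power2_eq_square)
  show ?thesis
    by (rule C8.diag_triple_exists_of_diagonalizable[OF _ sqrt der[OF Dg] diag, of \<i>]) simp
qed

section \<open>The rank\<close>

definition g2c_torus :: "complex \<Rightarrow> complex \<Rightarrow> g2c_operator" where
  "g2c_torus a b = g2c_elem ((!) [a, b, 0, 0, 0, 0, 0, 0, 0, 0, 0, 0, 0, 0])"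

text \<open>The weights \<open>root_value a b k\<close> of the coordinates under \<open>-\<i> ad (g2c_torus a b)\<close>.\<close>

definition root_value :: "'a::comm_ring_1 \<Rightarrow> 'a \<Rightarrow> nat \<Rightarrow> 'a" where
  "root_value a b k = [0, 0, a - b, 2 * a + b, a + 2 * b, b - a, - 2 * a - b, - a - 2 * b,
     a, b, - a - b, - a, - b, a + b] ! k"

lemma g2c_torus_in: "g2c_torus a b \<in> g2c"
  by (simp add: g2c_torus_def g2c_elem_in)

lemma g2c_torus_coord: "k < 14 \<Longrightarrow> g2c_coord (g2c_torus a b) k = [a, b, 0, 0, 0, 0, 0, 0, 0, 0, 0, 0, 0, 0] ! k"
  by (simp add: g2c_torus_def g2c_coord_elem)

lemma g2c_torus_bracket_coord:
  assumes "p \<in> g2c" "k < 14"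
  shows "g2c_coord (cbr (g2c_torus a b) p) k = \<i> * root_value a b k * g2c_coord p k"
proof -
  have "\<forall>k<14. g2_bracket (g2c_coord (g2c_torus a b)) (g2c_coord p) k = \<i> * root_value a b k * g2c_coord p k"
    unfolding all_less_14 by (simp add: g2_bracket_def g2c_torus_coord root_value_def algebra_simps)
  then show ?thesis using assms by (simp add: g2c_coord_bracket g2c_torus_in)
qed

definition g2c_hom :: "(g2c_operator \<Rightarrow> g2c_operator) \<Rightarrow> bool" where
  "g2c_hom f \<longleftrightarrow> (\<forall>p\<in>g2c. f p \<in> g2c) \<and> (\<forall>p\<in>g2c. \<forall>q\<in>g2c. f (p + q) = f p + f q) \<and>
     (\<forall>p\<in>g2c. \<forall>c. f (cscale c p) = cscale c (f p)) \<and> (\<forall>p\<in>g2c. \<forall>q\<in>g2c. f (cbr p q) = cbr (f p) (f q))"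

text \<open>Conjugation by the octonion automorphism that takes the reference triple to
  \<open>u, v, w\<close>; on the reference triple the diagonal form of \<open>D\<close> is exactly
  that of a torus element.\<close>

lemma g2c_conjugate_torus:
  assumes D: "D \<in> g2c" and t: "C8.diag_triple (g2c_act D) a b u v w"
  obtains \<Psi> \<Phi> where "g2c_hom \<Psi>" "g2c_hom \<Phi>"
    "\<And>p. p \<in> g2c \<Longrightarrow> \<Phi> (\<Psi> p) = p" "\<And>p. p \<in> g2c \<Longrightarrow> \<Psi> (\<Phi> p) = p" "\<Psi> D = g2c_torus a b"
proof -
  have bt: "C8.basic_triple u v w" using t by (simp add: C8.diag_triple_def)
  define m where "m = C8.triple_map u v w"
  define n where "n = C8.triple_map_inv u v w"
  note defs = m_def n_def
  have mn: "n (m x) = x" "m (n x) = x" for x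
    unfolding defs by (simp_all only: C8.triple_map_inverse[OF bt])
  have lin: "m (x + y) = m x + m y" "n (x + y) = n x + n y" "m (cscale c x) = cscale c (m x)"
    "n (cscale c x) = cscale c (n x)" for x y c
    unfolding defs by (simp_all only: C8.triple_map_linear)
  have mul: "m (coct_mult x y) = coct_mult (m x) (m y)" "n (coct_mult x y) = coct_mult (n x) (n y)" for x y
    unfolding defs by (simp_all only: C8.triple_map_mul[OF bt] C8.triple_map_inv_mul[OF bt])
  have diff: "m (x - y) = m x - m y" "n (x - y) = n x - n y" for x y
    using lin(1)[of "x - y" y] lin(2)[of "x - y" y] by (simp_all only: diff_add_cancel eq_diff_eq)
  note act_der = g2c_act_derivation[unfolded C8.derivation_def]
  have "\<exists>q. q \<in> g2c \<and> (\<forall>x. g2c_act q x = n (g2c_act p (m x)))" if "p \<in> g2c" for p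
  proof -
    have "C8.derivation (\<lambda>x. n (g2c_act p (m x)))"
      unfolding C8.derivation_def using act_der[OF that]
      by (simp only: lin mul mn simp_thms)
    then show ?thesis using g2c_act_surj by blast
  qed
  then obtain \<Psi> where \<Psi>: "\<And>p. p \<in> g2c \<Longrightarrow> \<Psi> p \<in> g2c" "\<And>p x. p \<in> g2c \<Longrightarrow> g2c_act (\<Psi> p) x = n (g2c_act p (m x))"
    by metis
  have "\<exists>q. q \<in> g2c \<and> (\<forall>x. g2c_act q x = m (g2c_act p (n x)))" if "p \<in> g2c" for p
  proof -
    have "C8.derivation (\<lambda>x. m (g2c_act p (n x)))"
      unfolding C8.derivation_def using act_der[OF that]
      by (simp only: lin mul mn simp_thms)
    then show ?thesis using g2c_act_surj by blast
  qed
  then obtain \<Phi> where \<Phi>: "\<And>p. p \<in> g2c \<Longrightarrow> \<Phi> p \<in> g2c" "\<And>p x. p \<in> g2c \<Longrightarrow> g2c_act (\<Phi> p) x = m (g2c_act p (n x))"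
    by metis
  have closed: "p + q \<in> g2c" "cscale c p \<in> g2c" "cbr p q \<in> g2c" if "p \<in> g2c" "q \<in> g2c" for p q c
    using that g2.complexified.subspace_G g2.complexified.subspace_add g2.complexified.subspace_scale
      g2.complexified.br_closed by blast+
  have 1: "\<Psi> p \<in> g2c \<and> \<Phi> p \<in> g2c \<and> \<Phi> (\<Psi> p) = p \<and> \<Psi> (\<Phi> p) = p" if "p \<in> g2c" for p
    using that by (intro conjI g2c_act_eqI) (simp_all only: \<Psi> \<Phi> mn)
  have 2: "\<Psi> (p + q) = \<Psi> p + \<Psi> q \<and> \<Phi> (p + q) = \<Phi> p + \<Phi> q" if "p \<in> g2c" "q \<in> g2c" for p q
    using that closed(1)[OF that] by (intro conjI g2c_act_eqI) (simp_all only: \<Psi> \<Phi> g2c_act_linear lin)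
  have 3: "\<Psi> (cscale c p) = cscale c (\<Psi> p) \<and> \<Phi> (cscale c p) = cscale c (\<Phi> p)" if "p \<in> g2c" for p c
    using that closed(2)[OF that that] by (intro conjI g2c_act_eqI) (simp_all only: \<Psi> \<Phi> g2c_act_linear lin)
  have 4: "\<Psi> (cbr p q) = cbr (\<Psi> p) (\<Psi> q) \<and> \<Phi> (cbr p q) = cbr (\<Phi> p) (\<Phi> q)" if "p \<in> g2c" "q \<in> g2c" for p q
    using that closed(3)[OF that] by (intro conjI g2c_act_eqI) (simp_all only: \<Psi> \<Phi> g2c_act_bracket diff mn)
  have "\<Psi> D = g2c_torus a b"
  proof (rule g2c_eqI)
    show "\<Psi> D \<in> g2c" "g2c_torus a b \<in> g2c" using \<Psi>(1)[OF D] g2c_torus_in by auto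
    have std: "m (oct_i, 0) = u" "m (oct_j, 0) = v" "m (oct_l, 0) = w"
      unfolding defs by (rule C8.triple_map_standard)+
    have inv: "n u = (oct_i, 0)" "n v = (oct_j, 0)" "n w = (oct_l, 0)"
      unfolding defs by (rule C8.triple_map_inv_triple[OF bt])+
    have n0: "n 0 = 0" using lin(4)[of 0 0] by simp
    have prod: "coct_mult (x, 0) (y, 0) = (x \<otimes>\<^sub>O y, 0)" for x y by (simp add: cbracket_def R8.mul_0)
    have "g2c_act (\<Psi> D) (oct_i, 0) = 0"
      "g2c_act (\<Psi> D) (oct_j, 0) = cscale a (oct_i \<otimes>\<^sub>O oct_j, 0)"
      "g2c_act (\<Psi> D) (oct_l, 0) = cscale b (oct_i \<otimes>\<^sub>O oct_l, 0)"
      using t unfolding C8.diag_triple_def by (simp_all add: \<Psi> D std inv n0 lin mul prod)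
    then have vals: "fst (\<Psi> D) oct_i = 0" "snd (\<Psi> D) oct_i = 0"
      "fst (\<Psi> D) oct_j = Re a *\<^sub>R (oct_i \<otimes>\<^sub>O oct_j)" "snd (\<Psi> D) oct_j = Im a *\<^sub>R (oct_i \<otimes>\<^sub>O oct_j)"
      "fst (\<Psi> D) oct_l = Re b *\<^sub>R (oct_i \<otimes>\<^sub>O oct_l)" "snd (\<Psi> D) oct_l = Im b *\<^sub>R (oct_i \<otimes>\<^sub>O oct_l)"
      by (simp_all add: g2c_act_def cscale_def blinfun.zero_right prod_eq_iff)
    have "\<forall>k<14. g2c_coord (\<Psi> D) k = g2c_coord (g2c_torus a b) k"
      unfolding all_less_14
      by (simp add: g2c_torus_coord) (simp add: g2c_coord_def g2_coord_def vals octonion_basis_products complex_eq_iff)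
    then show "g2c_coord (\<Psi> D) k = g2c_coord (g2c_torus a b) k" if "k < 14" for k using that by blast
  qed
  moreover have "g2c_hom \<Psi>" "g2c_hom \<Phi>"
    unfolding g2c_hom_def by (intro conjI ballI allI; simp only: 1 2 3 4)+
  ultimately show thesis using that[of \<Psi> \<Phi>] 1 by simp
qed

text \<open>The part of the Cartan condition that is transported along bijective homomorphisms;
  semisimplicity enters separately, through the diagonal form of one element.\<close>

definition maximal_abelian :: "g2c_operator set \<Rightarrow> bool" where
  "maximal_abelian H \<longleftrightarrow> g2.complexified.subalgebra H \<and> g2.complexified.abelian H \<and>
     (\<forall>K. g2.complexified.subalgebra K \<and> g2.complexified.abelian K \<and> H \<subseteq> K \<longrightarrow> K = H)"

definition torus :: "g2c_operator set" where
  "torus = {p \<in> g2c. \<forall>k. 2 \<le> k \<and> k < 14 \<longrightarrow> g2c_coord p k = 0}"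

lemma torus_eq: "p \<in> torus \<longleftrightarrow> p = g2c_torus (g2c_coord p 0) (g2c_coord p 1)"
proof
  assume p: "p \<in> torus"
  have "\<forall>k<14. g2c_coord p k = g2c_coord (g2c_torus (g2c_coord p 0) (g2c_coord p 1)) k"
    using p unfolding all_less_14 by (simp add: g2c_torus_coord torus_def)
  then have eq: "g2c_coord p k = g2c_coord (g2c_torus (g2c_coord p 0) (g2c_coord p 1)) k" if "k < 14" for k
    using that by blast
  have "p \<in> g2c" using p by (simp add: torus_def)
  then show "p = g2c_torus (g2c_coord p 0) (g2c_coord p 1)" by (rule g2c_eqI[OF _ g2c_torus_in eq])
next
  have "\<forall>k<14. 2 \<le> k \<longrightarrow> g2c_coord (g2c_torus a b) k = 0" for a b
    unfolding all_less_14 by (simp add: g2c_torus_coord)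
  then have "g2c_torus a b \<in> torus" for a b by (simp add: torus_def g2c_torus_in)
  then show "p \<in> torus" if "p = g2c_torus (g2c_coord p 0) (g2c_coord p 1)" by (subst that)
qed

lemma g2c_torus_in_torus: "g2c_torus a b \<in> torus"
  unfolding torus_eq by (simp add: g2c_torus_coord)

lemma g2c_zero_in: "0 \<in> g2c"
  using g2.complexified.subspace_G by (rule g2.complexified.subspace_0)

lemma g2c_closed: "p \<in> g2c \<Longrightarrow> q \<in> g2c \<Longrightarrow> p + q \<in> g2c" "p \<in> g2c \<Longrightarrow> cscale c p \<in> g2c"
  "p \<in> g2c \<Longrightarrow> q \<in> g2c \<Longrightarrow> cbr p q \<in> g2c"
  using g2.complexified.subspace_G g2.complexified.subspace_add g2.complexified.subspace_scale
    g2.complexified.br_closed by blast+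

lemma torus_subalgebra: "g2.complexified.subalgebra torus" "g2.complexified.abelian torus"
proof -
  have sub: "torus \<subseteq> g2c" by (auto simp: torus_def)
  have br: "cbr p q = 0" if "p \<in> torus" "q \<in> torus" for p q
  proof (rule g2c_eqI)
    have g: "p \<in> g2c" "q \<in> g2c" using that sub by auto
    then show "cbr p q \<in> g2c" by (rule g2.complexified.br_closed)
    show "0 \<in> g2c" using g2.complexified.subspace_G by (rule g2.complexified.subspace_0)
    fix k :: nat assume k: "k < 14"
    have z: "root_value a b k * g2c_coord q k = 0" for a b
    proof -
      consider "k = 0" | "k = 1" | "2 \<le> k" by linarith
      then show ?thesis using that(2) k by cases (simp_all add: torus_def root_value_def)
    qed
    have "g2c_coord (cbr p q) k = \<i> * root_value (g2c_coord p 0) (g2c_coord p 1) k * g2c_coord q k"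
      using g2c_torus_bracket_coord[OF g(2) k, of "g2c_coord p 0" "g2c_coord p 1"] that(1)
      unfolding torus_eq by simp
    then show "g2c_coord (cbr p q) k = g2c_coord 0 k"
      using z k by (simp add: g2c_coord_linear(4) mult.assoc)
  qed
  have sp: "g2.complexified.subspace torus"
    unfolding g2.complexified.subspace_def
    by (simp add: torus_def g2c_coord_linear g2c_zero_in g2c_closed del: split_paired_All)
  show "g2.complexified.subalgebra torus"
    unfolding g2.complexified.subalgebra_def
    using sp sub br g2.complexified.subspace_0[OF sp] by (simp del: split_paired_All)
  show "g2.complexified.abelian torus"
    unfolding g2.complexified.abelian_def using br by (simp del: split_paired_All)
qed

lemma (in vector_space) dim_eq_2I:
  assumes "t \<noteq> 0" "x \<notin> span {t}" "t \<in> H" "x \<in> H" "H \<subseteq> span {t, x}"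
  shows "dim H = 2"
proof (rule dim_unique)
  have "x \<noteq> t" using assms(2) span_base by blast
  then show "card {t, x} = 2" by simp
  show "independent {t, x}"
    using independent_insertI[OF assms(2)] assms(1) by (simp add: insert_commute)
qed (use assms in auto)

text \<open>Vanishing 2 by 2 minors mean that the coordinate map \<open>f\<close> has rank at most
  one on \<open>H\<close>, and its kernel there is the line of \<open>t\<close>.\<close>

lemma (in vector_space) dim_eq_2_of_minors:
  assumes H: "subspace H" and t: "t \<in> H" "t \<noteq> 0"
    and f: "\<And>x y i. f (x - y) i = f x i - f y i" "\<And>a x i. f (scale a x) i = a * f x i"
    and minors: "\<And>p q i j. p \<in> H \<Longrightarrow> q \<in> H \<Longrightarrow> f p i * f q j = f p j * f q i"
    and ker: "\<And>p. p \<in> H \<Longrightarrow> (\<And>i. f p i = 0) \<Longrightarrow> p \<in> span {t}"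
    and ft: "\<And>i. f t i = 0" and x: "x \<in> H" "f x i \<noteq> 0"
  shows "dim H = 2"
proof (rule dim_eq_2I[OF t(2) _ t(1) x(1)])
  show "x \<notin> span {t}"
  proof
    assume "x \<in> span {t}"
    then obtain c where "x = scale c t" by (auto simp: span_singleton)
    then show False using x(2) ft f(2) by simp
  qed
  show "H \<subseteq> span {t, x}"
  proof
    fix q assume q: "q \<in> H"
    define l where "l = f q i / f x i"
    have m: "q - scale l x \<in> H" using H q x(1) by (simp add: subspace_diff subspace_scale)
    have "f (q - scale l x) j = 0" for j
      using minors[OF q x(1), of i j] x(2) by (simp add: f l_def field_simps)
    then have "q - scale l x \<in> span {t}" by (rule ker[OF m])
    then have "q - scale l x \<in> span {t, x}" using span_mono[of "{t}" "{t, x}"] by blast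
    moreover have "scale l x \<in> span {t, x}" by (intro span_scale span_base) simp
    ultimately have "(q - scale l x) + scale l x \<in> span {t, x}" by (rule span_add)
    then show "q \<in> span {t, x}" by simp
  qed
qed

lemma torus_dim: "g2.complexified.dim torus = 2"
proof (rule g2.complexified.dim_eq_2I[of "g2c_torus 1 0" "g2c_torus 0 1"])
  show "g2c_torus 1 0 \<noteq> 0"
  proof
    assume "g2c_torus 1 0 = 0"
    then have "g2c_coord (g2c_torus 1 0) 0 = g2c_coord 0 0" by simp
    then show False by (simp add: g2c_torus_coord g2c_coord_linear)
  qed
  show "g2c_torus 0 1 \<notin> g2.complexified.span {g2c_torus 1 0}"
  proof
    assume "g2c_torus 0 1 \<in> g2.complexified.span {g2c_torus 1 0}"
    then obtain c where "g2c_torus 0 1 = cscale c (g2c_torus 1 0)"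
      by (auto simp: g2.complexified.span_singleton)
    then have "g2c_coord (g2c_torus 0 1) 1 = c * g2c_coord (g2c_torus 1 0) 1" by (simp add: g2c_coord_linear)
    then show False by (simp add: g2c_torus_coord)
  qed
  show "torus \<subseteq> g2.complexified.span {g2c_torus 1 0, g2c_torus 0 1}"
  proof
    fix p assume p: "p \<in> torus"
    have "p = cscale (g2c_coord p 0) (g2c_torus 1 0) + cscale (g2c_coord p 1) (g2c_torus 0 1)"
    proof (rule g2c_eqI)
      show "p \<in> g2c" using p by (simp add: torus_def)
      show "cscale (g2c_coord p 0) (g2c_torus 1 0) + cscale (g2c_coord p 1) (g2c_torus 0 1) \<in> g2c"
        by (intro g2c_closed g2c_torus_in)
      have "\<forall>k<14. g2c_coord p k = g2c_coord (cscale (g2c_coord p 0) (g2c_torus 1 0) + cscale (g2c_coord p 1) (g2c_torus 0 1)) k"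
        unfolding all_less_14 using p by (simp add: g2c_coord_linear g2c_torus_coord torus_def)
      then show "g2c_coord p k = g2c_coord (cscale (g2c_coord p 0) (g2c_torus 1 0) + cscale (g2c_coord p 1) (g2c_torus 0 1)) k"
        if "k < 14" for k using that by blast
    qed
    moreover have "cscale (g2c_coord p 0) (g2c_torus 1 0) + cscale (g2c_coord p 1) (g2c_torus 0 1)
        \<in> g2.complexified.span {g2c_torus 1 0, g2c_torus 0 1}"
      by (intro g2.complexified.span_add g2.complexified.span_scale g2.complexified.span_base) auto
    ultimately show "p \<in> g2.complexified.span {g2c_torus 1 0, g2c_torus 0 1}" by simp
  qed
qed (rule g2c_torus_in_torus)+

text \<open>\<open>H\<close> lies in the centralizer of the torus element. If no root vanishes on
  it, that is the torus. If \<open>b = 0\<close> (short root) or \<open>a = b\<close> (long root),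
  it is a copy of gl(2) whose centre is the line of the torus element, and commuting elements of
  gl(2) are proportional modulo the centre.\<close>

lemma maximal_abelian_dim:
  assumes H: "maximal_abelian H" and t: "g2c_torus a b \<in> H" and ab: "a \<noteq> 0 \<or> b \<noteq> 0"
    and cases: "b = 0 \<or> a = b \<or> (\<forall>k. 2 \<le> k \<and> k < 14 \<longrightarrow> root_value a b k \<noteq> 0)"
  shows "g2.complexified.dim H = 2"
proof -
  let ?t = "g2c_torus a b"
  have Hg: "H \<subseteq> g2c" and Hs: "g2.complexified.subspace H" and Ha: "\<And>p q. p \<in> H \<Longrightarrow> q \<in> H \<Longrightarrow> cbr p q = 0"
    using H by (auto simp: maximal_abelian_def g2.complexified.subalgebra_def g2.complexified.abelian_def)
  have "root_value a b k * g2c_coord p k = 0" if "p \<in> H" "k < 14" for p k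
    using g2c_torus_bracket_coord[of p k a b] Ha[OF t that(1)] that Hg by (auto simp: g2c_coord_linear)
  then have cent: "root_value a b k = 0 \<or> g2c_coord p k = 0" if "p \<in> H" "k < 14" for p k
    using that by (metis mult_eq_0_iff)
  have br: "g2_bracket (g2c_coord p) (g2c_coord q) k = 0" if "p \<in> H" "q \<in> H" "k < 14" for p q k
    using g2c_coord_bracket[of p q k] Ha[OF that(1,2)] that Hg by (auto simp: g2c_coord_linear)
  have in_torus: ?thesis if "H \<subseteq> torus"
  proof -
    have "torus = H" using H that torus_subalgebra unfolding maximal_abelian_def by blast
    then show ?thesis using torus_dim by simp
  qed
  have t0: "?t \<noteq> 0"
  proof
    assume z: "?t = 0"
    have "g2c_coord ?t 0 = 0" "g2c_coord ?t 1 = 0" unfolding z by (simp_all add: g2c_coord_linear)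
    then show False using ab by (simp add: g2c_torus_coord)
  qed
  have span_t: "p \<in> g2.complexified.span {?t}"
    if p: "p \<in> H" "p \<in> torus" "a * g2c_coord p 1 = b * g2c_coord p 0" for p
  proof -
    define c where "c = (if a = 0 then g2c_coord p 1 / b else g2c_coord p 0 / a)"
    have c: "g2c_coord p 0 = c * a" "g2c_coord p 1 = c * b" using p(3) ab by (auto simp: c_def field_simps)
    have "p = cscale c ?t"
    proof (rule g2c_eqI)
      show "p \<in> g2c" "cscale c ?t \<in> g2c" using p(1) Hg g2c_closed g2c_torus_in by auto
      have "\<forall>k<14. g2c_coord p k = g2c_coord (cscale c ?t) k"
        unfolding all_less_14 using p(2) c by (simp add: g2c_coord_linear g2c_torus_coord torus_def)
      then show "g2c_coord p k = g2c_coord (cscale c ?t) k" if "k < 14" for k using that by blast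
    qed
    then show ?thesis by (metis g2.complexified.span_base g2.complexified.span_scale singletonI)
  qed
  from cases consider "b = 0" | "a = b" | "\<forall>k. 2 \<le> k \<and> k < 14 \<longrightarrow> root_value a b k \<noteq> 0" by blast
  then show ?thesis
  proof cases
    case 1
    then have a: "a \<noteq> 0" using ab by simp
    have z: "g2c_coord p 2 = 0" "g2c_coord p 3 = 0" "g2c_coord p 4 = 0" "g2c_coord p 5 = 0"
      "g2c_coord p 6 = 0" "g2c_coord p 7 = 0" "g2c_coord p 8 = 0" "g2c_coord p 10 = 0"
      "g2c_coord p 11 = 0" "g2c_coord p 13 = 0" if "p \<in> H" for p
      using cent[OF that, of 2] cent[OF that, of 3] cent[OF that, of 4] cent[OF that, of 5]
        cent[OF that, of 6] cent[OF that, of 7] cent[OF that, of 8] cent[OF that, of 10]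
        cent[OF that, of 11] cent[OF that, of 13] 1 a by (auto simp: root_value_def)
    \<comment> \<open>Coordinates modulo the centre: for \<open>b = 0\<close> the torus element has
      coordinate 0 alone, and 1, 9, 12 parametrize the quotient sl(2).\<close>
    define f where "f p i = g2c_coord p (if i = 0 then 1 else if i = 1 then 9 else 12)" for p and i :: nat
    have tor: "p \<in> torus" if "p \<in> H" "g2c_coord p 9 = 0" "g2c_coord p 12 = 0" for p
    proof -
      have "\<forall>k<14. 2 \<le> k \<longrightarrow> g2c_coord p k = 0" unfolding all_less_14 using z that by simp
      then show ?thesis using that Hg by (auto simp: torus_def)
    qed
    show ?thesis
    proof (cases "\<exists>x\<in>H. \<exists>i. f x i \<noteq> 0")
      case True
      then obtain x i where x: "x \<in> H" "f x i \<noteq> 0" by blast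
      show ?thesis
      proof (rule g2.complexified.dim_eq_2_of_minors[OF Hs t t0, of f x i])
        fix p q i j assume pq: "p \<in> H" "q \<in> H"
        \<comment> \<open>The coordinates 9, 12 and 0 of the vanishing bracket are exactly the three
          2 by 2 minors, up to a factor.\<close>
        have "\<i> * (g2c_coord p 1 * g2c_coord q 9) = \<i> * (g2c_coord q 1 * g2c_coord p 9)"
          "\<i> * (g2c_coord p 1 * g2c_coord q 12) = \<i> * (g2c_coord q 1 * g2c_coord p 12)"
          "\<i> * (g2c_coord p 9 * g2c_coord q 12) = \<i> * (g2c_coord p 12 * g2c_coord q 9)"
          using br[OF pq, of 9] br[OF pq, of 12] br[OF pq, of 0] z[OF pq(1)] z[OF pq(2)]
          by (simp_all add: g2_bracket_def algebra_simps)
        then have "g2c_coord p 1 * g2c_coord q 9 = g2c_coord q 1 * g2c_coord p 9"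
          "g2c_coord p 1 * g2c_coord q 12 = g2c_coord q 1 * g2c_coord p 12"
          "g2c_coord p 9 * g2c_coord q 12 = g2c_coord p 12 * g2c_coord q 9"
          unfolding mult_cancel_left by simp_all
        then show "f p i * f q j = f p j * f q i"
          unfolding f_def by (simp add: mult.commute)
      next
        fix p assume p: "p \<in> H" "\<And>i. f p i = 0"
        then have "g2c_coord p 1 = 0" "g2c_coord p 9 = 0" "g2c_coord p 12 = 0"
          using p(2)[of 0] p(2)[of 1] p(2)[of 2] by (auto simp: f_def)
        then show "p \<in> g2.complexified.span {?t}" using span_t[OF p(1)] tor[OF p(1)] 1 by simp
      qed (use x 1 in \<open>auto simp: f_def g2c_coord_linear g2c_torus_coord\<close>)
    next
      case False
      then have "f p 1 = 0" "f p 2 = 0" if "p \<in> H" for p using that by auto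
      then have "H \<subseteq> torus" using tor by (auto simp: f_def)
      then show ?thesis by (rule in_torus)
    qed
  next
    case 2
    then have a: "a \<noteq> 0" using ab by simp
    have z: "g2c_coord p 3 = 0" "g2c_coord p 4 = 0" "g2c_coord p 6 = 0" "g2c_coord p 7 = 0"
      "g2c_coord p 8 = 0" "g2c_coord p 9 = 0" "g2c_coord p 10 = 0"
      "g2c_coord p 11 = 0" "g2c_coord p 12 = 0" "g2c_coord p 13 = 0" if "p \<in> H" for p
      using cent[OF that, of 3] cent[OF that, of 4]
        cent[OF that, of 6] cent[OF that, of 7] cent[OF that, of 8] cent[OF that, of 9] cent[OF that, of 10]
        cent[OF that, of 11] cent[OF that, of 12] cent[OF that, of 13] a
      unfolding 2[symmetric] by (auto simp: root_value_def)
    \<comment> \<open>For \<open>a = b\<close> the central element has equal coordinates 0 and 1, so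
      their difference together with 2 and 5 parametrizes the quotient.\<close>
    define f where "f p i = (if i = 0 then g2c_coord p 0 - g2c_coord p 1 else g2c_coord p (if i = 1 then 2 else 5))"
      for p and i :: nat
    have tor: "p \<in> torus" if "p \<in> H" "g2c_coord p 2 = 0" "g2c_coord p 5 = 0" for p
    proof -
      have "\<forall>k<14. 2 \<le> k \<longrightarrow> g2c_coord p k = 0" unfolding all_less_14 using z that by simp
      then show ?thesis using that Hg by (auto simp: torus_def)
    qed
    show ?thesis
    proof (cases "\<exists>x\<in>H. \<exists>i. f x i \<noteq> 0")
      case True
      then obtain x i where x: "x \<in> H" "f x i \<noteq> 0" by blast
      show ?thesis
      proof (rule g2.complexified.dim_eq_2_of_minors[OF Hs t t0, of f x i])
        fix p q i j assume pq: "p \<in> H" "q \<in> H"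
        have "\<i> * ((g2c_coord p 0 - g2c_coord p 1) * g2c_coord q 2) = \<i> * ((g2c_coord q 0 - g2c_coord q 1) * g2c_coord p 2)"
          "\<i> * ((g2c_coord p 0 - g2c_coord p 1) * g2c_coord q 5) = \<i> * ((g2c_coord q 0 - g2c_coord q 1) * g2c_coord p 5)"
          "\<i> * (g2c_coord p 2 * g2c_coord q 5) = \<i> * (g2c_coord p 5 * g2c_coord q 2)"
          using br[OF pq, of 2] br[OF pq, of 5] br[OF pq, of 0] z[OF pq(1)] z[OF pq(2)]
          by (simp_all add: g2_bracket_def algebra_simps)
        then have "(g2c_coord p 0 - g2c_coord p 1) * g2c_coord q 2 = (g2c_coord q 0 - g2c_coord q 1) * g2c_coord p 2"
          "(g2c_coord p 0 - g2c_coord p 1) * g2c_coord q 5 = (g2c_coord q 0 - g2c_coord q 1) * g2c_coord p 5"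
          "g2c_coord p 2 * g2c_coord q 5 = g2c_coord p 5 * g2c_coord q 2"
          unfolding mult_cancel_left by simp_all
        then show "f p i * f q j = f p j * f q i"
          unfolding f_def by (simp add: mult.commute)
      next
        fix p assume p: "p \<in> H" "\<And>i. f p i = 0"
        then have "g2c_coord p 0 = g2c_coord p 1" "g2c_coord p 2 = 0" "g2c_coord p 5 = 0"
          using p(2)[of 0] p(2)[of 1] p(2)[of 2] by (auto simp: f_def)
        then show "p \<in> g2.complexified.span {?t}" using span_t[OF p(1)] tor[OF p(1)] 2 by simp
      qed (use x 2 in \<open>auto simp: f_def g2c_coord_linear g2c_torus_coord algebra_simps\<close>)
    next
      case False
      then have "f p 1 = 0" "f p 2 = 0" if "p \<in> H" for p using that by auto
      then have "H \<subseteq> torus" using tor by (auto simp: f_def)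
      then show ?thesis by (rule in_torus)
    qed
  next
    case 3
    have "p \<in> torus" if p: "p \<in> H" for p
      unfolding torus_def using subsetD[OF Hg p] cent[OF p] 3 by blast
    then have "H \<subseteq> torus" by blast
    then show ?thesis by (rule in_torus)
  qed
qed

lemma g2c_homD:
  assumes "g2c_hom f" "p \<in> g2c"
  shows "f p \<in> g2c" "q \<in> g2c \<Longrightarrow> f (p + q) = f p + f q" "f (cscale c p) = cscale c (f p)"
    "q \<in> g2c \<Longrightarrow> f (cbr p q) = cbr (f p) (f q)"
  using assms unfolding g2c_hom_def by simp_all

lemma g2c_hom_zero: assumes f: "g2c_hom f" shows "f 0 = 0"
proof -
  have "f (cscale 0 0) = cscale 0 (f 0)" by (rule g2c_homD(3)[OF f g2c_zero_in])
  then show ?thesis by simp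
qed

lemma g2c_hom_subalgebra:
  assumes f: "g2c_hom f" and K: "g2.complexified.subalgebra K"
  shows "g2.complexified.subalgebra (f ` K)"
proof -
  have Kg: "K \<subseteq> g2c" and Ks: "g2.complexified.subspace K" and Kb: "\<And>p q. p \<in> K \<Longrightarrow> q \<in> K \<Longrightarrow> cbr p q \<in> K"
    using K unfolding g2.complexified.subalgebra_def by blast+
  have f': "f p \<in> g2c" "f p + f q = f (p + q)" "cscale c (f p) = f (cscale c p)" "cbr (f p) (f q) = f (cbr p q)"
    if "p \<in> K" "q \<in> K" for p q c
    using g2c_homD[OF f subsetD[OF Kg that(1)]] subsetD[OF Kg that(2)] by simp_all
  have "g2.complexified.subspace (f ` K)"
    unfolding g2.complexified.subspace_def
  proof (intro conjI ballI allI)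
    show "0 \<in> f ` K" using g2c_hom_zero[OF f] g2.complexified.subspace_0[OF Ks] by (simp add: rev_image_eqI)
  next
    fix x y assume "x \<in> f ` K" "y \<in> f ` K"
    then obtain p q where "x = f p" "y = f q" "p \<in> K" "q \<in> K" by blast
    then show "x + y \<in> f ` K" using f'(2) g2.complexified.subspace_add[OF Ks] by simp
  next
    fix x c assume "x \<in> f ` K"
    then obtain p where "x = f p" "p \<in> K" by blast
    then show "cscale c x \<in> f ` K" using f'(3) g2.complexified.subspace_scale[OF Ks] by simp
  qed
  moreover have "f ` K \<subseteq> g2c" using f'(1) by blast
  moreover have "cbr x y \<in> f ` K" if "x \<in> f ` K" "y \<in> f ` K" for x y
  proof -
    obtain p q where "x = f p" "y = f q" "p \<in> K" "q \<in> K" using \<open>x \<in> f ` K\<close> \<open>y \<in> f ` K\<close> by blast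
    then show ?thesis using f'(4) Kb by simp
  qed
  ultimately show ?thesis unfolding g2.complexified.subalgebra_def by blast
qed

lemma g2c_hom_abelian:
  assumes f: "g2c_hom f" and K: "g2.complexified.abelian K" "K \<subseteq> g2c"
  shows "g2.complexified.abelian (f ` K)"
  unfolding g2.complexified.abelian_def
proof (intro ballI)
  fix x y assume "x \<in> f ` K" "y \<in> f ` K"
  then obtain p q where pq: "x = f p" "y = f q" "p \<in> K" "q \<in> K" by blast
  then have "cbr x y = f (cbr p q)" using g2c_homD(4)[OF f] subsetD[OF K(2)] by simp
  also have "cbr p q = 0" using pq K(1) by (simp add: g2.complexified.abelian_def)
  finally show "cbr x y = 0" using g2c_hom_zero[OF f] by simp
qed

lemma g2c_hom_span:
  assumes f: "g2c_hom f" and K: "g2.complexified.subspace K" "K \<subseteq> g2c" and A: "A \<subseteq> K"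
  shows "f ` g2.complexified.span A \<subseteq> g2.complexified.span (f ` A)"
proof -
  let ?S = "{p \<in> K. f p \<in> g2.complexified.span (f ` A)}"
  have "g2.complexified.subspace ?S"
    unfolding g2.complexified.subspace_def
  proof (intro conjI ballI allI CollectI)
    show "0 \<in> K" "f 0 \<in> g2.complexified.span (f ` A)"
      using g2c_hom_zero[OF f] g2.complexified.subspace_0[OF K(1)] g2.complexified.span_zero by simp_all
  next
    fix x y assume "x \<in> ?S" "y \<in> ?S"
    then have xy: "x \<in> K" "y \<in> K" "f x \<in> g2.complexified.span (f ` A)" "f y \<in> g2.complexified.span (f ` A)"
      by blast+
    then have "f (x + y) = f x + f y" using g2c_homD(2)[OF f] subsetD[OF K(2)] by simp
    then show "x + y \<in> K" "f (x + y) \<in> g2.complexified.span (f ` A)"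
      using xy g2.complexified.subspace_add[OF K(1)] g2.complexified.span_add by simp_all
  next
    fix x c assume "x \<in> ?S"
    then have x: "x \<in> K" "f x \<in> g2.complexified.span (f ` A)" by blast+
    then have "f (cscale c x) = cscale c (f x)" using g2c_homD(3)[OF f] subsetD[OF K(2)] by simp
    then show "cscale c x \<in> K" "f (cscale c x) \<in> g2.complexified.span (f ` A)"
      using x g2.complexified.subspace_scale[OF K(1)] g2.complexified.span_scale by simp_all
  qed
  moreover have "A \<subseteq> ?S" using A g2.complexified.span_superset by blast
  ultimately have "g2.complexified.span A \<subseteq> ?S" by (intro g2.complexified.span_minimal)
  then show ?thesis by blast
qed

text \<open>Maximality is pulled back through the inverse \<open>g\<close>. The dimensions agree
  because the image of a basis spans the image and has no more elements, in both directions.\<close>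

lemma g2c_hom_maximal_abelian_dim:
  assumes f: "g2c_hom f" and g: "g2c_hom g" and gf: "\<And>p. p \<in> g2c \<Longrightarrow> g (f p) = p" and fg: "\<And>p. p \<in> g2c \<Longrightarrow> f (g p) = p"
    and H: "maximal_abelian H"
  shows "maximal_abelian (f ` H)" and "g2.complexified.dim (f ` H) = 2 \<Longrightarrow> g2.complexified.dim H = 2"
proof -
  have Hs: "g2.complexified.subalgebra H" and Ha: "g2.complexified.abelian H"
    and Hmax: "\<And>K. g2.complexified.subalgebra K \<Longrightarrow> g2.complexified.abelian K \<Longrightarrow> H \<subseteq> K \<Longrightarrow> K = H"
    using H unfolding maximal_abelian_def by blast+
  have Hg: "H \<subseteq> g2c" and Hsub: "g2.complexified.subspace H" using Hs unfolding g2.complexified.subalgebra_def by blast+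
  have id: "h ` A = A" if "\<And>p. p \<in> A \<Longrightarrow> h p = p" for h :: "'c \<Rightarrow> 'c" and A
    using that by simp
  have gfH: "g ` f ` H = H" unfolding image_image by (rule id) (use gf Hg in blast)
  have fs: "g2.complexified.subalgebra (f ` H)" by (rule g2c_hom_subalgebra[OF f Hs])
  then have fHg: "f ` H \<subseteq> g2c" and fHsub: "g2.complexified.subspace (f ` H)" unfolding g2.complexified.subalgebra_def by blast+
  show "maximal_abelian (f ` H)"
    unfolding maximal_abelian_def
  proof (intro conjI allI impI)
    show "g2.complexified.subalgebra (f ` H)" by (rule fs)
    show "g2.complexified.abelian (f ` H)" by (rule g2c_hom_abelian[OF f Ha Hg])
  next
    fix K assume "g2.complexified.subalgebra K \<and> g2.complexified.abelian K \<and> f ` H \<subseteq> K"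
    then have K: "g2.complexified.subalgebra K" "g2.complexified.abelian K" "f ` H \<subseteq> K" by blast+
    then have Kg: "K \<subseteq> g2c" unfolding g2.complexified.subalgebra_def by blast
    have "H \<subseteq> g ` K" using K(3) gfH by blast
    then have gK: "g ` K = H" using g2c_hom_subalgebra[OF g K(1)] g2c_hom_abelian[OF g K(2) Kg] Hmax by blast
    have "f ` g ` K = K" unfolding image_image by (rule id) (use fg Kg in blast)
    then show "K = f ` H" using gK by simp
  qed
  assume d: "g2.complexified.dim (f ` H) = 2"
  obtain B where B: "B \<subseteq> f ` H" "g2.complexified.independent B" "f ` H \<subseteq> g2.complexified.span B" "card B = 2"
    using g2.complexified.basis_exists[of "f ` H"] unfolding d by blast
  have fB: "finite B" using B(4) card.infinite by fastforce
  have "H \<subseteq> g ` g2.complexified.span B" using gfH B(3) by blast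
  also have "\<dots> \<subseteq> g2.complexified.span (g ` B)" by (rule g2c_hom_span[OF g fHsub fHg B(1)])
  finally have HB: "H \<subseteq> g2.complexified.span (g ` B)" .
  obtain A where A: "A \<subseteq> H" "g2.complexified.independent A" "H \<subseteq> g2.complexified.span A" "card A = g2.complexified.dim H"
    using g2.complexified.basis_exists[of H] by blast
  have fin: "finite A" "card A \<le> card (g ` B)"
    using g2.complexified.independent_span_bound[of "g ` B" A] fB A HB by auto
  have "f ` H \<subseteq> g2.complexified.span (f ` A)"
    using g2c_hom_span[OF f Hsub Hg A(1)] A(3) by blast
  then have "2 \<le> card (f ` A)" using g2.complexified.dim_le_card[of "f ` H" "f ` A"] fin d by simp
  also have "\<dots> \<le> card A" using fin by (intro card_image_le)
  finally show "g2.complexified.dim H = 2"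
    using fin(2) card_image_le[OF fB, of g] A(4) B(4) by linarith
qed

text \<open>The Weyl group is transitive on short roots and on long roots: a vanishing short root
  \<open>a\<close>, \<open>b\<close> or \<open>a + b\<close> can be moved to \<open>b\<close>, a
  vanishing long root \<open>a - b\<close>, \<open>2 * a + b\<close> or \<open>a + 2 * b\<close> to
  \<open>a - b\<close>.\<close>

lemma diag_triple_root_choice:
  assumes "C8.diag_triple D a b u v w" and D: "C8.derivation D"
  shows "\<exists>a b u v w. C8.diag_triple D a b u v w \<and>
    (b = 0 \<or> a = b \<or> (\<forall>k. 2 \<le> k \<and> k < 14 \<longrightarrow> root_value a b k \<noteq> 0))"
proof -
  note t = assms(1)
  note swap = C8.diag_triple_swap[OF t]
  note third = C8.diag_triple_third[OF t D]
  note third' = C8.diag_triple_third[OF swap D]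
  consider "b = 0" | "a = b" | "a = 0" | "a + b = 0" | "2 * a + b = 0" | "a + 2 * b = 0"
    | "a \<noteq> 0" "b \<noteq> 0" "a \<noteq> b" "a + b \<noteq> 0" "2 * a + b \<noteq> 0" "a + 2 * b \<noteq> 0" by blast
  then show ?thesis
  proof cases
    case 3
    then show ?thesis using swap by blast
  next
    case 4
    then have "- (a + b) = 0" by simp
    then show ?thesis using third by metis
  next
    case 5
    then have "a = - (a + b)" by (simp add: eq_neg_iff_add_eq_0)
    then show ?thesis using third by metis
  next
    case 6
    then have "b = - (b + a)" by (simp add: eq_neg_iff_add_eq_0 algebra_simps)
    then show ?thesis using third' by metis
  next
    case 7
    have "a - b \<noteq> 0" "b - a \<noteq> 0" "- a - b \<noteq> 0" "- 2 * a - b \<noteq> 0" "- a - 2 * b \<noteq> 0" "- a \<noteq> 0" "- b \<noteq> 0"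
    proof -
      have "- a - b = - (a + b)" "- 2 * a - b = - (2 * a + b)" "- a - 2 * b = - (a + 2 * b)" by simp_all
      then show "- a - b \<noteq> 0" "- 2 * a - b \<noteq> 0" "- a - 2 * b \<noteq> 0" using 7 by (simp_all only: neg_equal_0_iff_equal not_False_eq_True)
    qed (use 7 in simp_all)
    then have "\<forall>k<14. 2 \<le> k \<longrightarrow> root_value a b k \<noteq> 0"
      unfolding all_less_14 using 7 by (simp add: root_value_def)
    then show ?thesis using t by blast
  qed (use t in blast)+
qed

lemma cartan_dim:
  assumes H: "g2.complexified.cartan_subalgebra H"
  shows "g2.complexified.dim H = 2"
proof -
  have ss: "\<And>x. x \<in> H \<Longrightarrow> g2.complexified.semisimple_element x"
    using H by (simp add: g2.complexified.cartan_subalgebra_def del: split_paired_All)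
  have mH: "maximal_abelian H"
    using H unfolding g2.complexified.cartan_subalgebra_def maximal_abelian_def
    by (elim conjE, intro conjI)
  have zero: "0 \<in> K" if "g2.complexified.subalgebra K" for K
    by (rule g2.complexified.subspace_0) (use that in \<open>simp only: g2.complexified.subalgebra_def\<close>)
  \<comment> \<open>A zero \<open>H\<close> would be enlarged by the torus, against
    maximality.\<close>
  have "H \<noteq> {0}"
  proof
    assume H0: "H = {0}"
    have "{0} \<subseteq> torus" using zero[OF torus_subalgebra(1)] by simp
    then have t0: "torus = {0}"
      using mH torus_subalgebra unfolding maximal_abelian_def H0 by (simp only: simp_thms)
    have "g2.complexified.dim {0} = 0"
      by (rule g2.complexified.dim_unique[of "{}"]) (simp_all add: g2.complexified.span_empty g2.complexified.independent_empty)
    then show False using torus_dim unfolding t0 by simp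
  qed
  moreover have "0 \<in> H" using mH zero by (simp only: maximal_abelian_def)
  ultimately obtain D where D: "D \<in> H" "D \<noteq> 0" by blast
  have Dg: "D \<in> g2c" using ss[OF D(1)] by (simp only: g2.complexified.semisimple_element_def)
  obtain a' b' u' v' w' where t': "C8.diag_triple (g2c_act D) a' b' u' v' w'"
    using semisimple_diag_triple[OF ss[OF D(1)]] by (elim exE)
  obtain a b u v w where t: "C8.diag_triple (g2c_act D) a b u v w"
    and c: "b = 0 \<or> a = b \<or> (\<forall>k. 2 \<le> k \<and> k < 14 \<longrightarrow> root_value a b k \<noteq> 0)"
    using diag_triple_root_choice[OF t' g2c_act_derivation[OF Dg]] by (elim exE conjE)
  obtain \<Psi> \<Phi> where hom: "g2c_hom \<Psi>" "g2c_hom \<Phi>"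
    and gf: "\<And>p. p \<in> g2c \<Longrightarrow> \<Phi> (\<Psi> p) = p" and fg: "\<And>p. p \<in> g2c \<Longrightarrow> \<Psi> (\<Phi> p) = p"
    and PD: "\<Psi> D = g2c_torus a b"
    by (rule g2c_conjugate_torus[OF Dg t]) (rule that; assumption)
  note im = g2c_hom_maximal_abelian_dim[OF hom gf fg mH]
  have "a \<noteq> 0 \<or> b \<noteq> 0"
  proof (rule ccontr)
    assume "\<not> ?thesis"
    then have "\<forall>k<14. g2c_coord (g2c_torus a b) k = g2c_coord 0 k"
      unfolding all_less_14 by (simp add: g2c_coord_linear g2c_torus_coord)
    then have "\<Psi> D = 0" unfolding PD by (intro g2c_eqI g2c_torus_in g2c_zero_in) simp
    then have "D = 0" using gf[OF Dg] g2c_hom_zero[OF hom(2)] by simp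
    then show False using D(2) by simp
  qed
  moreover have "g2c_torus a b \<in> \<Psi> ` H" unfolding PD[symmetric] using D(1) by (rule imageI)
  ultimately have d: "g2.complexified.dim (\<Psi> ` H) = 2" by (intro maximal_abelian_dim[OF im(1) _ _ c])
  show ?thesis by (rule im(2); (assumption | rule d))
qed

text \<open>The basis dual to the coordinates: indices 0 and 1 give torus elements, the others
  eigenvectors for the roots.\<close>

definition root_vector :: "nat \<Rightarrow> g2c_operator" where
  "root_vector k = g2c_elem (\<lambda>j. if j = k then 1 else 0)"

lemma root_vector_in: "root_vector k \<in> g2c"
  by (simp add: root_vector_def g2c_elem_in)

lemma root_vector_coord: "j < 14 \<Longrightarrow> g2c_coord (root_vector k) j = (if j = k then 1 else 0)"
  by (simp add: root_vector_def g2c_coord_elem)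

lemma g2c_coord_sum: "k < 14 \<Longrightarrow> g2c_coord (sum f A) k = (\<Sum>i\<in>A. g2c_coord (f i) k)"
  by (induction A rule: infinite_finite_induct) (simp_all add: g2c_coord_linear)

lemma g2c_expand:
  assumes p: "p \<in> g2c"
  shows "p = (\<Sum>k<14. cscale (g2c_coord p k) (root_vector k))"
proof (rule g2c_eqI[OF p])
  show "(\<Sum>k<14. cscale (g2c_coord p k) (root_vector k)) \<in> g2c"
    using g2.complexified.subspace_G by (intro g2.complexified.subspace_sum g2c_closed root_vector_in)
  fix k :: nat assume k: "k < 14"
  have "(\<Sum>j<14. g2c_coord (cscale (g2c_coord p j) (root_vector j)) k) = (\<Sum>j<14. if k = j then g2c_coord p j else 0)"
    by (intro sum.cong) (use k in \<open>auto simp: g2c_coord_linear root_vector_coord\<close>)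
  then show "g2c_coord p k = g2c_coord (\<Sum>k<14. cscale (g2c_coord p k) (root_vector k)) k"
    using k by (simp add: g2c_coord_sum)
qed

lemma torus_root_vector: "cbr (g2c_torus a b) (root_vector k) = cscale (\<i> * root_value a b k) (root_vector k)"
proof (rule g2c_eqI)
  show "cbr (g2c_torus a b) (root_vector k) \<in> g2c" "cscale (\<i> * root_value a b k) (root_vector k) \<in> g2c"
    by (intro g2c_closed g2c_torus_in root_vector_in)+
  show "g2c_coord (cbr (g2c_torus a b) (root_vector k)) j = g2c_coord (cscale (\<i> * root_value a b k) (root_vector k)) j"
    if "j < 14" for j
    using that by (simp add: g2c_torus_bracket_coord root_vector_in g2c_coord_linear root_vector_coord)
qed

lemma torus_cartan: "g2.complexified.cartan_subalgebra torus"
  unfolding g2.complexified.cartan_subalgebra_def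
proof (intro conjI allI ballI impI)
  show "g2.complexified.subalgebra torus" "g2.complexified.abelian torus" by (rule torus_subalgebra)+
next
  fix K assume "g2.complexified.subalgebra K \<and> g2.complexified.abelian K \<and> torus \<subseteq> K"
  then have K: "K \<subseteq> g2c" "\<And>p q. p \<in> K \<Longrightarrow> q \<in> K \<Longrightarrow> cbr p q = 0" "torus \<subseteq> K"
    unfolding g2.complexified.subalgebra_def g2.complexified.abelian_def by blast+
  \<comment> \<open>The torus element (2, 1) is regular: no root vanishes on it, so whatever
    commutes with it lies in the torus.\<close>
  have nz: "\<forall>k<14. 2 \<le> k \<longrightarrow> root_value 2 1 k \<noteq> (0 :: complex)"
    unfolding all_less_14 by (simp add: root_value_def)
  have "p \<in> torus" if p: "p \<in> K" for p
  proof -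
    have z: "cbr (g2c_torus 2 1) p = 0" using K(2,3) g2c_torus_in_torus p by blast
    have "g2c_coord p k = 0" if "2 \<le> k" "k < 14" for k
      using g2c_torus_bracket_coord[OF subsetD[OF K(1) p] that(2), of 2 1] nz that
      by (simp add: z g2c_coord_linear)
    then show ?thesis unfolding torus_def using K(1) p by blast
  qed
  then show "K = torus" using K(3) by blast
next
  fix x assume x: "x \<in> torus"
  then have xt: "x = g2c_torus (g2c_coord x 0) (g2c_coord x 1)" by (simp only: torus_eq)
  show "g2.complexified.semisimple_element x"
    unfolding g2.complexified.semisimple_element_def
  proof (intro conjI subsetI)
    show "x \<in> g2c" using x by (simp add: torus_def)
    fix p assume "p \<in> g2c"
    have "root_vector k \<in> {z \<in> g2c. \<exists>c. cbr x z = cscale c z}" for k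
      using torus_root_vector[of "g2c_coord x 0" "g2c_coord x 1" k, folded xt] root_vector_in by blast
    then show "p \<in> g2.complexified.span {z \<in> g2c. \<exists>c. cbr x z = cscale c z}"
      by (subst g2c_expand[OF \<open>p \<in> g2c\<close>])
        (intro g2.complexified.span_sum g2.complexified.span_scale g2.complexified.span_base)
  qed
qed

lemma g2c_rank: "g2.complexified.rank = 2"
  unfolding g2.complexified.rank_def
proof (rule the_equality)
  show "\<exists>H. g2.complexified.cartan_subalgebra H \<and> g2.complexified.dim H = 2"
    using torus_cartan torus_dim by blast
  show "\<exists>H. g2.complexified.cartan_subalgebra H \<and> g2.complexified.dim H = r \<Longrightarrow> r = 2" for r
    using cartan_dim by metis
qed

section \<open>Principal subalgebras of the real form\<close>

definition oct_trace :: "(octonion \<Rightarrow> octonion) \<Rightarrow> real" where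
  "oct_trace A = (\<Sum>b\<in>Basis. A b \<bullet> b)"

text \<open>Minus the trace form of the octonion representation; the sign makes it positive
  definite, derivations being skew.\<close>

definition g2_form :: "(octonion \<Rightarrow>\<^sub>L octonion) \<Rightarrow> (octonion \<Rightarrow>\<^sub>L octonion) \<Rightarrow> real" where
  "g2_form D E = - oct_trace (\<lambda>x. D (E x))"

lemma oct_trace_commute: "oct_trace (\<lambda>x. blinfun_apply D (blinfun_apply E x)) = oct_trace (\<lambda>x. E (D x))"
proof -
  have e: "blinfun_apply A (blinfun_apply B b) \<bullet> b = (\<Sum>c\<in>Basis. (B b \<bullet> c) * (A c \<bullet> b))" for A B :: "octonion \<Rightarrow>\<^sub>L octonion" and b
  proof -
    have "A (B b) = A (\<Sum>c\<in>Basis. (B b \<bullet> c) *\<^sub>R c)" by (simp only: euclidean_representation)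
    also have "\<dots> = (\<Sum>c\<in>Basis. (B b \<bullet> c) *\<^sub>R A c)" by (simp only: blinfun.sum_right blinfun.scaleR_right)
    finally show ?thesis by (simp only: inner_sum_left inner_scaleR_left)
  qed
  show ?thesis unfolding oct_trace_def e by (subst sum.swap) (simp only: mult.commute)
qed

lemma g2_form_linear:
  "g2_form (D + E) F = g2_form D F + g2_form E F" "g2_form (D - E) F = g2_form D F - g2_form E F"
  "g2_form (r *\<^sub>R D) F = r * g2_form D F"
  by (simp_all add: g2_form_def oct_trace_def blinfun.bilinear_simps inner_simps sum.distrib sum_subtractf sum_distrib_left)

lemma g2_form_commute: "g2_form D E = g2_form E D"
  unfolding g2_form_def by (subst oct_trace_commute) (rule refl)

lemma g2_form_invariant: "g2_form (commutator D E) F = g2_form D (commutator E F)"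
proof -
  have c: "oct_trace (\<lambda>x. E (D (F x))) = oct_trace (\<lambda>x. D (F (E x)))"
    using oct_trace_commute[of E "D o\<^sub>L F"] by simp
  have d: "oct_trace (\<lambda>x. f x - g x) = oct_trace f - oct_trace g" for f g
    by (simp add: oct_trace_def inner_diff_left sum_subtractf)
  have "g2_form (commutator D E) F = - oct_trace (\<lambda>x. D (E (F x)) - E (D (F x)))"
    by (simp add: g2_form_def commutator_apply)
  moreover have "g2_form D (commutator E F) = - oct_trace (\<lambda>x. D (E (F x)) - D (F (E x)))"
    by (simp add: g2_form_def commutator_apply blinfun.diff_right)
  ultimately show ?thesis unfolding d c by simp
qed

lemma g2_form_pos:
  assumes D: "D \<in> g2" "D \<noteq> 0"
  shows "g2_form D D > 0"
proof -
  have "R8.derivation D" using D by (simp add: g2_iff_derivation)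
  note sk = R8.derivation_skew[OF this]
  have e: "g2_form D D = (\<Sum>b\<in>Basis. D b \<bullet> D b)"
    unfolding g2_form_def oct_trace_def sk[of "blinfun_apply D _"] by (simp add: sum_negf)
  obtain b where b: "b \<in> Basis" "D b \<noteq> 0"
  proof (rule ccontr)
    assume "\<not> thesis"
    then have z: "D b = 0" if "b \<in> Basis" for b using \<open>b \<in> Basis\<close> \<open>\<And>b. b \<in> Basis \<Longrightarrow> D b \<noteq> 0 \<Longrightarrow> thesis\<close> by blast
    have "D x = 0" for x
    proof -
      have "D x = D (\<Sum>c\<in>Basis. (x \<bullet> c) *\<^sub>R c)" by (simp only: euclidean_representation)
      also have "\<dots> = (\<Sum>c\<in>Basis. (x \<bullet> c) *\<^sub>R D c)" by (simp only: blinfun.sum_right blinfun.scaleR_right)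
      also have "\<dots> = 0" by (intro sum.neutral) (simp add: z)
      finally show ?thesis .
    qed
    then have "D = 0" by (intro blinfun_eqI) simp
    then show False using D(2) by simp
  qed
  show ?thesis unfolding e using b by (intro sum_pos2[of _ b]) auto
qed

text \<open>
  The principal nilpotent \<open>e = P + \<i> Q\<close> is isotropic for the invariant form, hence \<open>P\<close> and \<open>Q\<close> are
  orthogonal of the same length; together with \<open>[P, Q]\<close> they form an orthogonal basis.
\<close>

lemma principal_so3_basis:
  assumes s: "g2.principal_three_dim_subalgebra s"
  obtains X Y Z where "X \<in> g2" "Y \<in> g2" "Z \<in> g2" "s = span {X, Y, Z}"
    "commutator X Y = Z" "commutator Y Z = X" "commutator Z X = Y"
    "g2.complexified.dim (g2.complexified.centralizer (X, Y)) = 2"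
proof -
  have sub: "g2.subalgebra s" and nab: "\<not> g2.abelian s" and dim: "dim s = 3"
    and pr: "g2.complexified.principal_subalgebra (complexify s)"
    using s unfolding g2.principal_three_dim_subalgebra_def g2.simple_subalgebra_def dim_raw_def by blast+
  have ss: "subspace s" and sg: "s \<subseteq> g2" and sb: "\<And>x y. x \<in> s \<Longrightarrow> y \<in> s \<Longrightarrow> commutator x y \<in> s"
    using sub unfolding g2.subalgebra_def subspace_raw_def by blast+
  obtain e h f where t: "g2.complexified.sl2_triple e h f" and pn: "g2.complexified.principal_nilpotent e"
    and sp: "complexify s = g2.complexified.span {e, h, f}"
    using pr unfolding g2.complexified.principal_subalgebra_def by blast
  obtain P Q where e: "e = (P, Q)" by (cases e)
  obtain R S where h: "h = (R, S)" by (cases h)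
  have "e \<in> complexify s" "h \<in> complexify s" unfolding sp by (simp_all add: g2.complexified.span_base)
  then have PQ: "P \<in> s" "Q \<in> s" and RS: "R \<in> s" "S \<in> s" by (simp_all add: e h complexify_def)
  have he: "cbr h e = cscale 2 e" and ef: "cbr e f = h"
    using t unfolding g2.complexified.sl2_triple_def by blast+
  have rel: "commutator R P - commutator S Q = 2 *\<^sub>R P" "commutator R Q + commutator S P = 2 *\<^sub>R Q"
    using he by (simp_all add: e h cbracket_def cscale_def)
  have self: "commutator D D = 0" and anti: "commutator D E = - commutator E D" for D E :: "octonion \<Rightarrow>\<^sub>L octonion"
    by (auto intro!: blinfun_eqI simp: commutator_apply blinfun.minus_left)
  have form0: "g2_form 0 D = 0" "g2_form D 0 = 0" "g2_form (- D) E = - g2_form D E" "g2_form D (- E) = - g2_form D E"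
    for D E by (simp_all add: g2_form_def oct_trace_def blinfun.bilinear_simps sum_negf)
  let ?W = "commutator P Q"
  \<comment> \<open>Isotropy of \<open>e\<close>: by \<open>[h, e] = 2 e\<close> and invariance,
    twice the squared lengths of \<open>P\<close> and of \<open>Q\<close> are both the pairing of
    \<open>S\<close> with \<open>[P, Q]\<close>, while twice the product of \<open>P\<close> and
    \<open>Q\<close> is both plus and minus the pairing of \<open>R\<close> with
    \<open>[P, Q]\<close>.\<close>
  have "2 * g2_form P P = g2_form (commutator R P - commutator S Q) P" unfolding rel g2_form_linear by simp
  also have "\<dots> = g2_form S ?W"
    unfolding g2_form_linear g2_form_invariant self anti[of Q P] by (simp add: form0)
  finally have PP: "2 * g2_form P P = g2_form S ?W" .
  have "2 * g2_form Q Q = g2_form (commutator R Q + commutator S P) Q" unfolding rel g2_form_linear by simp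
  also have "\<dots> = g2_form S ?W"
    unfolding g2_form_linear g2_form_invariant self by (simp add: form0)
  finally have QQ: "g2_form Q Q = g2_form P P" using PP by simp
  have "2 * g2_form P Q = g2_form (commutator R P - commutator S Q) Q" unfolding rel g2_form_linear by simp
  also have "\<dots> = g2_form R ?W" unfolding g2_form_linear g2_form_invariant self by (simp add: form0)
  finally have pq1: "2 * g2_form P Q = g2_form R ?W" .
  have "2 * g2_form Q P = g2_form (commutator R Q + commutator S P) P" unfolding rel g2_form_linear by simp
  also have "\<dots> = - g2_form R ?W"
    unfolding g2_form_linear g2_form_invariant self anti[of Q P] by (simp add: form0)
  finally have oPQ: "g2_form P Q = 0" "g2_form Q P = 0" using pq1 g2_form_commute[of P Q] by simp_all
  \<comment> \<open>\<open>P = 0\<close> would force \<open>Q = 0\<close>, hence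
    \<open>e = 0\<close> and \<open>h = [e, f] = 0\<close>; the complexification of \<open>s\<close>
    would be spanned by \<open>f\<close> and \<open>s\<close> would be abelian.\<close>
  have P0: "P \<noteq> 0"
  proof
    assume "P = 0"
    then have "g2_form Q Q = 0" using QQ by (simp add: form0)
    then have "Q = 0" using g2_form_pos PQ sg by force
    then have e0: "e = 0" using \<open>P = 0\<close> by (simp add: e zero_prod_def)
    have h0: "h = 0" using ef unfolding e0 by (simp add: cbracket_def commutator_linear zero_prod_def)
    have "g2.abelian s" unfolding g2.abelian_def
    proof (intro ballI)
      fix x y assume xy: "x \<in> s" "y \<in> s"
      have "(0 :: octonion \<Rightarrow>\<^sub>L octonion) \<in> s" using ss subspace_0 by blast
      then have "(x, 0) \<in> g2.complexified.span {e, h, f}" "(y, 0) \<in> g2.complexified.span {e, h, f}"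
        using xy unfolding sp[symmetric] complexify_def by simp_all
      then have "(x, 0) \<in> g2.complexified.span {f}" "(y, 0) \<in> g2.complexified.span {f}"
        unfolding e0 h0 g2.complexified.span_insert_0 by simp_all
      then obtain c d where c: "(x, 0) = cscale c f" and d: "(y, 0) = cscale d f"
        unfolding g2.complexified.span_singleton by blast
      have "cbr (cscale c f) (cscale d f) = 0"
        by (simp add: cbracket_def cscale_def commutator_linear zero_prod_def anti[of "snd f" "fst f"] algebra_simps)
      then have "cbr (x, 0) (y, 0) = 0" unfolding c d .
      then show "commutator x y = 0" by (simp add: cbracket_def commutator_linear zero_prod_def)
    qed
    then show False using nab by contradiction
  qed
  define n where "n = g2_form P P"
  have n: "n > 0" unfolding n_def using g2_form_pos P0 PQ sg by blast
  have W0: "g2_form S ?W \<noteq> 0" using PP n by (simp add: n_def)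
  then have "?W \<noteq> 0" using form0 by metis
  have Ws: "?W \<in> s" using sb PQ by blast
  have WW: "g2_form ?W ?W > 0" using g2_form_pos Ws sg \<open>?W \<noteq> 0\<close> by blast
  have oW: "g2_form ?W P = 0" "g2_form ?W Q = 0"
  proof -
    have "g2_form ?W P = g2_form P (commutator Q P)" by (rule g2_form_invariant)
    also have "\<dots> = - g2_form ?W P" unfolding anti[of Q P] form0 by (simp add: g2_form_commute)
    finally show "g2_form ?W P = 0" by simp
    show "g2_form ?W Q = 0" unfolding g2_form_invariant self form0 ..
  qed
  note fc = g2_form_commute[of P Q] g2_form_commute[of P ?W] g2_form_commute[of Q ?W]
  note orth = oPQ oW fc(2)[unfolded oW] fc(3)[unfolded oW]
  have ne: "Q \<noteq> P" "?W \<noteq> P" "?W \<noteq> Q"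
  proof -
    show "Q \<noteq> P" using oPQ(1) n unfolding n_def by (metis less_irrefl)
    show "?W \<noteq> P" "?W \<noteq> Q" using oW WW by (metis less_irrefl)+
  qed
  have Qn: "g2_form Q Q = n" "g2_form P P = n" using QQ by (simp_all add: n_def)
  have comb: "a = 0 \<and> b = 0 \<and> c = 0" if z: "a *\<^sub>R P + b *\<^sub>R Q + c *\<^sub>R ?W = 0" for a b c
  proof -
    have "g2_form (a *\<^sub>R P + b *\<^sub>R Q + c *\<^sub>R ?W) P = 0" "g2_form (a *\<^sub>R P + b *\<^sub>R Q + c *\<^sub>R ?W) Q = 0"
      "g2_form (a *\<^sub>R P + b *\<^sub>R Q + c *\<^sub>R ?W) ?W = 0" unfolding z by (simp_all add: form0)
    then show ?thesis using n WW by (simp add: g2_form_linear orth Qn)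
  qed
  have ind: "independent {P, Q, ?W}"
  proof -
    have "u P = 0 \<and> u Q = 0 \<and> u ?W = 0" if "(\<Sum>v\<in>{P, Q, ?W}. u v *\<^sub>R v) = 0" for u
      using that ne ne[symmetric] by (intro comb) (simp add: add.assoc)
    then have "u v = 0" if "(\<Sum>v\<in>{P, Q, ?W}. u v *\<^sub>R v) = 0" "v \<in> {P, Q, ?W}" for u v
      using that by blast
    then show ?thesis by (subst dependent_finite) auto
  qed
  have card: "card {P, Q, ?W} = 3" using ne by auto
  obtain B where B: "B \<subseteq> s" "independent B" "s \<subseteq> span B" "card B = 3" using basis_exists[of s] unfolding dim by blast
  have "finite B" using B(4) card.infinite by fastforce
  have "{P, Q, ?W} \<subseteq> span B" using PQ Ws B(3) by blast
  then have "span B \<subseteq> span {P, Q, ?W}"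
    using real_vector.span_eq_of_independent_card[of "{P, Q, ?W}" B] ind \<open>finite B\<close> card B(4)
    unfolding span_raw_def dependent_raw_def by simp
  then have span: "s = span {P, Q, ?W}"
    using B(3) PQ Ws ss span_minimal[of "{P, Q, ?W}" s] by blast
  have combination: "\<exists>a b c. x = a *\<^sub>R P + b *\<^sub>R Q + c *\<^sub>R ?W" if x: "x \<in> s" for x
  proof -
    obtain a b c where "x - a *\<^sub>R P - b *\<^sub>R Q - c *\<^sub>R ?W = 0"
      using x unfolding span span_breakdown_eq span_empty by blast
    then have "x = a *\<^sub>R P + b *\<^sub>R Q + c *\<^sub>R ?W" by (simp add: algebra_simps)
    then show ?thesis by blast
  qed
  \<comment> \<open>By invariance \<open>[Q, W]\<close> paired with \<open>P\<close>, and
    \<open>[W, P]\<close> paired with \<open>Q\<close>, both give the squared length of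
    \<open>W = [P, Q]\<close>; dividing by \<open>n\<close> yields the common coefficient.\<close>
  define k where "k = g2_form ?W ?W / n"
  have k: "k > 0" using WW n by (simp add: k_def)
  have expand: "x = (g2_form x P / n) *\<^sub>R P" if x: "x \<in> s" "g2_form x Q = 0" "g2_form x ?W = 0" for x
  proof -
    obtain a b c where abc: "x = a *\<^sub>R P + b *\<^sub>R Q + c *\<^sub>R ?W" using combination[OF x(1)] by blast
    then have "b * n = 0" "c * g2_form ?W ?W = 0" "g2_form x P = a * n"
      using x by (simp_all add: g2_form_linear orth Qn)
    then show ?thesis using abc n WW by simp
  qed
  have expand': "x = (g2_form x Q / n) *\<^sub>R Q" if x: "x \<in> s" "g2_form x P = 0" "g2_form x ?W = 0" for x
  proof -
    obtain a b c where abc: "x = a *\<^sub>R P + b *\<^sub>R Q + c *\<^sub>R ?W" using combination[OF x(1)] by blast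
    then have "a * n = 0" "c * g2_form ?W ?W = 0" "g2_form x Q = b * n"
      using x by (simp_all add: g2_form_linear orth Qn)
    then show ?thesis using abc n WW by simp
  qed
  have QW: "commutator Q ?W = k *\<^sub>R P"
  proof -
    have "g2_form (commutator Q ?W) P = g2_form ?W ?W"
      using g2_form_invariant[of P Q ?W] g2_form_commute[of P "commutator Q ?W"] by simp
    moreover have "g2_form (commutator Q ?W) ?W = 0" unfolding g2_form_invariant self form0 ..
    moreover have "g2_form (commutator Q ?W) Q = 0"
      using g2_form_invariant[of Q Q ?W] g2_form_commute[of Q "commutator Q ?W"] unfolding self form0 by simp
    ultimately show ?thesis using expand[OF sb[OF PQ(2) Ws]] by (simp add: k_def)
  qed
  have WP: "commutator ?W P = k *\<^sub>R Q"
  proof -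
    have "g2_form (commutator ?W P) Q = g2_form ?W ?W" by (rule g2_form_invariant)
    moreover have "g2_form (commutator ?W P) ?W = 0"
      using g2_form_invariant[of ?W ?W P] g2_form_commute[of ?W "commutator ?W P"] unfolding self form0 by simp
    moreover have "g2_form (commutator ?W P) P = 0" unfolding g2_form_invariant self form0 ..
    ultimately show ?thesis using expand'[OF sb[OF Ws PQ(1)]] by (simp add: k_def)
  qed
  \<comment> \<open>The scaling that makes the structure constants 1: \<open>[Y, Z]\<close> is
    \<open>r * r * r * k\<close> times \<open>P\<close> and has to be \<open>r\<close> times
    \<open>P\<close>.\<close>
  define r where "r = 1 / sqrt k"
  have r: "r > 0" "r * r * k = 1" using k by (simp_all add: r_def)
  define X Y Z where "X = r *\<^sub>R P" and "Y = r *\<^sub>R Q" and "Z = (r * r) *\<^sub>R ?W"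
  have XYZs: "X \<in> s" "Y \<in> s" "Z \<in> s" unfolding X_def Y_def Z_def using PQ Ws ss subspace_scale by blast+
  have "s = span {X, Y, Z}"
  proof
    show "span {X, Y, Z} \<subseteq> s" using XYZs ss by (intro span_minimal) auto
    have "P = (1 / r) *\<^sub>R X" "Q = (1 / r) *\<^sub>R Y" "?W = (1 / (r * r)) *\<^sub>R Z"
      using r(1) by (simp_all add: X_def Y_def Z_def)
    moreover have "(1 / r) *\<^sub>R X \<in> span {X, Y, Z}" "(1 / r) *\<^sub>R Y \<in> span {X, Y, Z}"
      "(1 / (r * r)) *\<^sub>R Z \<in> span {X, Y, Z}" by (intro span_scale span_base; simp)+
    ultimately have "P \<in> span {X, Y, Z}" "Q \<in> span {X, Y, Z}" "?W \<in> span {X, Y, Z}" by simp_all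
    then show "s \<subseteq> span {X, Y, Z}" unfolding span by (intro span_minimal) (simp_all add: subspace_span)
  qed
  moreover have "commutator X Y = Z" "commutator Y Z = X" "commutator Z X = Y"
    using r(2) by (simp_all add: X_def Y_def Z_def commutator_linear QW WP algebra_simps)
  moreover have "g2.complexified.centralizer (X, Y) = g2.complexified.centralizer e"
  proof -
    have "cbr z (X, Y) = r *\<^sub>R cbr z e" for z
      by (simp add: e X_def Y_def cbracket_def commutator_linear algebra_simps)
    then show ?thesis unfolding g2.complexified.centralizer_def using r(1) by simp
  qed
  moreover have "g2.complexified.dim (g2.complexified.centralizer e) = 2"
    using pn g2c_rank unfolding g2.complexified.principal_nilpotent_def by simp
  moreover have "X \<in> g2" "Y \<in> g2" "Z \<in> g2" using XYZs sg by blast+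
  ultimately show thesis by (intro that[of X Y Z]) simp_all
qed

section \<open>Octonion automorphisms acting by conjugation\<close>

definition oct_automorphism_pair :: "(octonion \<Rightarrow>\<^sub>L octonion) \<Rightarrow> (octonion \<Rightarrow>\<^sub>L octonion) \<Rightarrow> bool" where
  "oct_automorphism_pair F F' \<longleftrightarrow> F o\<^sub>L F' = id_blinfun \<and> F' o\<^sub>L F = id_blinfun \<and> (\<forall>x y. F (x \<otimes>\<^sub>O y) = F x \<otimes>\<^sub>O F y)"

text \<open>With the inverse carried as an argument, the inverse conjugation is the same expression
  with arguments exchanged.\<close>

definition oct_conj :: "(octonion \<Rightarrow>\<^sub>L octonion) \<Rightarrow> (octonion \<Rightarrow>\<^sub>L octonion) \<Rightarrow> (octonion \<Rightarrow>\<^sub>L octonion) \<Rightarrow> (octonion \<Rightarrow>\<^sub>L octonion)" where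
  "oct_conj F F' D = F o\<^sub>L D o\<^sub>L F'"

lemma oct_conj_apply: "oct_conj F F' D x = F (D (F' x))"
  by (simp add: oct_conj_def)

lemma oct_automorphism_pair_inverse:
  assumes "oct_automorphism_pair F F'"
  shows "F (F' x) = x" "F' (F x) = x"
proof -
  have "blinfun_apply (F o\<^sub>L F') x = x" "blinfun_apply (F' o\<^sub>L F) x = x"
    using assms by (simp_all add: oct_automorphism_pair_def)
  then show "F (F' x) = x" "F' (F x) = x" by simp_all
qed

lemma oct_automorphism_pair_mult: "oct_automorphism_pair F F' \<Longrightarrow> F (x \<otimes>\<^sub>O y) = F x \<otimes>\<^sub>O F y"
  unfolding oct_automorphism_pair_def by blast

lemma oct_automorphism_pairI:
  fixes F F' :: "octonion \<Rightarrow>\<^sub>L octonion"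
  assumes "\<And>x. F (F' x) = x" "\<And>x. F' (F x) = x" "\<And>x y. F (x \<otimes>\<^sub>O y) = F x \<otimes>\<^sub>O F y"
  shows "oct_automorphism_pair F F'"
  unfolding oct_automorphism_pair_def
  by (intro conjI blinfun_eqI allI)
    (simp_all only: blinfun_apply_blinfun_compose blinfun_apply_id_blinfun id_apply assms)

lemma oct_automorphism_pair_swap:
  assumes "oct_automorphism_pair F F'" shows "oct_automorphism_pair F' F"
proof -
  note i = oct_automorphism_pair_inverse[OF assms]
  have "F' (x \<otimes>\<^sub>O y) = F' x \<otimes>\<^sub>O F' y" for x y
  proof -
    have "F (F' x \<otimes>\<^sub>O F' y) = x \<otimes>\<^sub>O y" by (simp only: oct_automorphism_pair_mult[OF assms] i)
    then have "F' (F (F' x \<otimes>\<^sub>O F' y)) = F' (x \<otimes>\<^sub>O y)" by (simp only:)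
    then show ?thesis by (simp only: i)
  qed
  then show ?thesis using i by (intro oct_automorphism_pairI)
qed

lemma oct_automorphism_pair_compose:
  assumes "oct_automorphism_pair F F'" "oct_automorphism_pair G G'"
  shows "oct_automorphism_pair (G o\<^sub>L F) (F' o\<^sub>L G')"
  by (rule oct_automorphism_pairI)
    (simp_all only: blinfun_apply_blinfun_compose oct_automorphism_pair_mult[OF assms(1)]
      oct_automorphism_pair_mult[OF assms(2)] oct_automorphism_pair_inverse[OF assms(1)]
      oct_automorphism_pair_inverse[OF assms(2)])

lemma oct_conj_compose: "oct_conj G G' (oct_conj F F' D) = oct_conj (G o\<^sub>L F) (F' o\<^sub>L G') D"
  by (rule blinfun_eqI) (simp add: oct_conj_apply)

lemma oct_conj_id: "oct_automorphism_pair F F' \<Longrightarrow> oct_conj F' F (oct_conj F F' D) = D"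
  by (rule blinfun_eqI) (simp add: oct_conj_apply oct_automorphism_pair_inverse)

lemma oct_conj_linear: "linear (oct_conj F F')"
  by (intro linearI) (auto intro!: blinfun_eqI simp: oct_conj_apply blinfun.bilinear_simps)

lemma oct_conj_in_g2:
  assumes "oct_automorphism_pair F F'" "D \<in> g2" shows "oct_conj F F' D \<in> g2"
  using assms oct_automorphism_pair_inverse[OF assms(1)] oct_automorphism_pair_swap[OF assms(1)]
  by (simp add: g2_def oct_conj_apply oct_automorphism_pair_def blinfun.add_right del: split_paired_All)

lemma oct_conj_commutator:
  assumes "oct_automorphism_pair F F'"
  shows "oct_conj F F' (commutator D E) = commutator (oct_conj F F' D) (oct_conj F F' E)"
  by (rule blinfun_eqI) (simp add: oct_conj_apply commutator_apply oct_automorphism_pair_inverse[OF assms] blinfun.diff_right)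

lemma oct_conj_automorphism:
  assumes F: "oct_automorphism_pair F F'" shows "g2.automorphism (oct_conj F F')"
proof -
  have "bij_betw (oct_conj F F') g2 g2"
    by (rule bij_betwI[where g = "oct_conj F' F"])
      (use oct_conj_in_g2 oct_conj_id oct_automorphism_pair_swap F in blast)+
  then show ?thesis
    unfolding g2.automorphism_def using oct_conj_commutator[OF F] oct_conj_linear[of F F']
    by (simp add: linear_add linear_scale)
qed

text \<open>The Weyl chamber with simple roots \<open>b\<close> and \<open>a - b\<close>.
  Permutations sort the weights \<open>a\<close>, \<open>b\<close>, \<open>- (a + b)\<close>
  decreasingly, and a sign change repairs a negative middle weight.\<close>

lemma real_diag_triple_ordered:
  assumes D: "R8.derivation D"
  shows "\<exists>a b u v w. R8.diag_triple D a b u v w \<and> 0 \<le> b \<and> b \<le> a"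
proof -
  have sorted: "\<exists>a b u v w. R8.diag_triple D a b u v w \<and> - (a + b) \<le> b \<and> b \<le> a"
    if "R8.diag_triple D a b u v w" for a b u v w
  proof -
    have sw: "\<exists>a b u v w. R8.diag_triple D a b u v w \<and> - (a + b) \<le> b \<and> b \<le> a"
      if t: "R8.diag_triple D a b u v w" and ba: "b \<le> a" for a b u v w
    proof -
      note third = R8.diag_triple_third[OF t D]
      note third' = R8.diag_triple_third[OF R8.diag_triple_swap[OF t] D]
      consider "- (a + b) \<le> b" | "b \<le> - (a + b)" "- (a + b) \<le> a" | "a \<le> - (a + b)" by linarith
      then show ?thesis
      proof cases
        case 1 then show ?thesis using t ba by blast
      next
        case 2
        then have "- (a + - (a + b)) \<le> - (a + b)" by linarith
        then show ?thesis using third 2 by blast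
      next
        case 3
        then have "- (- (a + b) + a) \<le> a" using ba by linarith
        then show ?thesis using R8.diag_triple_swap[OF third] 3 by blast
      qed
    qed
    show ?thesis
    proof (cases "b \<le> a")
      case True then show ?thesis using sw that by blast
    next
      case False
      then have "a \<le> b" by simp
      then show ?thesis by (rule sw[OF R8.diag_triple_swap[OF that]])
    qed
  qed
  obtain a b u v w where t: "R8.diag_triple D a b u v w" and o: "- (a + b) \<le> b" "b \<le> a"
    using real_derivation_diag_triple[OF D] sorted by blast
  show ?thesis
  proof (cases "0 \<le> b")
    case True then show ?thesis using t o by blast
  next
    case False
    \<comment> \<open>After negation the weights in decreasing order are \<open>a + b\<close>,
      \<open>- b\<close>, \<open>- a\<close>.\<close>
    note t' = R8.diag_triple_swap[OF R8.diag_triple_third[OF R8.diag_triple_swap[OF R8.diag_triple_neg[OF t D]] D]]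
    have "- (- b + - a) = a + b" by simp
    then have "R8.diag_triple D (a + b) (- b) (- u) (w \<otimes>\<^sub>O v) w" using t' by simp
    moreover have "0 \<le> - b" "- b \<le> a + b" using False o by linarith+
    ultimately show ?thesis by blast
  qed
qed

lemma g2_conjugate_torus:
  assumes D: "D \<in> g2" and t: "R8.diag_triple D a b u v w"
  obtains F F' where "oct_automorphism_pair F F'"
    "\<And>k. k < 14 \<Longrightarrow> g2_coord (oct_conj F F' D) k = [complex_of_real a, complex_of_real b, 0, 0, 0, 0, 0, 0, 0, 0, 0, 0, 0, 0] ! k"
proof -
  have bt: "R8.basic_triple u v w" using t by (simp add: R8.diag_triple_def)
  let ?m = "R8.triple_map u v w" and ?n = "R8.triple_map_inv u v w"
  have lin: "linear ?m" "linear ?n"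
    by (intro linearI; simp only: R8.triple_map_linear)+
  define F F' where "F = Blinfun ?n" and "F' = Blinfun ?m"
  have app: "blinfun_apply F = ?n" "blinfun_apply F' = ?m"
    unfolding F_def F'_def using lin by (simp_all add: bounded_linear_Blinfun_apply linear_conv_bounded_linear)
  have FF: "oct_automorphism_pair F F'"
    by (rule oct_automorphism_pairI)
      (simp_all only: app
        R8.triple_map_inverse[OF bt] R8.triple_map_inv_mul[OF bt])
  have vals: "oct_conj F F' D oct_i = 0" "oct_conj F F' D oct_j = a *\<^sub>R (oct_i \<otimes>\<^sub>O oct_j)"
    "oct_conj F F' D oct_l = b *\<^sub>R (oct_i \<otimes>\<^sub>O oct_l)"
    using t unfolding oct_conj_apply app R8.diag_triple_def R8.triple_map_standard
    by (simp_all add: R8.triple_map_linear R8.triple_map_inv_mul[OF bt] R8.triple_map_inv_triple[OF bt])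
  have "\<forall>k<14. g2_coord (oct_conj F F' D) k = [complex_of_real a, complex_of_real b, 0, 0, 0, 0, 0, 0, 0, 0, 0, 0, 0, 0] ! k"
    unfolding all_less_14 by (simp add: g2_coord_def vals octonion_basis_products complex_eq_iff)
  then show thesis using that[OF FF] by blast
qed

text \<open>The torus of automorphisms, multiplying the last three complex slots by
  \<open>p\<close>, \<open>q\<close> and \<open>p * q\<close>. Coordinates 2 and 9 belong to the
  roots \<open>a - b\<close> and \<open>b\<close> and are multiplied by \<open>p * cnj q\<close> and
  \<open>q\<close>, so the two phases can be set independently.\<close>

lemma oct_rotation:
  assumes p: "p * cnj p = 1" and q: "q * cnj q = 1"
  obtains F F' where "oct_automorphism_pair F F'"
    "\<And>a b c d. oct_conj F F' (blinfun_der ((!) [a, b, c, 0, 0, 0, 0, 0, 0, d, 0])) =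
      blinfun_der ((!) [a, b, p * cnj q * c, 0, 0, 0, 0, 0, 0, q * d, 0])"
proof -
  define rot where "rot p q x = ((fst (fst x), p * snd (fst x)), (q * fst (snd x), p * q * snd (snd x)))"
    for p q :: complex and x :: octonion
  have lin: "linear (rot p q)" for p q
    by (intro linearI) (simp_all add: rot_def algebra_simps)
  define F F' where "F = Blinfun (rot p q)" and "F' = Blinfun (rot (cnj p) (cnj q))"
  have app: "blinfun_apply F = rot p q" "blinfun_apply F' = rot (cnj p) (cnj q)"
    unfolding F_def F'_def using lin by (simp_all add: bounded_linear_Blinfun_apply linear_conv_bounded_linear)
  have pq: "p * q * (cnj p * cnj q) = 1"
    using p q by algebra
  have FF: "oct_automorphism_pair F F'"
  proof (rule oct_automorphism_pairI)
    show "F (F' x) = x" "F' (F x) = x" for x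
      unfolding app rot_def using p q pq
      by (simp_all add: prod_eq_iff mult.assoc[symmetric]) (algebra+)
    fix x y :: octonion
    obtain x0 x1 x2 x3 y0 y1 y2 y3 where xy: "x = ((x0, x1), (x2, x3))" "y = ((y0, y1), (y2, y3))"
      by (metis surj_pair)
    have "x0 * y0 - x1 * cnj y1 - x2 * cnj y2 - cnj x3 * y3 =
        x0 * y0 - p * x1 * (cnj p * cnj y1) - q * x2 * (cnj q * cnj y2) - cnj p * cnj q * cnj x3 * (p * q * y3)"
      using p q by algebra
    moreover have "p * (x0 * y1 + x1 * cnj y0 + cnj x2 * y3 - x3 * cnj y2) =
        x0 * (p * y1) + p * x1 * cnj y0 + cnj q * cnj x2 * (p * q * y3) - p * q * x3 * (cnj q * cnj y2)"
      using q by algebra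
    moreover have "q * (x0 * y2 + x2 * cnj y0 + x3 * cnj y1 - cnj x1 * y3) =
        x0 * (q * y2) + q * x2 * cnj y0 + p * q * x3 * (cnj p * cnj y1) - cnj p * cnj x1 * (p * q * y3)"
      using p by algebra
    moreover have "p * q * (cnj x0 * y3 + x3 * y0 + x1 * y2 - x2 * y1) =
        cnj x0 * (p * q * y3) + p * q * x3 * y0 + p * x1 * (q * y2) - q * x2 * (p * y1)"
      by algebra
    ultimately show "F (x \<otimes>\<^sub>O y) = F x \<otimes>\<^sub>O F y"
      unfolding app rot_def xy fst_conv snd_conv oct_mult_coords prod.inject complex_cnj_mult by blast
  qed
  have "oct_conj F F' (blinfun_der ((!) [a, b, c, 0, 0, 0, 0, 0, 0, d, 0])) =
      blinfun_der ((!) [a, b, p * cnj q * c, 0, 0, 0, 0, 0, 0, q * d, 0])" for a b c d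
  proof (rule blinfun_eqI)
    fix x :: octonion
    obtain x0 x1 x2 x3 where x: "x = ((x0, x1), (x2, x3))" by (metis surj_pair)
    define a' b' where "a' = complex_of_real (Re a)" and "b' = complex_of_real (Re b)"
    have ab: "cnj a' = a'" "cnj b' = b'" by (simp_all add: a'_def b'_def)
    show "oct_conj F F' (blinfun_der ((!) [a, b, c, 0, 0, 0, 0, 0, 0, d, 0])) x =
      blinfun_der ((!) [a, b, p * cnj q * c, 0, 0, 0, 0, 0, 0, q * d, 0]) x"
      unfolding oct_conj_apply app blinfun_der_apply x oct_der_def Let_def rot_def fst_conv snd_conv
      using p q by (simp add: ab flip: a'_def b'_def) (intro conjI; algebra)
  qed
  then show thesis using that[OF FF] by blast
qed

section \<open>Weights in the Weyl chamber\<close>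

lemma cbr_linear:
  "cbr (p + p') q = cbr p q + cbr p' q" "cbr p (q + q') = cbr p q + cbr p q'"
  "cbr (cscale c p) q = cscale c (cbr p q)" "cbr p (cscale c q) = cscale c (cbr p q)"
  by (simp_all add: cbracket_def cscale_def commutator_linear algebra_simps)

lemma commutator_anti: "commutator D E = - commutator E D"
  by (rule blinfun_eqI) (simp add: commutator_apply blinfun.minus_left)

lemma cbr_anti: "cbr p q = - cbr q p"
  by (simp add: cbracket_def commutator_anti[of "fst q"] commutator_anti[of "snd q"])

text \<open>On the octonions the bracket acts as an operator commutator, and the action is faithful;
  the identity therefore holds for arbitrary pairs of operators.\<close>

lemma cbr_jacobi: "cbr t (cbr e p) = cbr (cbr t e) p + cbr e (cbr t p)"
proof -
  have d: "g2c_act r (x - y) = g2c_act r x - g2c_act r y" for r x y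
    by (simp add: g2c_act_def blinfun.bilinear_simps algebra_simps)
  show ?thesis by (rule g2c_act_eqI) (simp add: g2c_act_bracket g2c_act_linear d)
qed

lemma root_value_of_real: "k < 14 \<Longrightarrow> root_value (complex_of_real a) (complex_of_real b) k = complex_of_real (root_value a b k)"
  unfolding less_14_cases by (elim disjE) (simp_all add: root_value_def)

lemma root_vectors_independent:
  assumes I: "I \<subseteq> {..<14}"
  shows "inj_on root_vector I" "g2.complexified.independent (root_vector ` I)"
proof -
  show inj: "inj_on root_vector I"
  proof (rule inj_onI)
    fix i j assume ij: "i \<in> I" "j \<in> I" "root_vector i = root_vector j"
    then have "g2c_coord (root_vector i) i = g2c_coord (root_vector j) i" by simp
    then show "i = j" using ij(1) I by (auto simp: root_vector_coord split: if_splits)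
  qed
  have fin: "finite I" using I finite_subset by blast
  have "u (root_vector k) = 0" if z: "(\<Sum>v\<in>root_vector ` I. cscale (u v) v) = 0" and k: "k \<in> I" for u k
  proof -
    have k14: "k < 14" using k I by auto
    have "0 = g2c_coord (\<Sum>v\<in>root_vector ` I. cscale (u v) v) k" unfolding z using k14 by (simp add: g2c_coord_linear)
    also have "\<dots> = (\<Sum>i\<in>I. g2c_coord (cscale (u (root_vector i)) (root_vector i)) k)"
      using k14 by (simp add: g2c_coord_sum sum.reindex[OF inj])
    also have "\<dots> = (\<Sum>i\<in>I. if i = k then u (root_vector i) else 0)"
      by (intro sum.cong) (use k14 in \<open>auto simp: g2c_coord_linear root_vector_coord\<close>)
    also have "\<dots> = u (root_vector k)" using fin k by simp
    finally show ?thesis by simp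
  qed
  then show "g2.complexified.independent (root_vector ` I)"
    unfolding g2.complexified.dependent_finite[OF finite_imageI[OF fin]] by blast
qed

text \<open>
  If \<open>E\<close> lowers the eigenvalues of \<open>-\<i> ad Z\<close> by 1, then \<open>ad E\<close> maps the span of the eigenvectors with
  nonpositive eigenvalues to the span of those with eigenvalue at most \<open>-1\<close>. Hence the dimension of
  its kernel is at least the number of eigenvalues in \<open>(-1, 0]\<close>, which is 3 unless both simple
  roots are at least 1.
\<close>

lemma lowering_weights:
  assumes Z: "Z = g2c_torus (complex_of_real a) (complex_of_real b)" and ba: "0 \<le> b" "b \<le> a"
    and E: "E \<in> g2c" "cbr Z E = cscale (- \<i>) E"
    and B: "g2.complexified.centralizer E \<subseteq> g2.complexified.span B" "finite B" "card B \<le> 2"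
  shows "1 \<le> b \<and> 1 \<le> a - b"
proof (rule ccontr)
  assume neg: "\<not> ?thesis"
  \<comment> \<open>In the chamber \<open>?I\<close> consists of the torus and the six negative
    roots. If one simple root is below 1, eight dimensions are mapped into at most five, leaving a
    kernel of dimension at least three.\<close>
  let ?I = "{0, 1, 5, 6, 7, 10, 11, 12} :: nat set"
  let ?J = "{j \<in> {5, 6, 7, 10, 11, 12}. root_value a b j \<le> -1} :: nat set"
  have I14: "?I \<subseteq> {..<14}" by simp
  have lin: "Vector_Spaces.linear cscale cscale (cbr E)"
    by unfold_locales (simp_all add: cbr_linear)
  have "cbr E (root_vector k) \<in> g2.complexified.span (root_vector ` ?J)" if k: "k \<in> ?I" for k
  proof -
    let ?p = "cbr E (root_vector k)"
    have k14: "k < 14" using k by auto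
    have p: "?p \<in> g2c" using E(1) root_vector_in by (rule g2c_closed)
    have k0: "root_value a b k \<le> 0" using k ba by (auto simp: root_value_def)
    have eigp: "cbr Z ?p = cscale (\<i> * (root_value (complex_of_real a) (complex_of_real b) k - 1)) ?p"
    proof -
      have "cbr Z (root_vector k) = cscale (\<i> * root_value (complex_of_real a) (complex_of_real b) k) (root_vector k)"
        unfolding Z by (rule torus_root_vector)
      then have "cbr Z ?p = cscale (- \<i>) ?p + cscale (\<i> * root_value (complex_of_real a) (complex_of_real b) k) ?p"
        using cbr_jacobi[of Z E "root_vector k"] by (simp only: E(2) cbr_linear)
      also have "\<dots> = cscale (\<i> * (root_value (complex_of_real a) (complex_of_real b) k - 1)) ?p"
        by (simp add: cscale_def algebra_simps)
      finally show ?thesis .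
    qed
    have eig: "root_value a b j - root_value a b k + 1 = 0 \<or> g2c_coord ?p j = 0" if j: "j < 14" for j
    proof -
      have "\<i> * complex_of_real (root_value a b j) * g2c_coord ?p j = g2c_coord (cbr Z ?p) j"
        using g2c_torus_bracket_coord[OF p j] unfolding Z by (simp only: root_value_of_real[OF j])
      also have "\<dots> = \<i> * (complex_of_real (root_value a b k) - 1) * g2c_coord ?p j"
        unfolding eigp g2c_coord_linear(3)[OF j] root_value_of_real[OF k14] ..
      finally have "complex_of_real (root_value a b j) = complex_of_real (root_value a b k - 1) \<or> g2c_coord ?p j = 0"
        by auto
      then show ?thesis unfolding of_real_eq_iff by linarith
    qed
    have J: "j \<in> ?J" if "j < 14" "root_value a b j \<le> -1" for j
    proof -
      have "\<forall>j<14. root_value a b j \<le> -1 \<longrightarrow> j \<in> {5, 6, 7, 10, 11, 12}"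
        unfolding all_less_14 using ba by (simp add: root_value_def)
      then show ?thesis using that by blast
    qed
    have "cscale (g2c_coord ?p j) (root_vector j) \<in> g2.complexified.span (root_vector ` ?J)" if j: "j < 14" for j
    proof (cases "g2c_coord ?p j = 0")
      case True
      then show ?thesis by (simp add: g2.complexified.span_zero)
    next
      case False
      then have "root_value a b j \<le> -1" using eig[OF j] k0 by linarith
      then show ?thesis using J[OF j] by (intro g2.complexified.span_scale g2.complexified.span_base imageI)
    qed
    then have "(\<Sum>j<14. cscale (g2c_coord ?p j) (root_vector j)) \<in> g2.complexified.span (root_vector ` ?J)"
      by (intro g2.complexified.span_sum) simp
    then show ?thesis by (simp only: g2c_expand[OF p, symmetric])
  qed
  then have im: "cbr E ` root_vector ` ?I \<subseteq> g2.complexified.span (root_vector ` ?J)"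
    by blast
  have fin: "finite (root_vector ` ?I)" "finite (root_vector ` ?J)" by simp_all
  obtain N where N: "N \<subseteq> {x \<in> g2.complexified.span (root_vector ` ?I). cbr E x = 0}"
      "g2.complexified.independent N" "finite N" "card (root_vector ` ?I) \<le> card N + card (root_vector ` ?J)"
    by (rule g2.complexified.independent_kernel_subset[OF lin root_vectors_independent(2)[OF I14] fin(1) im fin(2)])
  have "card (root_vector ` ?I) = 8"
    using card_image[OF root_vectors_independent(1)[OF I14]] by simp
  moreover have "card (root_vector ` ?J) \<le> 5"
  proof -
    \<comment> \<open>A simple root below 1 removes its negative from \<open>?J\<close>: index 5
      belongs to \<open>b - a\<close>, index 12 to \<open>- b\<close>.\<close>
    have "card ?J \<le> 5"
    proof (cases "1 \<le> b")
      case True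
      then have "\<not> root_value a b 5 \<le> -1" using neg by (simp add: root_value_def)
      then have "?J \<subseteq> {6, 7, 10, 11, 12}" by blast
      from card_mono[OF _ this] show ?thesis by simp
    next
      case False
      then have "\<not> root_value a b 12 \<le> -1" by (simp add: root_value_def)
      then have "?J \<subseteq> {5, 6, 7, 10, 11}" by blast
      from card_mono[OF _ this] show ?thesis by simp
    qed
    then show ?thesis using card_image_le[of ?J root_vector] by simp
  qed
  ultimately have N3: "3 \<le> card N" using N(4) by linarith
  have "root_vector ` ?I \<subseteq> g2c" using root_vector_in by blast
  then have "g2.complexified.span (root_vector ` ?I) \<subseteq> g2c"
    using g2.complexified.subspace_G by (rule g2.complexified.span_minimal)
  moreover have "cbr x E = 0" if "cbr E x = 0" for x using that cbr_anti[of x E] by simp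
  ultimately have NC: "N \<subseteq> g2.complexified.centralizer E"
    using N(1) unfolding g2.complexified.centralizer_def by blast
  have "N \<subseteq> g2.complexified.span B" using NC B(1) by blast
  then have "card N \<le> card B"
    using g2.complexified.independent_span_bound[OF B(2) N(2)] by blast
  then have "card N \<le> 2" using B(3) by simp
  then show False using N3 by simp
qed

text \<open>Supported on the two simple roots, with the absolute values forced in
  \<open>principal_coords\<close> and phases chosen real; \<open>std_y\<close> turns both
  coefficients by a quarter.\<close>

definition std_x :: "octonion \<Rightarrow>\<^sub>L octonion" where
  "std_x = blinfun_der ((!) [0, 0, complex_of_real (sqrt (5 / 2)), 0, 0, 0, 0, 0, 0, complex_of_real (sqrt (3 / 2)), 0])"

definition std_y :: "octonion \<Rightarrow>\<^sub>L octonion" where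
  "std_y = blinfun_der ((!) [0, 0, \<i> * complex_of_real (sqrt (5 / 2)), 0, 0, 0, 0, 0, 0, \<i> * complex_of_real (sqrt (3 / 2)), 0])"

definition std_z :: "octonion \<Rightarrow>\<^sub>L octonion" where
  "std_z = commutator std_x std_y"

text \<open>Once both simple roots are at least 1, every other negative root is at most -2, so the
  eigenvalue -1 of \<open>X + \<i> Y\<close> can occur only at indices 5 and 12. Reality of
  \<open>X\<close> and \<open>Y\<close> then determines their shape, and the bracket the two
  lengths.\<close>

lemma principal_coords:
  assumes XYZ: "X \<in> g2" "Y \<in> g2" "Z \<in> g2"
    and br: "commutator X Y = Z" "commutator Y Z = X" "commutator Z X = Y"
    and Z: "\<And>k. k < 14 \<Longrightarrow> g2_coord Z k = [complex_of_real a, complex_of_real b, 0, 0, 0, 0, 0, 0, 0, 0, 0, 0, 0, 0] ! k"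
    and ba: "0 \<le> b" "b \<le> a"
    and B: "g2.complexified.centralizer (X, Y) \<subseteq> g2.complexified.span B" "finite B" "card B \<le> 2"
  obtains x y where "x * cnj x = 5 / 2" "y * cnj y = 3 / 2"
    "X = blinfun_der ((!) [0, 0, x, 0, 0, 0, 0, 0, 0, y, 0])"
    "Y = blinfun_der ((!) [0, 0, \<i> * x, 0, 0, 0, 0, 0, 0, \<i> * y, 0])"
proof -
  have XY: "(X, Y) \<in> g2c" using XYZ by (simp add: complexify_def)
  have "0 \<in> g2" using g2c_zero_in by (simp add: complexify_def zero_prod_def)
  then have Z0: "(Z, 0) \<in> g2c" using XYZ by (simp add: complexify_def)
  have "g2c_coord (Z, 0) k = g2c_coord (g2c_torus (complex_of_real a) (complex_of_real b)) k" if k: "k < 14" for k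
  proof -
    have "g2c_coord (Z, 0) k = g2_coord Z k" using k by (simp add: g2c_coord_def g2_coord_blinfun_linear)
    then show ?thesis unfolding Z[OF k] g2c_torus_coord[OF k] .
  qed
  then have ZT: "(Z, 0) = g2c_torus (complex_of_real a) (complex_of_real b)"
    by (rule g2c_eqI[OF Z0 g2c_torus_in])
  have ZE: "cbr (Z, 0) (X, Y) = cscale (- \<i>) (X, Y)"
    using br commutator_anti[of Z Y] by (simp add: cbracket_def cscale_def commutator_linear)
  have reg: "1 \<le> b" "1 \<le> a - b" using lowering_weights[OF ZT ba XY ZE B] by auto
  have E: "root_value a b k = -1 \<or> g2_coord X k + \<i> * g2_coord Y k = 0" if k: "k < 14" for k
  proof -
    have "\<i> * root_value (complex_of_real a) (complex_of_real b) k * g2c_coord (X, Y) k = - \<i> * g2c_coord (X, Y) k"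
      using g2c_torus_bracket_coord[OF XY k, of "complex_of_real a" "complex_of_real b"]
      unfolding ZT[symmetric] ZE g2c_coord_linear(3)[OF k] by simp
    then have "\<i> * (complex_of_real (root_value a b k) + 1) * g2c_coord (X, Y) k = 0"
      using k by (simp add: root_value_of_real algebra_simps)
    then have "complex_of_real (root_value a b k) + 1 = 0 \<or> g2c_coord (X, Y) k = 0" by simp
    then show ?thesis by (auto simp: complex_eq_iff g2c_coord_def)
  qed
  have E0: "g2_coord X k + \<i> * g2_coord Y k = 0" if "k < 14" "k \<noteq> 5" "k \<noteq> 12" for k
  proof -
    have "\<forall>k<14. k \<noteq> 5 \<longrightarrow> k \<noteq> 12 \<longrightarrow> root_value a b k \<noteq> -1"
      unfolding all_less_14 using reg by (simp add: root_value_def)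
    then show ?thesis using E that by blast
  qed
  have e: "g2_coord X 0 + \<i> * g2_coord Y 0 = 0" "g2_coord X 1 + \<i> * g2_coord Y 1 = 0"
    "g2_coord X 2 + \<i> * g2_coord Y 2 = 0" "g2_coord X 3 + \<i> * g2_coord Y 3 = 0"
    "g2_coord X 4 + \<i> * g2_coord Y 4 = 0" "g2_coord X 6 + \<i> * g2_coord Y 6 = 0"
    "g2_coord X 7 + \<i> * g2_coord Y 7 = 0" "g2_coord X 8 + \<i> * g2_coord Y 8 = 0"
    "g2_coord X 9 + \<i> * g2_coord Y 9 = 0" "g2_coord X 10 + \<i> * g2_coord Y 10 = 0"
    "g2_coord X 11 + \<i> * g2_coord Y 11 = 0" "g2_coord X 13 + \<i> * g2_coord Y 13 = 0"
    by (rule E0; simp)+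
  \<comment> \<open>When a coordinate of \<open>X + \<i> Y\<close> and its conjugate partner both
    vanish, \<open>X\<close> and \<open>Y\<close> vanish there separately. The coordinates 2 and 9
    have the surviving partners 5 and 12, so at them only \<open>Y = \<i> X\<close> follows.\<close>
  have cj: "x = 0 \<and> y = 0" if "x + \<i> * y = 0" "cnj x + \<i> * cnj y = 0" for x y
    using that by (simp add: complex_eq_iff)
  have cj': "x = 0 \<and> y = 0" if "x + \<i> * y = 0" "- cnj x + \<i> * - cnj y = 0" for x y
    using that by (simp add: complex_eq_iff)
  have rl: "x = 0 \<and> y = 0" if "x + \<i> * y = 0" "x \<in> \<real>" "y \<in> \<real>" for x y
    using that by (auto simp: complex_eq_iff complex_is_Real_iff)
  note Xr = g2_coord_real[OF XYZ(1)] and Yr = g2_coord_real[OF XYZ(2)]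
  have z01: "g2_coord X 0 = 0 \<and> g2_coord Y 0 = 0" "g2_coord X 1 = 0 \<and> g2_coord Y 1 = 0"
    using rl[OF e(1) Xr(1) Yr(1)] rl[OF e(2) Xr(2) Yr(2)] .
  have z34: "g2_coord X 3 = 0 \<and> g2_coord Y 3 = 0" "g2_coord X 4 = 0 \<and> g2_coord Y 4 = 0"
    using cj'[OF e(4) e(6)[unfolded Xr(4) Yr(4)]] cj'[OF e(5) e(7)[unfolded Xr(5) Yr(5)]] .
  have z810: "g2_coord X 8 = 0 \<and> g2_coord Y 8 = 0" "g2_coord X 10 = 0 \<and> g2_coord Y 10 = 0"
    using cj[OF e(8) e(11)[unfolded Xr(6) Yr(6)]] cj[OF e(10) e(12)[unfolded Xr(8) Yr(8)]] .
  define x y where "x = g2_coord X 2" and "y = g2_coord X 9"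
  have yi: "v = \<i> * u" if "u + \<i> * v = 0" for u v using that by (auto simp: complex_eq_iff)
  have Yxy: "g2_coord Y 2 = \<i> * x" "g2_coord Y 9 = \<i> * y"
    unfolding x_def y_def using yi[OF e(3)] yi[OF e(9)] .
  have der: "blinfun_apply D v = oct_der (g2_coord D) v" if "D \<in> g2" for D v
    using that unfolding g2_iff_derivation by (rule derivation_eq_oct_der)
  have Xe: "X = blinfun_der ((!) [0, 0, x, 0, 0, 0, 0, 0, 0, y, 0])"
    by (rule blinfun_eqI, subst der[OF XYZ(1)])
      (simp add: blinfun_der_apply oct_der_def z01 z01[unfolded One_nat_def] z34 z810 x_def y_def)
  have Ye: "Y = blinfun_der ((!) [0, 0, \<i> * x, 0, 0, 0, 0, 0, 0, \<i> * y, 0])"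
    by (rule blinfun_eqI, subst der[OF XYZ(2)])
      (simp add: blinfun_der_apply oct_der_def z01 z01[unfolded One_nat_def] z34 z810 Yxy)
  have ab: "complex_of_real a = 2 * (x * cnj x) - 2 * (y * cnj y)" "complex_of_real b = 4 * (y * cnj y) - 2 * (x * cnj x)"
    using g2_coord_commutator[OF XYZ(1,2), of 0] g2_coord_commutator[OF XYZ(1,2), of 1]
    unfolding br(1) by (simp_all add: Z g2_bracket_def Xr Yr z01 z01[unfolded One_nat_def] z34 z810 Yxy algebra_simps flip: x_def y_def)
  define m n where "m = (cmod x)\<^sup>2" and "n = (cmod y)\<^sup>2"
  have mn: "x * cnj x = complex_of_real m" "y * cnj y = complex_of_real n" "0 \<le> m" "0 \<le> n"
    by (simp_all add: m_def n_def complex_norm_square[symmetric])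
  have "complex_of_real a = complex_of_real (2 * m - 2 * n)" "complex_of_real b = complex_of_real (4 * n - 2 * m)"
    using ab unfolding mn(1,2) by simp_all
  then have abr: "a = 2 * m - 2 * n" "b = 4 * n - 2 * m" unfolding of_real_eq_iff by blast+
  \<comment> \<open>Without \<open>x\<close> the value \<open>a\<close> would be at most 0, without
    \<open>y\<close> the value \<open>b\<close> would be. Hence -1 really occurs at both simple
    indices.\<close>
  have "x \<noteq> 0" "y \<noteq> 0" using abr reg mn(3,4) by (auto simp: m_def n_def)
  have "a - b = 1"
  proof -
    have "g2_coord X 5 + \<i> * g2_coord Y 5 = - 2 * cnj x" by (simp add: Xr Yr Yxy flip: x_def)
    then show ?thesis using E[of 5] \<open>x \<noteq> 0\<close> by (auto simp: root_value_def)
  qed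
  moreover have "b = 1"
  proof -
    have "g2_coord X 12 + \<i> * g2_coord Y 12 = 2 * cnj y" by (simp add: Xr Yr Yxy flip: y_def)
    then show ?thesis using E[of 12] \<open>y \<noteq> 0\<close> by (auto simp: root_value_def)
  qed
  ultimately have "m = 5 / 2" "n = 3 / 2" using abr by linarith+
  then have "x * cnj x = complex_of_real (5 / 2)" "y * cnj y = complex_of_real (3 / 2)"
    using mn(1,2) by (simp_all only:)
  then have "x * cnj x = 5 / 2" "y * cnj y = 3 / 2" by simp_all
  then show thesis using that Xe Ye by blast
qed

lemma principal_conjugate_std:
  assumes s: "g2.principal_three_dim_subalgebra s"
  obtains F F' where "oct_automorphism_pair F F'" "oct_conj F F' ` s = span {std_x, std_y, std_z}"
proof -
  obtain X Y Z where XYZ: "X \<in> g2" "Y \<in> g2" "Z \<in> g2" and sXYZ: "s = span {X, Y, Z}"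
    and br: "commutator X Y = Z" "commutator Y Z = X" "commutator Z X = Y"
    and dim: "g2.complexified.dim (g2.complexified.centralizer (X, Y)) = 2"
    by (rule principal_so3_basis[OF s]) (rule that; assumption)
  obtain a b u v w where t: "R8.diag_triple Z a b u v w" and ba: "0 \<le> b" "b \<le> a"
    using real_diag_triple_ordered[OF XYZ(3)[unfolded g2_iff_derivation]] by (elim exE conjE)
  obtain F F' where F: "oct_automorphism_pair F F'"
    and Zc: "\<And>k. k < 14 \<Longrightarrow> g2_coord (oct_conj F F' Z) k = [complex_of_real a, complex_of_real b, 0, 0, 0, 0, 0, 0, 0, 0, 0, 0, 0, 0] ! k"
    by (rule g2_conjugate_torus[OF XYZ(3) t]) (rule that; assumption)
  let ?c = "oct_conj F F'"
  have g: "?c X \<in> g2" "?c Y \<in> g2" "?c Z \<in> g2" using XYZ oct_conj_in_g2[OF F] by blast+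
  have br': "commutator (?c X) (?c Y) = ?c Z" "commutator (?c Y) (?c Z) = ?c X" "commutator (?c Z) (?c X) = ?c Y"
    unfolding oct_conj_commutator[OF F, symmetric] br by (rule refl)+
  obtain B where B: "B \<subseteq> g2.complexified.centralizer (X, Y)"
      "g2.complexified.centralizer (X, Y) \<subseteq> g2.complexified.span B"
      "card B = g2.complexified.dim (g2.complexified.centralizer (X, Y))"
    by (rule g2.complexified.basis_exists)
  note B3 = B(3)[unfolded dim]
  have fB: "finite B" using B3 card.infinite by fastforce
  let ?P = "\<lambda>p. (?c (fst p), ?c (snd p))"
  \<comment> \<open>The inverse conjugation pulls an element centralizing the image back to one
    centralizing \<open>(X, Y)\<close>, so the image of \<open>B\<close> spans.\<close>
  have cB: "g2.complexified.centralizer (?c X, ?c Y) \<subseteq> g2.complexified.span (?P ` B)"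
  proof
    fix z assume "z \<in> g2.complexified.centralizer (?c X, ?c Y)"
    then have z: "z \<in> g2c" "cbr z (?c X, ?c Y) = 0" by (simp_all add: g2.complexified.centralizer_def)
    note F' = oct_automorphism_pair_swap[OF F]
    define y where "y = (oct_conj F' F (fst z), oct_conj F' F (snd z))"
    have y: "y \<in> g2c" using z(1) oct_conj_in_g2[OF F'] by (simp add: y_def complexify_def mem_Times_iff)
    have Py: "?P y = z" by (simp add: y_def oct_conj_id[OF F'])
    have "cbr (?P y) (?P (X, Y)) = ?P (cbr y (X, Y))"
      by (simp add: cbracket_def oct_conj_commutator[OF F] linear_diff[OF oct_conj_linear] linear_add[OF oct_conj_linear])
    then have "?P (cbr y (X, Y)) = 0" using z(2) unfolding Py by simp
    then have "oct_conj F' F (?c (fst (cbr y (X, Y)))) = 0" "oct_conj F' F (?c (snd (cbr y (X, Y)))) = 0"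
      by (simp_all add: zero_prod_def linear_0[OF oct_conj_linear])
    then have "cbr y (X, Y) = 0" unfolding oct_conj_id[OF F] by (simp add: prod_eq_iff)
    then have "y \<in> g2.complexified.span B"
      using y B(2) by (auto simp: g2.complexified.centralizer_def)
    then have "?P y \<in> ?P ` g2.complexified.span B" by (rule imageI)
    also have "?P ` g2.complexified.span B \<subseteq> g2.complexified.span (?P ` B)"
    proof (rule g2c_hom_span[where K = g2c])
      show "g2c_hom ?P"
        unfolding g2c_hom_def using oct_conj_in_g2[OF F]
        by (simp add: complexify_def mem_Times_iff cbracket_def cscale_def oct_conj_commutator[OF F]
            linear_diff[OF oct_conj_linear] linear_add[OF oct_conj_linear] linear_scale[OF oct_conj_linear]
            del: split_paired_All)
      show "g2.complexified.subspace g2c" by (rule g2.complexified.subspace_G)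
      show "B \<subseteq> g2c" using B(1) by (auto simp: g2.complexified.centralizer_def)
    qed simp
    finally show "z \<in> g2.complexified.span (?P ` B)" unfolding Py .
  qed
  have cfin: "finite (?P ` B)" "card (?P ` B) \<le> 2" using fB card_image_le[OF fB, of ?P] B3 by simp_all
  obtain x y where xy: "x * cnj x = 5 / 2" "y * cnj y = 3 / 2"
    and Xe: "?c X = blinfun_der ((!) [0, 0, x, 0, 0, 0, 0, 0, 0, y, 0])"
    and Ye: "?c Y = blinfun_der ((!) [0, 0, \<i> * x, 0, 0, 0, 0, 0, 0, \<i> * y, 0])"
    by (rule principal_coords[OF g br' Zc ba cB cfin]; (assumption | (rule that; assumption)))
  define r t where "r = complex_of_real (sqrt (5 / 2))" and "t = complex_of_real (sqrt (3 / 2))"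
  have rt: "cnj r = r" "r * r = 5 / 2" "cnj t = t" "t * t = 3 / 2" "r \<noteq> 0" "t \<noteq> 0"
    by (simp_all add: r_def t_def flip: of_real_mult)
  \<comment> \<open>Chosen so that \<open>q * y = t\<close> and \<open>p * cnj q * x = r\<close>:
    both quotients have modulus 1 because \<open>t\<close> and \<open>r\<close> are the moduli of
    \<open>y\<close> and \<open>x\<close>, and the factor \<open>q\<close> in \<open>p\<close>
    cancels \<open>cnj q\<close>.\<close>
  define q p where "q = cnj y / t" and "p = q * (cnj x / r)"
  have qq: "q * cnj q = 1"
  proof -
    have "q * cnj q = (y * cnj y) / (t * t)" by (simp add: q_def rt(3) mult.commute)
    then show ?thesis unfolding xy rt by simp
  qed
  have pp: "p * cnj p = 1"
  proof -
    have "p * cnj p = (q * cnj q) * ((x * cnj x) / (r * r))" by (simp add: p_def rt(1) ac_simps)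
    then show ?thesis unfolding xy rt qq by simp
  qed
  obtain G G' where G: "oct_automorphism_pair G G'"
    and Gd: "\<And>a b c d. oct_conj G G' (blinfun_der ((!) [a, b, c, 0, 0, 0, 0, 0, 0, d, 0])) =
      blinfun_der ((!) [a, b, p * cnj q * c, 0, 0, 0, 0, 0, 0, q * d, 0])"
    by (rule oct_rotation[OF pp qq]) (rule that; assumption)
  have v: "p * cnj q * x = r" "q * y = t" "p * cnj q * (\<i> * x) = \<i> * r" "q * (\<i> * y) = \<i> * t"
  proof -
    have "q * y = (y * cnj y) / t" by (simp add: q_def)
    then show 1: "q * y = t" unfolding xy rt(4)[symmetric] using rt(6) by simp
    have "p * cnj q * x = (q * cnj q) * ((x * cnj x) / r)" by (simp add: p_def)
    then show 2: "p * cnj q * x = r" unfolding qq xy rt(2)[symmetric] using rt(5) by simp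
    show "p * cnj q * (\<i> * x) = \<i> * r" "q * (\<i> * y) = \<i> * t"
      using 1 2 by (simp_all only: mult.left_commute[of _ \<i>])
  qed
  have GX: "oct_conj G G' (?c X) = std_x" "oct_conj G G' (?c Y) = std_y"
    unfolding Xe Ye Gd v std_x_def std_y_def r_def t_def by simp_all
  have GZ: "oct_conj G G' (?c Z) = std_z"
    unfolding br'(1)[symmetric] oct_conj_commutator[OF G] GX std_z_def ..
  have "oct_conj (G o\<^sub>L F) (F' o\<^sub>L G') ` s = oct_conj G G' ` ?c ` s"
    by (simp add: image_image oct_conj_compose)
  also have "\<dots> = span {std_x, std_y, std_z}"
    unfolding sXYZ linear_span_image[OF oct_conj_linear, symmetric] by (simp add: GX GZ)
  finally show thesis using that oct_automorphism_pair_compose[OF F G] by blast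
qed

section \<open>The standard principal subalgebra\<close>

definition std_e :: "g2c_operator" where
  "std_e = (std_x, std_y)"

lemma std_in_g2: "std_x \<in> g2" "std_y \<in> g2" "std_z \<in> g2"
proof -
  show x: "std_x \<in> g2" and y: "std_y \<in> g2" by (simp_all add: std_x_def std_y_def blinfun_der_in_g2)
  show "std_z \<in> g2" unfolding std_z_def using x y by (rule g2.br_closed)
qed

text \<open>The element \<open>std_z\<close> has torus coordinates (2, 1), where both simple roots
  take the value 1.\<close>

lemma std_coords:
  assumes "k < 14"
  shows "g2_coord std_x k = [0, 0, complex_of_real (sqrt (5 / 2)), 0, 0, - complex_of_real (sqrt (5 / 2)), 0, 0,
      0, complex_of_real (sqrt (3 / 2)), 0, 0, complex_of_real (sqrt (3 / 2)), 0] ! k"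
    "g2_coord std_y k = [0, 0, \<i> * complex_of_real (sqrt (5 / 2)), 0, 0, \<i> * complex_of_real (sqrt (5 / 2)), 0, 0,
      0, \<i> * complex_of_real (sqrt (3 / 2)), 0, 0, - \<i> * complex_of_real (sqrt (3 / 2)), 0] ! k"
    "g2_coord std_z k = [2, 1, 0, 0, 0, 0, 0, 0, 0, 0, 0, 0, 0, 0] ! k"
proof -
  have x: "\<forall>k<14. g2_coord std_x k = [0, 0, complex_of_real (sqrt (5 / 2)), 0, 0, - complex_of_real (sqrt (5 / 2)), 0, 0,
      0, complex_of_real (sqrt (3 / 2)), 0, 0, complex_of_real (sqrt (3 / 2)), 0] ! k"
    "\<forall>k<14. g2_coord std_y k = [0, 0, \<i> * complex_of_real (sqrt (5 / 2)), 0, 0, \<i> * complex_of_real (sqrt (5 / 2)), 0, 0,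
      0, \<i> * complex_of_real (sqrt (3 / 2)), 0, 0, - \<i> * complex_of_real (sqrt (3 / 2)), 0] ! k"
    unfolding all_less_14 by (simp_all add: std_x_def std_y_def blinfun_der_apply g2_coord_oct_der)
  have "\<forall>k<14. g2_bracket (g2_coord std_x) (g2_coord std_y) k = [2, 1, 0, 0, 0, 0, 0, 0, 0, 0, 0, 0, 0, 0] ! k"
    using x unfolding all_less_14 by (simp add: g2_bracket_def complex_eq_iff)
  then have "\<forall>k<14. g2_coord std_z k = [2, 1, 0, 0, 0, 0, 0, 0, 0, 0, 0, 0, 0, 0] ! k"
    unfolding std_z_def using g2_coord_commutator[OF std_in_g2(1,2)] by simp
  then show "g2_coord std_z k = [2, 1, 0, 0, 0, 0, 0, 0, 0, 0, 0, 0, 0, 0] ! k" using assms by blast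
  show "g2_coord std_x k = [0, 0, complex_of_real (sqrt (5 / 2)), 0, 0, - complex_of_real (sqrt (5 / 2)), 0, 0,
      0, complex_of_real (sqrt (3 / 2)), 0, 0, complex_of_real (sqrt (3 / 2)), 0] ! k"
    "g2_coord std_y k = [0, 0, \<i> * complex_of_real (sqrt (5 / 2)), 0, 0, \<i> * complex_of_real (sqrt (5 / 2)), 0, 0,
      0, \<i> * complex_of_real (sqrt (3 / 2)), 0, 0, - \<i> * complex_of_real (sqrt (3 / 2)), 0] ! k"
    using x assms by blast+
qed

lemma std_brackets:
  "commutator std_x std_y = std_z" "commutator std_y std_z = std_x" "commutator std_z std_x = std_y"
proof -
  show "commutator std_x std_y = std_z" by (simp add: std_z_def)
  note c = std_coords
  have "\<forall>k<14. g2_bracket (g2_coord std_y) (g2_coord std_z) k = g2_coord std_x k"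
    "\<forall>k<14. g2_bracket (g2_coord std_z) (g2_coord std_x) k = g2_coord std_y k"
    unfolding all_less_14 by (simp_all add: g2_bracket_def c algebra_simps)
  note b = this
  show "commutator std_y std_z = std_x"
    by (rule g2_eqI) (simp_all add: std_in_g2 g2.br_closed g2_coord_commutator b)
  show "commutator std_z std_x = std_y"
    by (rule g2_eqI) (simp_all add: std_in_g2 g2.br_closed g2_coord_commutator b)
qed

lemma std_combination:
  assumes "x \<in> span {std_x, std_y, std_z}"
  obtains a b c where "x = a *\<^sub>R std_x + b *\<^sub>R std_y + c *\<^sub>R std_z"
proof -
  obtain a b c where "x - a *\<^sub>R std_x - b *\<^sub>R std_y - c *\<^sub>R std_z = 0"
    using assms unfolding span_breakdown_eq span_empty by blast
  then have "x = a *\<^sub>R std_x + b *\<^sub>R std_y + c *\<^sub>R std_z" by (simp add: algebra_simps)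
  then show thesis by (rule that)
qed

lemma std_commutator_combination:
  "commutator (a *\<^sub>R std_x + b *\<^sub>R std_y + c *\<^sub>R std_z) (a' *\<^sub>R std_x + b' *\<^sub>R std_y + c' *\<^sub>R std_z)
    = (b * c' - c * b') *\<^sub>R std_x + (c * a' - a * c') *\<^sub>R std_y + (a * b' - b * a') *\<^sub>R std_z"
proof -
  have "commutator std_y std_x = - std_z" "commutator std_z std_y = - std_x" "commutator std_x std_z = - std_y"
    using commutator_anti[of std_y std_x] commutator_anti[of std_z std_y] commutator_anti[of std_x std_z]
    unfolding std_brackets by (simp_all only:)
  then show ?thesis by (simp add: commutator_linear std_brackets algebra_simps)
qed

lemma std_combination_eq_0:
  assumes z: "a *\<^sub>R std_x + b *\<^sub>R std_y + c *\<^sub>R std_z = 0"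
  shows "a = 0" "b = 0" "c = 0"
proof -
  have l: "a *\<^sub>R g2_coord std_x k + b *\<^sub>R g2_coord std_y k + c *\<^sub>R g2_coord std_z k = 0" if k: "k < 14" for k
  proof -
    have "g2_coord (blinfun_apply (a *\<^sub>R std_x + b *\<^sub>R std_y + c *\<^sub>R std_z)) k = 0"
      unfolding z using k by (simp add: g2_coord_blinfun_linear)
    then show ?thesis by (simp only: g2_coord_blinfun_linear[OF k])
  qed
  show "a = 0" "b = 0" "c = 0"
    using l[of 0] l[of 2] by (simp_all add: std_coords complex_eq_iff)
qed

lemma std_span_mem: "a *\<^sub>R std_x + b *\<^sub>R std_y + c *\<^sub>R std_z \<in> span {std_x, std_y, std_z}"
  by (intro span_add span_scale span_base) simp_all

lemma std_dim: "dim (span {std_x, std_y, std_z}) = 3"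
proof -
  have ne: "std_x \<noteq> std_y" "std_x \<noteq> std_z" "std_y \<noteq> std_z"
    using std_combination_eq_0(1)[of 1 "-1" 0] std_combination_eq_0(1)[of 1 0 "-1"] std_combination_eq_0(2)[of 0 1 "-1"]
    by auto
  have "u std_x = 0 \<and> u std_y = 0 \<and> u std_z = 0" if "(\<Sum>v\<in>{std_x, std_y, std_z}. u v *\<^sub>R v) = 0" for u
  proof -
    have "u std_x *\<^sub>R std_x + u std_y *\<^sub>R std_y + u std_z *\<^sub>R std_z = 0" using that ne by (simp add: add.assoc)
    then show ?thesis by (intro conjI; rule std_combination_eq_0)
  qed
  then have "u v = 0" if "(\<Sum>v\<in>{std_x, std_y, std_z}. u v *\<^sub>R v) = 0" "v \<in> {std_x, std_y, std_z}" for u v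
    using that by blast
  then have "independent {std_x, std_y, std_z}" by (subst dependent_finite) auto
  then have "dim (span {std_x, std_y, std_z}) = card {std_x, std_y, std_z}" by (rule dim_span_eq_card_independent)
  also have "\<dots> = 3" using ne by simp
  finally show ?thesis .
qed

text \<open>In this basis the bracket is the cross product. A nonzero element of an ideal yields a
  nonzero multiple of one basis vector, and the cyclic brackets produce the other two.\<close>

lemma std_simple: "g2.simple_subalgebra (span {std_x, std_y, std_z})"
proof -
  let ?s = "span {std_x, std_y, std_z}"
  have sg: "?s \<subseteq> g2"
    using std_in_g2 g2.subspace_G unfolding subspace_raw_def[symmetric] by (intro span_minimal) auto
  have closed: "commutator x y \<in> ?s" if xy: "x \<in> ?s" "y \<in> ?s" for x y
  proof -
    obtain a b c where x: "x = a *\<^sub>R std_x + b *\<^sub>R std_y + c *\<^sub>R std_z" by (rule std_combination[OF xy(1)])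
    obtain a' b' c' where y: "y = a' *\<^sub>R std_x + b' *\<^sub>R std_y + c' *\<^sub>R std_z" by (rule std_combination[OF xy(2)])
    show ?thesis unfolding x y std_commutator_combination by (rule std_span_mem)
  qed
  have sub: "g2.subalgebra ?s"
    unfolding g2.subalgebra_def subspace_raw_def[symmetric] using sg closed subspace_span by blast
  have nz: "std_z \<noteq> 0" using std_combination_eq_0(3)[of 0 0 1] by auto
  have mem: "std_x \<in> ?s" "std_y \<in> ?s" "std_z \<in> ?s" by (simp_all add: span_base)
  have nab: "\<not> g2.abelian ?s" using nz mem std_brackets(1) unfolding g2.abelian_def by metis
  have ideal: "I = {0} \<or> I = ?s" if I: "g2.ideal_of I ?s" for I
  proof (cases "I = {0}")
    case False
    have Is: "subspace I" and sI: "I \<subseteq> ?s" and br: "\<And>x y. x \<in> ?s \<Longrightarrow> y \<in> I \<Longrightarrow> commutator x y \<in> I"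
      using I unfolding g2.ideal_of_def subspace_raw_def[symmetric] by blast+
    obtain x where x: "x \<in> I" "x \<noteq> 0" using False subspace_0[OF Is] by blast
    obtain a b c where abc: "x = a *\<^sub>R std_x + b *\<^sub>R std_y + c *\<^sub>R std_z"
      by (rule std_combination[OF subsetD[OF sI x(1)]])
    \<comment> \<open>For a basis vector \<open>u\<close>, the square of \<open>ad u\<close> is -1
      on the other two directions, so this is the component of \<open>x\<close> along
      \<open>u\<close>.\<close>
    have proj: "x + commutator u (commutator u x) \<in> I" if "u \<in> ?s" for u
      using x(1) br[OF that br[OF that x(1)]] by (rule subspace_add[OF Is])
    have e: "std_x = 1 *\<^sub>R std_x + 0 *\<^sub>R std_y + 0 *\<^sub>R std_z" "std_y = 0 *\<^sub>R std_x + 1 *\<^sub>R std_y + 0 *\<^sub>R std_z"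
      "std_z = 0 *\<^sub>R std_x + 0 *\<^sub>R std_y + 1 *\<^sub>R std_z" by simp_all
    have cc: "commutator std_x x = (- c) *\<^sub>R std_y + b *\<^sub>R std_z" "commutator std_y x = c *\<^sub>R std_x + (- a) *\<^sub>R std_z"
      "commutator std_z x = (- b) *\<^sub>R std_x + a *\<^sub>R std_y"
      using std_commutator_combination[of 1 0 0 a b c] std_commutator_combination[of 0 1 0 a b c]
        std_commutator_combination[of 0 0 1 a b c] by (simp_all add: abc)
    have "x + commutator std_x (commutator std_x x) = a *\<^sub>R std_x" "x + commutator std_y (commutator std_y x) = b *\<^sub>R std_y"
      "x + commutator std_z (commutator std_z x) = c *\<^sub>R std_z"
      using std_commutator_combination[of 1 0 0 0 "- c" b] std_commutator_combination[of 0 1 0 c 0 "- a"]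
        std_commutator_combination[of 0 0 1 "- b" a 0]
      unfolding cc by (simp_all add: abc)
    then have m: "a *\<^sub>R std_x \<in> I" "b *\<^sub>R std_y \<in> I" "c *\<^sub>R std_z \<in> I"
      using proj[OF mem(1)] proj[OF mem(2)] proj[OF mem(3)] by simp_all
    have inv: "v \<in> I" if "d *\<^sub>R v \<in> I" "d \<noteq> 0" for d v
      using subspace_scale[OF Is that(1), of "1 / d"] that(2) by simp
    have neg: "v \<in> I" if "- v \<in> I" for v using subspace_neg[OF Is that] by simp
    have all: "std_x \<in> I \<and> std_y \<in> I \<and> std_z \<in> I" if "std_x \<in> I \<or> std_y \<in> I \<or> std_z \<in> I"
    proof -
      have 1: "std_x \<in> I \<Longrightarrow> std_y \<in> I" using br[OF mem(3), of std_x] by (simp add: std_brackets)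
      have 2: "std_y \<in> I \<Longrightarrow> std_z \<in> I" using br[OF mem(1), of std_y] by (simp add: std_brackets)
      have 3: "std_z \<in> I \<Longrightarrow> std_x \<in> I" using br[OF mem(2), of std_z] by (simp add: std_brackets)
      show ?thesis using that 1 2 3 by blast
    qed
    have "a \<noteq> 0 \<or> b \<noteq> 0 \<or> c \<noteq> 0" using x(2) abc by auto
    then have "std_x \<in> I \<and> std_y \<in> I \<and> std_z \<in> I" using m inv all by blast
    then have "?s \<subseteq> I" using Is by (intro span_minimal) auto
    then show ?thesis using sI by blast
  qed simp
  show ?thesis unfolding g2.simple_subalgebra_def using sub nab ideal by blast
qed

text \<open>\<open>std_r\<close> and \<open>std_t\<close> are the coefficients of
  \<open>std_e\<close> at the negative simple roots, indices 5 and 12.\<close>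

definition std_r :: complex where "std_r = - 2 * complex_of_real (sqrt (5 / 2))"
definition std_t :: complex where "std_t = 2 * complex_of_real (sqrt (3 / 2))"

lemma std_rt_nonzero: "std_r \<noteq> 0" "std_t \<noteq> 0"
  by (simp_all add: std_r_def std_t_def)

lemma std_e_in: "std_e \<in> g2c"
  by (simp add: std_e_def complexify_def std_in_g2)

lemma std_e_coord:
  assumes "k < 14"
  shows "g2c_coord std_e k = [0, 0, 0, 0, 0, std_r, 0, 0, 0, 0, 0, 0, std_t, 0] ! k"
proof -
  have "\<forall>k<14. g2c_coord std_e k = [0, 0, 0, 0, 0, std_r, 0, 0, 0, 0, 0, 0, std_t, 0] ! k"
    unfolding all_less_14 by (simp add: g2c_coord_def std_e_def std_coords std_r_def std_t_def complex_eq_iff)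
  then show ?thesis using assms by blast
qed

lemma std_e_bracket_coord:
  assumes p: "p \<in> g2c" and k: "k < 14"
  shows "g2c_coord (cbr std_e p) k =
    [\<i> * (std_r * g2c_coord p 2 + std_t * g2c_coord p 9), - \<i> * (std_r * g2c_coord p 2 + 2 * std_t * g2c_coord p 9),
     3 * std_t * g2c_coord p 8, 0, std_r * g2c_coord p 3, \<i> * std_r * (g2c_coord p 0 - g2c_coord p 1),
     - std_r * g2c_coord p 7, 3 * std_t * g2c_coord p 10, 2 * \<i> * std_t * g2c_coord p 13, std_r * g2c_coord p 8,
     - 2 * \<i> * std_t * g2c_coord p 11, std_t * g2c_coord p 5 - std_r * g2c_coord p 12, \<i> * std_t * g2c_coord p 1,
     std_t * g2c_coord p 4] ! k"
proof -
  have "\<forall>k<14. g2_bracket (g2c_coord std_e) (g2c_coord p) k =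
    [\<i> * (std_r * g2c_coord p 2 + std_t * g2c_coord p 9), - \<i> * (std_r * g2c_coord p 2 + 2 * std_t * g2c_coord p 9),
     3 * std_t * g2c_coord p 8, 0, std_r * g2c_coord p 3, \<i> * std_r * (g2c_coord p 0 - g2c_coord p 1),
     - std_r * g2c_coord p 7, 3 * std_t * g2c_coord p 10, 2 * \<i> * std_t * g2c_coord p 13, std_r * g2c_coord p 8,
     - 2 * \<i> * std_t * g2c_coord p 11, std_t * g2c_coord p 5 - std_r * g2c_coord p 12, \<i> * std_t * g2c_coord p 1,
     std_t * g2c_coord p 4] ! k"
    unfolding all_less_14 by (simp add: g2_bracket_def std_e_coord algebra_simps)
  then show ?thesis unfolding g2c_coord_bracket[OF std_e_in p k] using k by blast
qed

text \<open>In the grading by \<open>root_value 2 1\<close> the bracket with \<open>std_e\<close>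
  lowers the grade by one; after \<open>n\<close> steps nothing is left above grade
  \<open>5 - n\<close>.\<close>

lemma std_e_nilpotent: "g2.complexified.nilpotent_element std_e"
proof -
  have step: "(cbr std_e ^^ n) p \<in> g2c \<and>
      (\<forall>k<14. 5 - int n < root_value 2 1 k \<longrightarrow> g2c_coord ((cbr std_e ^^ n) p) k = 0)" if p: "p \<in> g2c" for n p
  proof (induction n)
    case 0
    have "\<forall>k<14. root_value 2 1 k \<le> (5 :: int)" unfolding all_less_14 by (simp add: root_value_def)
    then have "\<not> 5 - int 0 < root_value 2 1 k" if "k < 14" for k using that by fastforce
    then show ?case using p by simp
  next
    case (Suc n)
    let ?q = "(cbr std_e ^^ n) p"
    have q: "?q \<in> g2c" using Suc by blast
    have c: "\<forall>k<14. 5 - int n < root_value 2 1 k \<longrightarrow> g2c_coord ?q k = 0" using Suc by blast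
    have "\<forall>k<14. 5 - int (Suc n) < root_value 2 1 k \<longrightarrow> g2c_coord (cbr std_e ?q) k = 0"
      using c unfolding all_less_14 by (simp add: std_e_bracket_coord[OF q] root_value_def)
    then show ?case using g2c_closed(3)[OF std_e_in q] by simp
  qed
  \<comment> \<open>The grades run from -5 to 5, eleven in all.\<close>
  have "(cbr std_e ^^ 11) p = 0" if p: "p \<in> g2c" for p
  proof (rule g2c_eqI)
    show "(cbr std_e ^^ 11) p \<in> g2c" using step[OF p] by blast
    show "0 \<in> g2c" by (rule g2c_zero_in)
    have "\<forall>k<14. 5 - int 11 < root_value 2 1 k" unfolding all_less_14 by (simp add: root_value_def)
    then show "g2c_coord ((cbr std_e ^^ 11) p) k = g2c_coord 0 k" if k: "k < 14" for k
      using step[OF p, of 11] k by (simp add: g2c_coord_linear)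
  qed
  then show ?thesis unfolding g2.complexified.nilpotent_element_def using std_e_in by blast
qed

text \<open>Besides \<open>std_e\<close> itself, the centralizer contains the lowest root vector,
  index 6 of grade -5; the explicit matrix of \<open>ad std_e\<close> leaves no further
  freedom.\<close>

lemma std_e_centralizer_dim: "g2.complexified.dim (g2.complexified.centralizer std_e) = 2"
proof (rule g2.complexified.dim_eq_2I[of std_e "root_vector 6"])
  note rt = std_rt_nonzero
  show "std_e \<noteq> 0"
  proof
    assume "std_e = 0"
    then have "g2c_coord std_e 5 = g2c_coord 0 5" by simp
    then show False using rt by (simp add: std_e_coord g2c_coord_linear)
  qed
  show "root_vector 6 \<notin> g2.complexified.span {std_e}"
  proof
    assume "root_vector 6 \<in> g2.complexified.span {std_e}"
    then obtain c where "root_vector 6 = cscale c std_e" unfolding g2.complexified.span_singleton by blast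
    then have "g2c_coord (root_vector 6) 6 = c * g2c_coord std_e 6" by (simp add: g2c_coord_linear)
    then show False by (simp add: root_vector_coord std_e_coord)
  qed
  have cent: "p \<in> g2.complexified.centralizer std_e \<longleftrightarrow> p \<in> g2c \<and> cbr std_e p = 0" for p
    unfolding g2.complexified.centralizer_def using cbr_anti[of p std_e] by auto
  have "cbr std_e std_e = 0" by (rule g2.complexified.br_self[OF std_e_in])
  then show "std_e \<in> g2.complexified.centralizer std_e" unfolding cent using std_e_in by blast
  have "\<forall>k<14. g2c_coord (cbr std_e (root_vector 6)) k = g2c_coord 0 k"
    unfolding all_less_14 by (simp add: std_e_bracket_coord[OF root_vector_in] root_vector_coord g2c_coord_linear)
  then have "cbr std_e (root_vector 6) = 0"
    by (intro g2c_eqI g2c_closed std_e_in root_vector_in g2c_zero_in) simp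
  then show "root_vector 6 \<in> g2.complexified.centralizer std_e" unfolding cent using root_vector_in by blast
  show "g2.complexified.centralizer std_e \<subseteq> g2.complexified.span {std_e, root_vector 6}"
  proof
    fix p assume "p \<in> g2.complexified.centralizer std_e"
    then have p: "p \<in> g2c" "cbr std_e p = 0" unfolding cent by blast+
    have z: "g2c_coord (cbr std_e p) k = 0" if "k < 14" for k
      unfolding p(2) using that by (simp add: g2c_coord_linear)
    have eqs: "std_r * g2c_coord p 2 + std_t * g2c_coord p 9 = 0" "std_r * g2c_coord p 2 + 2 * std_t * g2c_coord p 9 = 0"
      "g2c_coord p 8 = 0" "g2c_coord p 3 = 0" "g2c_coord p 0 = g2c_coord p 1" "g2c_coord p 7 = 0" "g2c_coord p 10 = 0"
      "g2c_coord p 13 = 0" "g2c_coord p 11 = 0" "std_t * g2c_coord p 5 = std_r * g2c_coord p 12" "g2c_coord p 1 = 0"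
      "g2c_coord p 4 = 0"
      using z[of 0] z[of 1] z[of 2] z[of 4] z[of 5] z[of 6] z[of 7] z[of 8] z[of 10] z[of 11] z[of 12] z[of 13] rt
      by (simp_all add: std_e_bracket_coord[OF p(1)])
    \<comment> \<open>The two torus coordinates of the bracket are independent combinations of
      coordinates 2 and 9; their difference isolates 9.\<close>
    have "std_t * g2c_coord p 9 = (std_r * g2c_coord p 2 + 2 * std_t * g2c_coord p 9) - (std_r * g2c_coord p 2 + std_t * g2c_coord p 9)"
      by (simp add: algebra_simps)
    then have "std_t * g2c_coord p 9 = 0" unfolding eqs by simp
    then have z9: "g2c_coord p 9 = 0" "g2c_coord p 2 = 0" using rt eqs(1) by simp_all
    define c where "c = g2c_coord p 12 / std_t"
    have c: "g2c_coord p 12 = c * std_t" "g2c_coord p 5 = c * std_r" using rt eqs(10) by (simp_all add: c_def field_simps)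
    have "\<forall>k<14. g2c_coord p k = g2c_coord (cscale c std_e + cscale (g2c_coord p 6) (root_vector 6)) k"
      unfolding all_less_14
      using eqs z9 c by (simp add: g2c_coord_linear std_e_coord root_vector_coord)
    then have pc: "g2c_coord p k = g2c_coord (cscale c std_e + cscale (g2c_coord p 6) (root_vector 6)) k" if "k < 14" for k
      using that by blast
    have "p = cscale c std_e + cscale (g2c_coord p 6) (root_vector 6)"
      by (rule g2c_eqI[OF p(1) _ pc]) (intro g2c_closed std_e_in root_vector_in)
    also have "cscale c std_e + cscale (g2c_coord p 6) (root_vector 6) \<in> g2.complexified.span {std_e, root_vector 6}"
      by (intro g2.complexified.span_add g2.complexified.span_scale g2.complexified.span_base) simp_all
    finally show "p \<in> g2.complexified.span {std_e, root_vector 6}" .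
  qed
qed

lemma std_principal: "g2.principal_three_dim_subalgebra (span {std_x, std_y, std_z})"
proof -
  let ?s = "span {std_x, std_y, std_z}"
  \<comment> \<open>In complex notation \<open>h = 2 \<i> Z\<close> and
    \<open>f = - X + \<i> Y\<close>, the triple completing \<open>e = X + \<i> Y\<close>.\<close>
  define h f where "h = (0 :: octonion \<Rightarrow>\<^sub>L octonion, 2 *\<^sub>R std_z)" and "f = (- std_x, std_y)"
  have minus: "commutator (- D) E = - commutator D E" "commutator D (- E) = - commutator D E" for D E :: "octonion \<Rightarrow>\<^sub>L octonion"
    by (rule blinfun_eqI, simp add: commutator_apply blinfun.bilinear_simps)+
  have rev: "commutator std_y std_x = - std_z" "commutator std_z std_y = - std_x" "commutator std_x std_z = - std_y"
    using commutator_anti[of std_y std_x] commutator_anti[of std_z std_y] commutator_anti[of std_x std_z]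
    unfolding std_brackets by (simp_all only:)
  note br = std_brackets rev minus commutator_linear
  have z2: "0 \<in> g2" using g2c_zero_in by (simp add: complexify_def zero_prod_def)
  have hf: "h \<in> g2c" "f \<in> g2c"
  proof -
    have "2 *\<^sub>R std_z \<in> g2" "- std_x \<in> g2"
      using std_in_g2 g2.subspace_G unfolding subspace_raw_def[symmetric] by (simp_all add: subspace_scale subspace_neg)
    then show "h \<in> g2c" "f \<in> g2c" using z2 std_in_g2 by (simp_all add: h_def f_def complexify_def)
  qed
  have "cbr h std_e = cscale 2 std_e" "cbr h f = cscale (- 2) f" "cbr std_e f = h"
    by (simp_all add: h_def f_def std_e_def cbracket_def cscale_def br scaleR_2)
  then have triple: "g2.complexified.sl2_triple std_e h f"
    unfolding g2.complexified.sl2_triple_def using std_e_in hf by blast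
  have nil: "g2.complexified.principal_nilpotent std_e"
    unfolding g2.complexified.principal_nilpotent_def g2c_rank
    using std_e_nilpotent std_e_centralizer_dim by blast
  let ?S = "g2.complexified.span {std_e, h, f}"
  have sp: "complexify ?s = ?S"
  proof
    have gen: "std_e \<in> ?S" "h \<in> ?S" "f \<in> ?S" by (simp_all add: g2.complexified.span_base)
    note cl = g2.complexified.span_add g2.complexified.span_scale
    have e: "(std_x, 0) = cscale (1 / 2) (std_e + cscale (- 1) f)" "(std_y, 0) = cscale (- \<i> / 2) (std_e + f)"
      "(std_z, 0) = cscale (- \<i> / 2) h"
      by (simp_all add: h_def f_def std_e_def cscale_def scaleR_2[symmetric])
    have b: "(std_x, 0) \<in> ?S" "(std_y, 0) \<in> ?S" "(std_z, 0) \<in> ?S" unfolding e by (intro cl gen)+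
    have r: "(x, 0) \<in> ?S" if xs: "x \<in> ?s" for x
    proof -
      obtain a b' c where x: "x = a *\<^sub>R std_x + b' *\<^sub>R std_y + c *\<^sub>R std_z" by (rule std_combination[OF xs])
      have "(x, 0) = cscale (complex_of_real a) (std_x, 0) + cscale (complex_of_real b') (std_y, 0)
          + cscale (complex_of_real c) (std_z, 0)"
        by (simp add: x cscale_def)
      also have "\<dots> \<in> ?S" by (intro cl b)
      finally show ?thesis .
    qed
    show "complexify ?s \<subseteq> ?S"
    proof
      fix p assume "p \<in> complexify ?s"
      then have m: "fst p \<in> ?s" "snd p \<in> ?s" by (simp_all add: complexify_def mem_Times_iff)
      have "p = (fst p, 0) + cscale \<i> (snd p, 0)" by (simp add: cscale_def prod_eq_iff)
      also have "\<dots> \<in> ?S" by (intro cl r m)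
      finally show "p \<in> ?S" .
    qed
    have s: "std_x \<in> ?s" "std_y \<in> ?s" "std_z \<in> ?s" "0 \<in> ?s" "- std_x \<in> ?s" "2 *\<^sub>R std_z \<in> ?s"
      by (simp_all add: span_base span_zero span_neg span_scale)
    have "g2.complexified.subspace (complexify ?s)"
      unfolding g2.complexified.subspace_def complexify_def
      by (simp add: mem_Times_iff cscale_def span_zero span_add span_diff span_scale del: split_paired_All)
    moreover have "{std_e, h, f} \<subseteq> complexify ?s"
      using s by (simp add: std_e_def h_def f_def complexify_def)
    ultimately show "?S \<subseteq> complexify ?s" by (intro g2.complexified.span_minimal)
  qed
  show ?thesis
    unfolding g2.principal_three_dim_subalgebra_def g2.complexified.principal_subalgebra_def
    using std_simple std_dim triple nil sp unfolding dim_raw_def by blast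
qed

theorem proposition3p14:
  shows "(\<exists>\<ss>. g2.principal_three_dim_subalgebra \<ss>) \<and>
    (\<forall>\<ss> \<ss>'. g2.principal_three_dim_subalgebra \<ss> \<and> g2.principal_three_dim_subalgebra \<ss>' \<longrightarrow>
      (\<exists>\<Psi>. g2.automorphism \<Psi> \<and> \<Psi> ` \<ss> = \<ss>'))"
proof (intro conjI allI impI)
  show "\<exists>\<ss>. g2.principal_three_dim_subalgebra \<ss>" using std_principal by blast
next
  fix \<ss> \<ss>' assume "g2.principal_three_dim_subalgebra \<ss> \<and> g2.principal_three_dim_subalgebra \<ss>'"
  then have s: "g2.principal_three_dim_subalgebra \<ss>" and s': "g2.principal_three_dim_subalgebra \<ss>'" by blast+
  obtain F F' where F: "oct_automorphism_pair F F'" "oct_conj F F' ` \<ss> = span {std_x, std_y, std_z}"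
    by (rule principal_conjugate_std[OF s])
  obtain G G' where G: "oct_automorphism_pair G G'" "oct_conj G G' ` \<ss>' = span {std_x, std_y, std_z}"
    by (rule principal_conjugate_std[OF s'])
  note G' = oct_automorphism_pair_swap[OF G(1)]
  \<comment> \<open>Both subalgebras have been moved onto the standard copy; the first conjugation
    is followed by the inverse of the second.\<close>
  have "oct_conj (G' o\<^sub>L F) (F' o\<^sub>L G) ` \<ss> = oct_conj G' G ` oct_conj F F' ` \<ss>"
    by (simp add: image_image oct_conj_compose)
  also have "\<dots> = oct_conj G' G ` oct_conj G G' ` \<ss>'" unfolding F(2) G(2) ..
  also have "\<dots> = \<ss>'" by (simp add: image_image oct_conj_id[OF G(1)])
  finally have "oct_conj (G' o\<^sub>L F) (F' o\<^sub>L G) ` \<ss> = \<ss>'" .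
  moreover have "g2.automorphism (oct_conj (G' o\<^sub>L F) (F' o\<^sub>L G))"
    by (rule oct_conj_automorphism[OF oct_automorphism_pair_compose[OF F(1) G']])
  ultimately show "\<exists>\<Psi>. g2.automorphism \<Psi> \<and> \<Psi> ` \<ss> = \<ss>'" by blast
qed

end
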